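(* Let $\mathrm{K}\in\{\mathrm{III},\mathrm{IV}\}$, let $[D,\mathrm{K}]$ be an admissible scatterer, and let $U=U(U^{in};[D,\mathrm{K}])$ be the solution to the elastic scattering problem for $[D,\mathrm{K}]$ with incident plane wave $U^{in}$. Define $$v_p:=-\nabla\cdot U,\qquad E_s:=\nabla\wedge U .$$ Then $$U=U_s+U_p,\qquad U_s=\frac{1}{k_s^2}\nabla\wedge E_s,\qquad U_p=\frac{1}{k_p^2}\nabla v_p .$$ Moreover, set $v_p^{in}:=-\nabla\cdot U^{in}$ and $E_s^{in}:=\nabla\wedge U^{in}$. Then $v_p$ satisfies an acoustic scattering system and $E_s$ satisfies an electromagnetic scattering system, with the correspondences $$v_p(v_p^{in};[D,\mathrm{C(K)}])=-\nabla\cdot U(U^{in};[D,\mathrm{K}]),\qquad E_s(E_s^{in};[D,\mathrm{B(K)}])=\nabla\wedge U(U^{in};[D,\mathrm{K}]),$$ where $$\mathrm{C(K)}=\mathrm{SH},\ \mathrm{B(K)}=\mathrm{PEC}\ \text{ if }\mathrm{K}=\mathrm{III};\qquad \mathrm{C(K)}=\mathrm{SS},\ \mathrm{B(K)}=\mathrm{PMC}\ \text{ if }\mathrm{K}=\mathrm{IV}.$$ That is, $v_p$ solves the acoustic scattering problem for $[D,\mathrm{C(K)}]$ with incident field $v_p^{in}$, and $E_s$ solves the electromagnetic scattering problem for $[D,\mathrm{B(K)}]$ with incident electric field $E_s^{in}$.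
   Context: Constants: $\lambda,\mu\in\mathbb{R}$ with $\mu>0$, $3\lambda+2\mu>0$; $\omega>0$; $k_s=\omega/\sqrt{\mu}$, $k_p=\omega/\sqrt{\lambda+2\mu}$. $\wedge$ is the cross product, $\nabla\wedge$ the curl. Scatterer: $D\subset\mathbb{R}^3$ is a bounded domain with Lipschitz, piecewise $C^{2,1}$-smooth boundary, connected complement $\mathbb{R}^3\setminus\overline D$, and outward unit normal $\nu$. Let $H=\frac12(\kappa_1+\kappa_2)$, $K=\kappa_1\kappa_2$ be the mean and Gaussian curvatures of $\partial D$. Traction: $TU:=2\mu[\nu\cdot\nabla U_j]_{j=1}^3+\lambda\nu(\nabla\cdot U)+\mu\,\nu\wedge(\nabla\wedge U)$. Elastic scattering problem for $[D,\mathrm{K}]$: $(\Delta^*+\omega^2)U=0$ in $\mathbb{R}^3\setminus\overline{D}$ with $\Delta^*U=\mu\Delta U+(\lambda+\mu)\nabla(\nabla\cdot U)$; $U=U^{in}+U^{sc}$; $U^{in}=U^{in}_p+U^{in}_s$, $U_p^{in}=\alpha_p d\,e^{ik_pd\cdot x}$, $U_s^{in}=\alpha_s d^\perp e^{ik_sd\cdot x}$, $d,d^\perp\in\mathbb{S}^2$, $d\cdot d^\perp=0$, $\alpha_p,\alpha_s\in\mathbb{C}$; $U^{sc}$ satisfies the Kupradze radiation condition, i.e. $(\nabla\wedge\nabla\wedge U^{sc})\wedge\frac{x}{\|x\|}-ik_s\nabla\wedge U^{sc}=\mathcal{O}(\|x\|^{-2})$ and $\frac{x}{\|x\|}\cdot\nabla(\nabla\cdot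 U^{sc})-ik_p\nabla\cdot U^{sc}=\mathcal{O}(\|x\|^{-2})$ uniformly in all directions as $\|x\|\to\infty$; and on $\partial D$: for $\mathrm{K}=\mathrm{III}$ (third kind), $\nu\cdot U=0$ and $\nu\wedge TU=0$; for $\mathrm{K}=\mathrm{IV}$ (fourth kind), $\nu\wedge U=0$ and $\nu\cdot TU=0$. The problem has a unique solution, locally $H^1$ up to the boundary, and locally $H^3$ near regular ($C^{2,1}$) pieces of $\partial D$. Decomposition: $U_p:=U_p^{in}+U_p^{sc}$, $U_s:=U_s^{in}+U_s^{sc}$, with $U_p^{sc}:=-k_p^{-2}\nabla(\nabla\cdot U^{sc})$ and $U_s^{sc}:=k_s^{-2}\nabla\wedge(\nabla\wedge U^{sc})$. Admissible: $[D,\mathrm{IV}]$ is admissible if $H=0$ on every regular piece of $\partial D$; $[D,\mathrm{III}]$ is admissible if $H=0$ and $K=0$ on every regular piece of $\partial D$. Acoustic scattering problem for $[D,\mathrm{SS}]$ (sound-soft) or $[D,\mathrm{SH}]$ (sound-hard): $(\Delta+k_p^2)v=0$ in $\mathbb{R}^3\setminus\overline D$, $v=v^{in}+v^{sc}$, $\frac{x}{\|x\|}\cdot\nabla v^{sc}-ik_pv^{sc}=\mathcal{O}(\|x\|^{-2})$ as $\|x\|\to\infty$, and on $\partial D$: $v=0$ (SS), or $\nu\cdot\nabla v=0$ (SH). Its total field is denoted $v_p(v^{in};[D,\mathrm{SS}])$ or $v_p(v^{in};[D,\mathrm{SH}])$. Electromagnetic scattering problem for $[D,\mathrm{PEC}]$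 or $[D,\mathrm{PMC}]$: $\nabla\wedge E-ik_sH_s=0$, $\nabla\wedge H_s+ik_sE=0$ in $\mathbb{R}^3\setminus\overline D$, $E=E^{in}+E^{sc}$, $\frac{x}{\|x\|}\wedge(\nabla\wedge E^{sc})+ik_sE^{sc}=\mathcal{O}(\|x\|^{-2})$ as $\|x\|\to\infty$, and on $\partial D$: $\nu\wedge E=0$ (PEC), or $\nu\wedge(\nabla\wedge E)=0$ (PMC). Its total electric field is denoted $E_s(E^{in};[D,\mathrm{PEC}])$ or $E_s(E^{in};[D,\mathrm{PMC}])$. *)

theory Defs
  imports "HOL-Analysis.Analysis" "HOL-Library.Landau_Symbols"
begin

section \<open>Vector calculus for complex fields on three-dimensional space\<close>

definition pderiv_at :: "'n::finite \<Rightarrow> (real^'n \<Rightarrow> 'b::real_normed_vector) \<Rightarrow> real^'n \<Rightarrow> 'b" where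
  "pderiv_at i f x = frechet_derivative f (at x) (axis i 1)"

definition iter_pderiv :: "'n::finite list \<Rightarrow> (real^'n \<Rightarrow> 'b::real_normed_vector) \<Rightarrow> real^'n \<Rightarrow> 'b" where
  "iter_pderiv js f = foldr pderiv_at js f"

definition smooth_on :: "(real^'n::finite) set \<Rightarrow> (real^'n \<Rightarrow> 'b::real_normed_vector) \<Rightarrow> bool" where
  "smooth_on S f \<longleftrightarrow> (\<forall>js. \<forall>x\<in>S. iter_pderiv js f differentiable (at x))"

text \<open>On complex vectors the dot product is bilinear (no conjugation), and the
  cross product is the complex bilinear extension of the real one.\<close>

definition cdot :: "complex^3 \<Rightarrow> complex^3 \<Rightarrow> complex" where
  "cdot a b = (\<Sum>i\<in>UNIV. a $ i * b $ i)"

definition ccross :: "complex^3 \<Rightarrow> complex^3 \<Rightarrow> complex^3" where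
  "ccross a b = vector [a$2 * b$3 - a$3 * b$2, a$3 * b$1 - a$1 * b$3, a$1 * b$2 - a$2 * b$1]"

definition cvec :: "real^3 \<Rightarrow> complex^3" where
  "cvec x = (\<chi> i. complex_of_real (x $ i))"

definition gradient :: "(real^3 \<Rightarrow> complex) \<Rightarrow> real^3 \<Rightarrow> complex^3" where
  "gradient f x = (\<chi> i. pderiv_at i f x)"

definition divergence :: "(real^3 \<Rightarrow> complex^3) \<Rightarrow> real^3 \<Rightarrow> complex" where
  "divergence U x = (\<Sum>i\<in>UNIV. pderiv_at i U x $ i)"

definition curl :: "(real^3 \<Rightarrow> complex^3) \<Rightarrow> real^3 \<Rightarrow> complex^3" where
  "curl U x = vector [pderiv_at 2 U x $ 3 - pderiv_at 3 U x $ 2,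
                      pderiv_at 3 U x $ 1 - pderiv_at 1 U x $ 3,
                      pderiv_at 1 U x $ 2 - pderiv_at 2 U x $ 1]"

definition laplacian :: "(real^3 \<Rightarrow> 'b::real_normed_vector) \<Rightarrow> real^3 \<Rightarrow> 'b" where
  "laplacian f x = (\<Sum>i\<in>UNIV. pderiv_at i (pderiv_at i f) x)"

section \<open>Domains with Lipschitz, piecewise C2,1 boundary\<close>

text \<open>In the rotated coordinates given by \<open>Q\<close>, \<open>graph_point Q \<phi> s \<tau>\<close> is the point at
  height \<open>\<tau>\<close> above the point of the graph of \<open>\<phi>\<close> over \<open>s\<close>. In a \<open>graph_chart\<close> the set
  \<open>D\<close> lies below the graph; as \<open>\<phi>\<close> will be continuous, the points with \<open>0 < \<tau> < h\<close> then
  lie outside the closure of \<open>D\<close> and those with \<open>\<tau> = 0\<close> form a relatively open part of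
  the boundary.\<close>

definition graph_point :: "real^3^3 \<Rightarrow> (real^2 \<Rightarrow> real) \<Rightarrow> real^2 \<Rightarrow> real \<Rightarrow> real^3" where
  "graph_point Q \<phi> s \<tau> = Q *v vector [s $ 1, s $ 2, \<phi> s + \<tau>]"

definition graph_chart ::
  "(real^3) set \<Rightarrow> real^3^3 \<Rightarrow> (real^2 \<Rightarrow> real) \<Rightarrow> (real^2) set \<Rightarrow> real \<Rightarrow> bool" where
  "graph_chart D Q \<phi> V h \<longleftrightarrow> orthogonal_matrix Q \<and> open V \<and> 0 < h \<and>
     (\<forall>s\<in>V. \<forall>\<tau>. \<bar>\<tau>\<bar> < h \<longrightarrow> (graph_point Q \<phi> s \<tau> \<in> D \<longleftrightarrow> \<tau> < 0))"

definition C21_on :: "(real^2) set \<Rightarrow> (real^2 \<Rightarrow> real) \<Rightarrow> bool" where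
  "C21_on V \<phi> \<longleftrightarrow>
     (\<forall>s\<in>V. \<phi> differentiable (at s)) \<and>
     (\<forall>i. \<forall>s\<in>V. pderiv_at i \<phi> differentiable (at s)) \<and>
     (\<forall>i j. \<exists>L. L-lipschitz_on V (pderiv_at i (pderiv_at j \<phi>)))"

definition lipschitz_boundary :: "(real^3) set \<Rightarrow> bool" where
  "lipschitz_boundary D \<longleftrightarrow> (\<forall>y\<in>frontier D. \<exists>Q \<phi> V h L s.
     graph_chart D Q \<phi> V h \<and> L-lipschitz_on V \<phi> \<and> s \<in> V \<and> y = graph_point Q \<phi> s 0)"

definition C21_chart ::
  "(real^3) set \<Rightarrow> real^3^3 \<Rightarrow> (real^2 \<Rightarrow> real) \<Rightarrow> (real^2) set \<Rightarrow> bool" where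
  "C21_chart D Q \<phi> V \<longleftrightarrow> C21_on V \<phi> \<and> (\<exists>h. graph_chart D Q \<phi> V h)"

definition regular_points :: "(real^3) set \<Rightarrow> (real^3) set" where
  "regular_points D = {y. \<exists>Q \<phi> V s. C21_chart D Q \<phi> V \<and> s \<in> V \<and> y = graph_point Q \<phi> s 0}"

definition regular_pieces :: "(real^3) set \<Rightarrow> (real^3) set set" where
  "regular_pieces D = components (regular_points D)"

text \<open>Finitely many regular pieces; the edges and vertices are covered by finitely
  many Lipschitz curves.\<close>

definition piecewise_C21_boundary :: "(real^3) set \<Rightarrow> bool" where
  "piecewise_C21_boundary D \<longleftrightarrow> finite (regular_pieces D) \<and>
     (\<exists>\<Gamma> :: (real \<Rightarrow> real^3) set. finite \<Gamma> \<and>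
        (\<forall>\<gamma>\<in>\<Gamma>. \<exists>L. L-lipschitz_on {0..1} \<gamma>) \<and>
        frontier D - regular_points D \<subseteq> (\<Union>\<gamma>\<in>\<Gamma>. \<gamma> ` {0..1}))"

definition scatterer :: "(real^3) set \<Rightarrow> bool" where
  "scatterer D \<longleftrightarrow> open D \<and> connected D \<and> D \<noteq> {} \<and> bounded D \<and> connected (- closure D) \<and>
     lipschitz_boundary D \<and> piecewise_C21_boundary D"

text \<open>Outward unit normal at the boundary point \<open>graph_point Q \<phi> s 0\<close>; it depends on that
  point only, not on the chart.\<close>

definition unit_normal :: "real^3^3 \<Rightarrow> (real^2 \<Rightarrow> real) \<Rightarrow> real^2 \<Rightarrow> real^3" where
  "unit_normal Q \<phi> s = Q *v sgn (vector [- pderiv_at 1 \<phi> s, - pderiv_at 2 \<phi> s, 1])"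

text \<open>The principal curvatures at a regular point \<open>y\<close> are the two eigenvalues of the
  Weingarten map (the differential of the unit normal on the tangent plane), here read in
  a chart \<open>P s = graph_point Q \<phi> s 0\<close>: the eigenvectors are \<open>dP w\<close> for tangent
  coordinates \<open>w\<close>. The pair exists at every regular point and is unique up to order.\<close>

definition principal_curvatures :: "(real^3) set \<Rightarrow> real^3 \<Rightarrow> real \<Rightarrow> real \<Rightarrow> bool" where
  "principal_curvatures D y \<kappa>1 \<kappa>2 \<longleftrightarrow> (\<exists>Q \<phi> V s w1 w2.
     C21_chart D Q \<phi> V \<and> s \<in> V \<and> y = graph_point Q \<phi> s 0 \<and>
     w1 \<noteq> w2 \<and> independent {w1, w2} \<and>
     frechet_derivative (unit_normal Q \<phi>) (at s) w1 =
       \<kappa>1 *\<^sub>R frechet_derivative (\<lambda>s. graph_point Q \<phi> s 0) (at s) w1 \<and>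
     frechet_derivative (unit_normal Q \<phi>) (at s) w2 =
       \<kappa>2 *\<^sub>R frechet_derivative (\<lambda>s. graph_point Q \<phi> s 0) (at s) w2)"

definition zero_mean_curvature_at :: "(real^3) set \<Rightarrow> real^3 \<Rightarrow> bool" where
  "zero_mean_curvature_at D y \<longleftrightarrow>
     (\<forall>\<kappa>1 \<kappa>2. principal_curvatures D y \<kappa>1 \<kappa>2 \<longrightarrow> (\<kappa>1 + \<kappa>2) / 2 = 0)"

definition zero_gaussian_curvature_at :: "(real^3) set \<Rightarrow> real^3 \<Rightarrow> bool" where
  "zero_gaussian_curvature_at D y \<longleftrightarrow>
     (\<forall>\<kappa>1 \<kappa>2. principal_curvatures D y \<kappa>1 \<kappa>2 \<longrightarrow> \<kappa>1 * \<kappa>2 = 0)"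

section \<open>Sobolev regularity and traces\<close>

text \<open>All fields considered are smooth in the open exterior (interior elliptic regularity),
  so their weak derivatives there are the classical ones.\<close>

definition sobolev_bounded :: "nat \<Rightarrow> (real^3) set \<Rightarrow> (real^3 \<Rightarrow> 'b::real_normed_vector) \<Rightarrow> bool" where
  "sobolev_bounded k S f \<longleftrightarrow> (\<forall>js. length js \<le> k \<longrightarrow>
     (\<integral>\<^sup>+x\<in>S. ennreal ((norm (iter_pderiv js f x))\<^sup>2) \<partial>lborel) < \<infinity>)"

definition H1_loc_up_to_boundary :: "(real^3) set \<Rightarrow> (real^3 \<Rightarrow> 'b::real_normed_vector) \<Rightarrow> bool" where
  "H1_loc_up_to_boundary D f \<longleftrightarrow> (\<forall>R. sobolev_bounded 1 (ball 0 R - closure D) f)"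

definition Hk_near_regular_pieces ::
  "nat \<Rightarrow> (real^3) set \<Rightarrow> (real^3 \<Rightarrow> 'b::real_normed_vector) \<Rightarrow> bool" where
  "Hk_near_regular_pieces k D f \<longleftrightarrow>
     (\<forall>y\<in>regular_points D. \<exists>W. open W \<and> y \<in> W \<and> sobolev_bounded k (W - closure D) f)"

text \<open>\<open>vanishes_on_boundary D B\<close> says that the trace from outside of \<open>x \<mapsto> B \<nu> x\<close> on the
  regular part of the boundary is zero, where the first argument of \<open>B\<close> is the outward unit
  normal at the boundary point. The trace of a function that is \<open>H\<^sup>1\<close> near the regular
  pieces is the local \<open>L\<^sup>2\<close> limit of its restrictions to the translated surfaces
  \<open>\<tau> = const\<close>, \<open>\<tau> \<rightarrow> 0+\<close>. Lebesgue measure in the chart is locally equivalent to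
  surface measure. Nonnegative integrals are used because the Bochner integral of a
  non-integrable function is 0.\<close>

definition vanishes_on_boundary ::
  "(real^3) set \<Rightarrow> (real^3 \<Rightarrow> real^3 \<Rightarrow> 'b::real_normed_vector) \<Rightarrow> bool" where
  "vanishes_on_boundary D B \<longleftrightarrow> (\<forall>Q \<phi> V C.
     C21_chart D Q \<phi> V \<and> compact C \<and> C \<subseteq> V \<longrightarrow>
     ((\<lambda>\<tau>. \<integral>\<^sup>+s\<in>C. ennreal ((norm (B (unit_normal Q \<phi> s) (graph_point Q \<phi> s \<tau>)))\<^sup>2) \<partial>lborel)
        \<longlongrightarrow> 0) (at_right 0))"

section \<open>The scattering problems\<close>

datatype elastic_kind = Third_Kind | Fourth_Kind
datatype acoustic_kind = Sound_Soft | Sound_Hard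
datatype em_kind = PEC | PMC

definition admissible :: "(real^3) set \<Rightarrow> elastic_kind \<Rightarrow> bool" where
  "admissible D K \<longleftrightarrow> scatterer D \<and> (\<forall>\<Gamma>\<in>regular_pieces D. \<forall>y\<in>\<Gamma>.
     (case K of
        Third_Kind \<Rightarrow> zero_mean_curvature_at D y \<and> zero_gaussian_curvature_at D y
      | Fourth_Kind \<Rightarrow> zero_mean_curvature_at D y))"

definition traction ::
  "real \<Rightarrow> real \<Rightarrow> (real^3 \<Rightarrow> complex^3) \<Rightarrow> real^3 \<Rightarrow> real^3 \<Rightarrow> complex^3" where
  "traction lam \<mu> U \<nu> x =
     (2 * \<mu>) *\<^sub>R (\<chi> j. cdot (cvec \<nu>) (gradient (\<lambda>z. U z $ j) x))
     + lam *\<^sub>R (divergence U x *s cvec \<nu>)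
     + \<mu> *\<^sub>R ccross (cvec \<nu>) (curl U x)"

definition kupradze_radiation :: "real \<Rightarrow> real \<Rightarrow> (real^3 \<Rightarrow> complex^3) \<Rightarrow> bool" where
  "kupradze_radiation ks kp U \<longleftrightarrow>
     (\<lambda>x. norm (ccross (curl (curl U) x) (cvec (sgn x)) - (\<i> * complex_of_real ks) *s curl U x))
        \<in> O[at_infinity](\<lambda>x. 1 / (norm x)\<^sup>2) \<and>
     (\<lambda>x. norm (cdot (cvec (sgn x)) (gradient (divergence U) x)
                 - \<i> * complex_of_real kp * divergence U x))
        \<in> O[at_infinity](\<lambda>x. 1 / (norm x)\<^sup>2)"

definition elastic_solution ::
  "real \<Rightarrow> real \<Rightarrow> real \<Rightarrow> (real^3) set \<Rightarrow> elastic_kind \<Rightarrow>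
   (real^3 \<Rightarrow> complex^3) \<Rightarrow> (real^3 \<Rightarrow> complex^3) \<Rightarrow> bool" where
  "elastic_solution lam \<mu> \<omega> D K Uin U \<longleftrightarrow>
     smooth_on (- closure D) U \<and>
     H1_loc_up_to_boundary D U \<and>
     Hk_near_regular_pieces 3 D U \<and>
     (\<forall>x\<in>- closure D. \<mu> *\<^sub>R laplacian U x + (lam + \<mu>) *\<^sub>R gradient (divergence U) x
                       + \<omega>\<^sup>2 *\<^sub>R U x = 0) \<and>
     kupradze_radiation (\<omega> / sqrt \<mu>) (\<omega> / sqrt (lam + 2 * \<mu>)) (\<lambda>x. U x - Uin x) \<and>
     (case K of
        Third_Kind \<Rightarrow>
          vanishes_on_boundary D (\<lambda>\<nu> x. cdot (cvec \<nu>) (U x)) \<and>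
          vanishes_on_boundary D (\<lambda>\<nu> x. ccross (cvec \<nu>) (traction lam \<mu> U \<nu> x))
      | Fourth_Kind \<Rightarrow>
          vanishes_on_boundary D (\<lambda>\<nu> x. ccross (cvec \<nu>) (U x)) \<and>
          vanishes_on_boundary D (\<lambda>\<nu> x. cdot (cvec \<nu>) (traction lam \<mu> U \<nu> x)))"

text \<open>The \<open>H\<^sup>2\<close> regularity near the regular pieces in the next two definitions is what
  gives the boundary conditions on first derivatives a meaning as traces.\<close>

definition acoustic_solution ::
  "real \<Rightarrow> (real^3) set \<Rightarrow> acoustic_kind \<Rightarrow> (real^3 \<Rightarrow> complex) \<Rightarrow> (real^3 \<Rightarrow> complex) \<Rightarrow> bool" where
  "acoustic_solution kp D C vin v \<longleftrightarrow>
     smooth_on (- closure D) v \<and>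
     Hk_near_regular_pieces 2 D v \<and>
     (\<forall>x\<in>- closure D. laplacian v x + kp\<^sup>2 *\<^sub>R v x = 0) \<and>
     (let vsc = (\<lambda>x. v x - vin x) in
       (\<lambda>x. norm (cdot (cvec (sgn x)) (gradient vsc x) - \<i> * complex_of_real kp * vsc x))
         \<in> O[at_infinity](\<lambda>x. 1 / (norm x)\<^sup>2)) \<and>
     (case C of
        Sound_Soft \<Rightarrow> vanishes_on_boundary D (\<lambda>\<nu> x. v x)
      | Sound_Hard \<Rightarrow> vanishes_on_boundary D (\<lambda>\<nu> x. cdot (cvec \<nu>) (gradient v x)))"

definition em_solution ::
  "real \<Rightarrow> (real^3) set \<Rightarrow> em_kind \<Rightarrow> (real^3 \<Rightarrow> complex^3) \<Rightarrow> (real^3 \<Rightarrow> complex^3) \<Rightarrow> bool" where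
  "em_solution ks D B Ein E \<longleftrightarrow>
     smooth_on (- closure D) E \<and>
     Hk_near_regular_pieces 2 D E \<and>
     (\<exists>H. smooth_on (- closure D) H \<and>
        (\<forall>x\<in>- closure D. curl E x - (\<i> * complex_of_real ks) *s H x = 0 \<and>
                         curl H x + (\<i> * complex_of_real ks) *s E x = 0)) \<and>
     (let Esc = (\<lambda>x. E x - Ein x) in
       (\<lambda>x. norm (ccross (cvec (sgn x)) (curl Esc x) + (\<i> * complex_of_real ks) *s Esc x))
         \<in> O[at_infinity](\<lambda>x. 1 / (norm x)\<^sup>2)) \<and>
     (case B of
        PEC \<Rightarrow> vanishes_on_boundary D (\<lambda>\<nu> x. ccross (cvec \<nu>) (E x))
      | PMC \<Rightarrow> vanishes_on_boundary D (\<lambda>\<nu> x. ccross (cvec \<nu>) (curl E x)))"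

definition plane_wave :: "complex \<Rightarrow> real^3 \<Rightarrow> real \<Rightarrow> real^3 \<Rightarrow> real^3 \<Rightarrow> complex^3" where
  "plane_wave \<alpha> p k d x = (\<alpha> * exp (\<i> * complex_of_real (k * (d \<bullet> x)))) *s cvec p"

fun acoustic_kind_of :: "elastic_kind \<Rightarrow> acoustic_kind" where
  "acoustic_kind_of Third_Kind = Sound_Hard"
| "acoustic_kind_of Fourth_Kind = Sound_Soft"

fun em_kind_of :: "elastic_kind \<Rightarrow> em_kind" where
  "em_kind_of Third_Kind = PEC"
| "em_kind_of Fourth_Kind = PMC"

end

theory Submission
  imports Defs
begin

text \<open>
  In the exterior the decoupling is algebra. Since \<open>curl (curl U) = gradient (divergence U) - laplacian U\<close>,
  the Navier equation reads
  \<open>U = (1 / ks\<^sup>2) *\<^sub>R curl (curl U) - (1 / kp\<^sup>2) *\<^sub>R gradient (divergence U)\<close> (\<open>helmholtz_decomposition\<close>).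
  Its divergence and its curl are the Helmholtz equation for \<open>divergence U\<close> and the Maxwell equation for
  \<open>curl U\<close>. The incident plane waves are eigenfields of the two terms, so the scattered parts split in the same way, and
  the two halves of the Kupradze condition are the two radiation conditions.

  The boundary conditions need geometry. Fourth kind: \<open>U\<close> is normal on the boundary, and differentiating this
  along the boundary shows that the tangential part of the divergence is proportional to the mean curvature, hence
  zero. What remains of the divergence is the normal derivative of the normal component, of which the normal traction is a
  nonzero multiple. Hence \<open>divergence U\<close> vanishes on the boundary, so does its tangential gradient, and
  the differential equation turns this into the condition on \<open>curl (curl U)\<close>
  (\<open>fourth_kind_divergence\<close>, \<open>fourth_kind_curl_curl\<close>). Third kind: the regular pieces are
  flat, so the normal is locally constant. Differentiating the condition on the normal component of \<open>U\<close> reduces the tangential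
  traction to a multiple of the tangential part of \<open>curl U\<close>, which therefore vanishes; differentiating once more, the surface
  curl of \<open>curl U\<close> vanishes, and this is the normal component of \<open>curl (curl U)\<close>. The differential equation then gives
  the normal derivative of the divergence (\<open>third_kind_curl\<close>, \<open>third_kind_normal_gradient\<close>).

  Boundary values are \<open>L\<^sup>2\<close> limits of slices parallel to the boundary, and the whole argument differentiates such
  limits. Two facts make this possible. Slices of a function that is \<open>H\<^sup>1\<close> near the boundary form a Cauchy family as their
  height tends to zero (\<open>slice_cauchy_H1\<close>); the \<open>H\<^sup>3\<close> regularity of \<open>U\<close> provides this for derivatives up to
  order two. And if slices tend to zero while their tangential derivatives form a Cauchy family, then these derivatives tend to
  zero, too (\<open>slice_null_pderiv\<close>). Vanishing curvature is translated into vanishing combinations of second derivatives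
  of a graph function by exhibiting the principal directions (\<open>principal_curvatures_chart\<close>).\<close>

section \<open>Partial derivatives\<close>

lemma pderiv_at_eqI:
  assumes "(f has_derivative f') (at x)"
  shows "pderiv_at i f x = f' (axis i 1)"
  using frechet_derivative_at[OF assms] by (simp add: pderiv_at_def)

lemma has_derivative_pderiv_sum:
  fixes f :: "real^'n::finite \<Rightarrow> 'b::real_normed_vector"
  assumes "f differentiable at x"
  shows "(f has_derivative (\<lambda>w. \<Sum>k\<in>UNIV. w $ k *\<^sub>R pderiv_at k f x)) (at x)"
proof -
  let ?f' = "frechet_derivative f (at x)"
  have d: "(f has_derivative ?f') (at x)" using assms frechet_derivative_works by blast
  interpret bounded_linear ?f' using d by (rule has_derivative_bounded_linear)
  have "?f' w = (\<Sum>k\<in>UNIV. w $ k *\<^sub>R pderiv_at k f x)" for w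
  proof -
    have "?f' w = ?f' (\<Sum>k\<in>UNIV. w $ k *\<^sub>R axis k 1)"
      by (simp add: basis_expansion[of w, unfolded scalar_mult_eq_scaleR])
    then show ?thesis by (simp add: sum scaleR pderiv_at_def)
  qed
  then have "?f' = (\<lambda>w. \<Sum>k\<in>UNIV. w $ k *\<^sub>R pderiv_at k f x)" by auto
  then show ?thesis using d by simp
qed

lemma sum_axis_scaleR:
  fixes g :: "'n::finite \<Rightarrow> 'b::real_normed_vector"
  shows "(\<Sum>k\<in>UNIV. axis i c $ k *\<^sub>R g k) = c *\<^sub>R g i"
proof -
  have "axis i c $ k *\<^sub>R g k = (if k = i then c *\<^sub>R g k else 0)" for k by (simp add: axis_def)
  then show ?thesis by simp
qed

lemma pderiv_at_cong_open:
  assumes "open S" "x \<in> S" "\<And>y. y \<in> S \<Longrightarrow> f y = g y"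
  shows "pderiv_at i f x = pderiv_at i g x"
proof -
  have "(f has_derivative f') (at x) \<longleftrightarrow> (g has_derivative f') (at x)" for f'
    using assms has_derivative_transform_within_open[of f f' x UNIV S g]
      has_derivative_transform_within_open[of g f' x UNIV S f] by auto
  then show ?thesis by (simp add: pderiv_at_def frechet_derivative_def)
qed

lemma differentiable_cong_open:
  assumes "open S" "x \<in> S" "\<And>y. y \<in> S \<Longrightarrow> f y = g y" "f differentiable at x"
  shows "g differentiable at x"
  using assms has_derivative_transform_within_open[of f _ x UNIV S g]
  unfolding differentiable_def by blast

lemma pderiv_at_bounded_linear:
  assumes "bounded_linear L" "f differentiable at x"
  shows "pderiv_at i (\<lambda>y. L (f y)) x = L (pderiv_at i f x)"
  using pderiv_at_eqI[OF bounded_linear.has_derivative[OF assms(1) has_derivative_pderiv_sum[OF assms(2)]]]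
  by (simp add: sum_axis_scaleR)

lemma pderiv_at_add:
  assumes "f differentiable at x" "g differentiable at x"
  shows "pderiv_at i (\<lambda>y. f y + g y) x = pderiv_at i f x + pderiv_at i g x"
  using pderiv_at_eqI[OF has_derivative_add[OF has_derivative_pderiv_sum[OF assms(1)]
    has_derivative_pderiv_sum[OF assms(2)]]]
  by (simp add: sum_axis_scaleR)

lemma pderiv_at_diff:
  assumes "f differentiable at x" "g differentiable at x"
  shows "pderiv_at i (\<lambda>y. f y - g y) x = pderiv_at i f x - pderiv_at i g x"
  using pderiv_at_eqI[OF has_derivative_diff[OF has_derivative_pderiv_sum[OF assms(1)]
    has_derivative_pderiv_sum[OF assms(2)]]]
  by (simp add: sum_axis_scaleR)

lemma pderiv_at_sum:
  assumes "finite I" "\<And>k. k \<in> I \<Longrightarrow> f k differentiable at x"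
  shows "pderiv_at i (\<lambda>y. \<Sum>k\<in>I. f k y) x = (\<Sum>k\<in>I. pderiv_at i (f k) x)"
  using assms
proof (induction I rule: finite_induct)
  case empty
  then show ?case using pderiv_at_eqI[of "\<lambda>y. 0" "\<lambda>y. 0" x i] by simp
next
  case (insert a I)
  then show ?case by (simp add: pderiv_at_add)
qed

lemma differentiable_bounded_linear:
  assumes "bounded_linear L" "f differentiable at x"
  shows "(\<lambda>y. L (f y)) differentiable at x"
  using assms bounded_linear.has_derivative unfolding differentiable_def by blast

subsection \<open>Symmetry of second derivatives\<close>

text \<open>The second difference is compared with the derivative of one first-order partial
  derivative; exchanging the roles of the two directions then gives Young's theorem.\<close>

lemma second_difference_bound:
  fixes f :: "real^'n::finite \<Rightarrow> 'b::real_normed_vector"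
  assumes r: "r > 0" "\<And>y. y \<in> ball x r \<Longrightarrow> f differentiable at y"
    and P: "(pderiv_at i f has_derivative P) (at x)" and e: "e > 0"
  shows "\<exists>d>0. \<forall>t. 0 < t \<and> t < d \<longrightarrow>
    norm (f (x + t *\<^sub>R axis i 1 + t *\<^sub>R axis j 1) - f (x + t *\<^sub>R axis i 1)
          - f (x + t *\<^sub>R axis j 1) + f x - t\<^sup>2 *\<^sub>R P (axis j 1)) \<le> 3 * e * t\<^sup>2"
proof -
  obtain d0 where d0: "d0 > 0"
    "\<And>y. norm (y - x) < d0 \<Longrightarrow> norm (pderiv_at i f y - pderiv_at i f x - P (y - x)) \<le> e * norm (y - x)"
    using P e unfolding has_derivative_at_alt by blast
  interpret P: bounded_linear P using P by (rule has_derivative_bounded_linear)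
  define d where "d = min d0 r / 2"
  have "d > 0" using d0 r by (simp add: d_def)
  moreover have "norm (f (x + t *\<^sub>R axis i 1 + t *\<^sub>R axis j 1) - f (x + t *\<^sub>R axis i 1)
          - f (x + t *\<^sub>R axis j 1) + f x - t\<^sup>2 *\<^sub>R P (axis j 1)) \<le> 3 * e * t\<^sup>2"
    if t: "0 < t" "t < d" for t
  proof -
    let ?y = "\<lambda>\<sigma>. x + (\<sigma> * t) *\<^sub>R axis i 1 :: real^'n"
    let ?z = "\<lambda>\<sigma>. ?y \<sigma> + t *\<^sub>R axis j 1 :: real^'n"
    define g where "g = (\<lambda>\<sigma>. f (?z \<sigma>) - f (?y \<sigma>) - \<sigma> *\<^sub>R (t\<^sup>2 *\<^sub>R P (axis j 1)))"
    define g' where "g' = (\<lambda>\<sigma>. t *\<^sub>R pderiv_at i f (?z \<sigma>) - t *\<^sub>R pderiv_at i f (?y \<sigma>) - t\<^sup>2 *\<^sub>R P (axis j 1))"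
    have ny: "norm (?y \<sigma> - x) \<le> t" "norm (?z \<sigma> - x) \<le> 2 * t" if "\<sigma> \<in> {0..1}" for \<sigma>
    proof -
      have a: "norm ((\<sigma> * t) *\<^sub>R axis i 1 :: real^'n) \<le> t"
        using that t by (simp add: mult_left_le_one_le abs_mult)
      then show "norm (?y \<sigma> - x) \<le> t" by simp
      have "norm ((\<sigma> * t) *\<^sub>R axis i 1 + t *\<^sub>R axis j 1 :: real^'n) \<le> t + t"
        using a t by (intro norm_triangle_mono) auto
      then show "norm (?z \<sigma> - x) \<le> 2 * t" by (simp add: add.assoc)
    qed
    have line: "((\<lambda>\<sigma>. f (y + (\<sigma> * t) *\<^sub>R axis i 1)) has_vector_derivative t *\<^sub>R pderiv_at i f (y + (\<sigma> * t) *\<^sub>R axis i 1)) (at \<sigma> within {0..1})"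
      if "f differentiable at (y + (\<sigma> * t) *\<^sub>R axis i 1)" for \<sigma> y
    proof -
      have "((\<lambda>\<sigma>. y + (\<sigma> * t) *\<^sub>R axis i 1) has_derivative (\<lambda>h. (h * t) *\<^sub>R axis i 1)) (at \<sigma> within {0..1})"
        by (auto intro!: derivative_eq_intros)
      from has_derivative_compose[OF this has_derivative_pderiv_sum[OF that]]
      show ?thesis unfolding has_vector_derivative_def
        by (simp add: sum_axis_scaleR scaleR_left_commute flip: scaleR_scaleR scaleR_sum_right)
    qed
    have der: "(g has_vector_derivative g' \<sigma>) (at \<sigma> within {0..1})" if s: "\<sigma> \<in> {0..1}" for \<sigma>
    proof -
      have "norm (?y \<sigma> - x) < r" "norm (?z \<sigma> - x) < r" using ny[OF s] t r unfolding d_def by linarith+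
      moreover have "f differentiable at y" if "norm (y - x) < r" for y
        using that by (intro r(2)) (simp add: dist_norm norm_minus_commute)
      ultimately have df: "f differentiable at (?y \<sigma>)" "f differentiable at (?z \<sigma>)" by blast+
      have l2: "((\<lambda>\<sigma>. f (?z \<sigma>)) has_vector_derivative t *\<^sub>R pderiv_at i f (?z \<sigma>)) (at \<sigma> within {0..1})"
        using line[of "x + t *\<^sub>R axis j 1" \<sigma>] df by (simp add: algebra_simps)
      have l1: "((\<lambda>\<sigma>. f (?y \<sigma>)) has_vector_derivative t *\<^sub>R pderiv_at i f (?y \<sigma>)) (at \<sigma> within {0..1})"
        using line[of x \<sigma>] df by (simp add: algebra_simps)
      have l3: "((\<lambda>\<sigma>. \<sigma> *\<^sub>R (t\<^sup>2 *\<^sub>R P (axis j 1))) has_vector_derivative (t\<^sup>2 *\<^sub>R P (axis j 1))) (at \<sigma> within {0..1})"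
        unfolding has_vector_derivative_def by (auto intro!: derivative_eq_intros)
      show ?thesis unfolding g_def g'_def
        using has_vector_derivative_diff[OF has_vector_derivative_diff[OF l2 l1] l3] by simp
    qed
    \<comment> \<open>the linear parts of the two first-order expansions at \<open>x\<close> differ by exactly the subtracted term, and the
      remainders are at most \<open>e * (2 * t)\<close> and \<open>e * t\<close>\<close>
    have bd: "norm (g' \<sigma>) \<le> 3 * e * t\<^sup>2" if s: "\<sigma> \<in> {0..1}" for \<sigma>
    proof -
      let ?R = "\<lambda>y. pderiv_at i f y - pderiv_at i f x - P (y - x)"
      have "P (?z \<sigma> - x) - P (?y \<sigma> - x) = t *\<^sub>R P (axis j 1)"
        by (simp add: P.diff[symmetric] P.scaleR[symmetric])
      then have "g' \<sigma> = t *\<^sub>R (?R (?z \<sigma>) - ?R (?y \<sigma>))"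
        by (simp add: g'_def power2_eq_square algebra_simps flip: scaleR_scaleR)
      moreover have "norm (?R (?z \<sigma>) - ?R (?y \<sigma>)) \<le> e * (2 * t) + e * t"
      proof -
        have "norm (?R (?z \<sigma>)) \<le> e * (2 * t)"
          by (rule order_trans[OF d0(2) mult_left_mono]) (use ny[OF s] t e in \<open>auto simp: d_def\<close>)
        moreover have "norm (?R (?y \<sigma>)) \<le> e * t"
          by (rule order_trans[OF d0(2) mult_left_mono]) (use ny[OF s] t e in \<open>auto simp: d_def\<close>)
        ultimately show ?thesis by (intro order_trans[OF norm_triangle_ineq4 add_mono])
      qed
      ultimately have "norm (g' \<sigma>) \<le> t * (e * (2 * t) + e * t)" using t by simp
      then show ?thesis by (simp add: power2_eq_square algebra_simps)
    qed
    have "norm (g 1 - g 0) \<le> (3 * e * t\<^sup>2) * norm (1 - 0 :: real)"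
    proof (rule differentiable_bound[where S = "{0..1}" and f' = "\<lambda>\<sigma> h. h *\<^sub>R g' \<sigma>"])
      show "(g has_derivative (\<lambda>h. h *\<^sub>R g' \<sigma>)) (at \<sigma> within {0..1})" if "\<sigma> \<in> {0..1}" for \<sigma>
        using der[OF that] by (simp add: has_vector_derivative_def)
      show "onorm (\<lambda>h. h *\<^sub>R g' \<sigma>) \<le> 3 * e * t\<^sup>2" if "\<sigma> \<in> {0..1}" for \<sigma>
        using bd[OF that] by (intro onorm_le) (simp add: mult.commute mult_left_mono)
    qed auto
    then show ?thesis by (simp add: g_def algebra_simps)
  qed
  ultimately show ?thesis by blast
qed

lemma pderiv_at_commute:
  fixes f :: "real^'n::finite \<Rightarrow> 'b::real_normed_vector"
  assumes S: "open S" "x \<in> S" "\<And>y. y \<in> S \<Longrightarrow> f differentiable at y"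
    and "pderiv_at i f differentiable at x" "pderiv_at j f differentiable at x"
  shows "pderiv_at i (pderiv_at j f) x = pderiv_at j (pderiv_at i f) x"
proof -
  obtain r where r: "r > 0" "ball x r \<subseteq> S" using S open_contains_ball by blast
  then have fd: "\<And>y. y \<in> ball x r \<Longrightarrow> f differentiable at y" using S by auto
  obtain P Q where P: "(pderiv_at i f has_derivative P) (at x)" and Q: "(pderiv_at j f has_derivative Q) (at x)"
    using assms(4,5) unfolding differentiable_def by blast
  have "norm (P (axis j 1) - Q (axis i 1)) \<le> 6 * e" if e: "e > 0" for e
  proof -
    obtain d1 where d1: "d1 > 0" "\<And>t. 0 < t \<and> t < d1 \<Longrightarrow>
        norm (f (x + t *\<^sub>R axis i 1 + t *\<^sub>R axis j 1) - f (x + t *\<^sub>R axis i 1)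
          - f (x + t *\<^sub>R axis j 1) + f x - t\<^sup>2 *\<^sub>R P (axis j 1)) \<le> 3 * e * t\<^sup>2"
      using second_difference_bound[OF r(1) fd P e, of j] by blast
    obtain d2 where d2: "d2 > 0" "\<And>t. 0 < t \<and> t < d2 \<Longrightarrow>
        norm (f (x + t *\<^sub>R axis j 1 + t *\<^sub>R axis i 1) - f (x + t *\<^sub>R axis j 1)
          - f (x + t *\<^sub>R axis i 1) + f x - t\<^sup>2 *\<^sub>R Q (axis i 1)) \<le> 3 * e * t\<^sup>2"
      using second_difference_bound[OF r(1) fd Q e, of i] by blast
    define t where "t = min d1 d2 / 2"
    have t: "0 < t" "t < d1" "t < d2" using d1 d2 by (auto simp: t_def)
    let ?A = "f (x + t *\<^sub>R axis i 1 + t *\<^sub>R axis j 1) - f (x + t *\<^sub>R axis i 1) - f (x + t *\<^sub>R axis j 1) + f x"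
    have e1: "norm (?A - t\<^sup>2 *\<^sub>R P (axis j 1)) \<le> 3 * e * t\<^sup>2" using d1 t by blast
    have "x + t *\<^sub>R axis j 1 + t *\<^sub>R axis i 1 = x + t *\<^sub>R axis i 1 + t *\<^sub>R axis j 1"
      by (simp add: algebra_simps)
    then have e2: "norm (?A - t\<^sup>2 *\<^sub>R Q (axis i 1)) \<le> 3 * e * t\<^sup>2" using d2(2)[of t] t
      by (simp add: algebra_simps)
    have "norm ((?A - t\<^sup>2 *\<^sub>R Q (axis i 1)) - (?A - t\<^sup>2 *\<^sub>R P (axis j 1))) \<le> 3 * e * t\<^sup>2 + 3 * e * t\<^sup>2"
      by (rule order_trans[OF norm_triangle_ineq4 add_mono[OF e2 e1]])
    moreover have "(?A - t\<^sup>2 *\<^sub>R Q (axis i 1)) - (?A - t\<^sup>2 *\<^sub>R P (axis j 1)) = t\<^sup>2 *\<^sub>R (P (axis j 1) - Q (axis i 1))"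
      by (simp add: algebra_simps)
    ultimately have "t\<^sup>2 * norm (P (axis j 1) - Q (axis i 1)) \<le> t\<^sup>2 * (6 * e)"
      by (simp only: norm_scaleR) (simp add: mult_ac)
    then show ?thesis using t by simp
  qed
  then have bound: "norm (P (axis j 1) - Q (axis i 1)) \<le> 0 + e" if "e > 0" for e
    using that[THEN divide_pos_pos, of 6] by (metis add_0 nonzero_mult_div_cancel_left times_divide_eq_right zero_less_numeral zero_neq_numeral)
  have "norm (P (axis j 1) - Q (axis i 1)) \<le> 0"
    by (rule field_le_epsilon) (rule bound)
  then show ?thesis using pderiv_at_eqI[OF P, of j] pderiv_at_eqI[OF Q, of i] by simp
qed

subsection \<open>Smooth fields\<close>

lemma iter_pderiv_Nil [simp]: "iter_pderiv [] f = f"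
  and iter_pderiv_Cons [simp]: "iter_pderiv (i # js) f = pderiv_at i (iter_pderiv js f)"
  and iter_pderiv_append: "iter_pderiv (js @ [i]) f = iter_pderiv js (pderiv_at i f)"
  by (simp_all add: iter_pderiv_def)

lemma smooth_on_differentiable: "smooth_on S f \<Longrightarrow> x \<in> S \<Longrightarrow> f differentiable at x"
  unfolding smooth_on_def using iter_pderiv_Nil by metis

lemma smooth_on_pderiv_at: "smooth_on S f \<Longrightarrow> smooth_on S (pderiv_at i f)"
  unfolding smooth_on_def by (metis iter_pderiv_append)

lemma smooth_on_iter_pderiv: "smooth_on S f \<Longrightarrow> smooth_on S (iter_pderiv js f)"
  by (induction js) (auto intro: smooth_on_pderiv_at)

lemma smooth_on_continuous_on:
  assumes "smooth_on S f" shows "continuous_on S f"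
  using assms by (meson continuous_at_imp_continuous_on differentiable_imp_continuous_within smooth_on_differentiable)

lemma smooth_on_subset: "smooth_on S f \<Longrightarrow> T \<subseteq> S \<Longrightarrow> smooth_on T f"
  unfolding smooth_on_def by blast

text \<open>The differential operators below are sums of constant linear maps applied to partial derivatives; their
  smoothness and their Sobolev bounds come from this commutation rule.\<close>

lemma iter_pderiv_sum_bounded_linear:
  assumes S: "open S" and f: "\<And>k. k \<in> I \<Longrightarrow> smooth_on S (f k)" and L: "\<And>k. k \<in> I \<Longrightarrow> bounded_linear (L k)"
    and I: "finite I" and x: "x \<in> S"
  shows "iter_pderiv js (\<lambda>y. \<Sum>k\<in>I. L k (f k y)) x = (\<Sum>k\<in>I. L k (iter_pderiv js (f k) x))"
  using x
proof (induction js arbitrary: x)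
  case (Cons i js)
  have d: "iter_pderiv js (f k) differentiable at x" if "k \<in> I" for k
    using f[OF that] Cons.prems unfolding smooth_on_def by blast
  have "iter_pderiv (i # js) (\<lambda>y. \<Sum>k\<in>I. L k (f k y)) x
      = pderiv_at i (\<lambda>y. \<Sum>k\<in>I. L k (iter_pderiv js (f k) y)) x"
    using Cons.IH by (auto intro: pderiv_at_cong_open[OF S Cons.prems])
  also have "\<dots> = (\<Sum>k\<in>I. pderiv_at i (\<lambda>y. L k (iter_pderiv js (f k) y)) x)"
    by (rule pderiv_at_sum[OF I differentiable_bounded_linear[OF L d]])
  also have "\<dots> = (\<Sum>k\<in>I. L k (pderiv_at i (iter_pderiv js (f k)) x))"
    by (rule sum.cong[OF refl pderiv_at_bounded_linear[OF L d]])
  finally show ?case by simp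
qed simp

lemma smooth_on_sum_bounded_linear:
  assumes S: "open S" and f: "\<And>k. k \<in> I \<Longrightarrow> smooth_on S (f k)" and L: "\<And>k. k \<in> I \<Longrightarrow> bounded_linear (L k)"
    and I: "finite I"
  shows "smooth_on S (\<lambda>y. \<Sum>k\<in>I. L k (f k y))"
  unfolding smooth_on_def
proof (intro allI ballI)
  fix js x assume x: "x \<in> S"
  show "iter_pderiv js (\<lambda>y. \<Sum>k\<in>I. L k (f k y)) differentiable at x"
  proof (rule differentiable_cong_open[OF S x, where f = "\<lambda>y. \<Sum>k\<in>I. L k (iter_pderiv js (f k) y)"])
    show "(\<Sum>k\<in>I. L k (iter_pderiv js (f k) y)) = iter_pderiv js (\<lambda>y. \<Sum>k\<in>I. L k (f k y)) y" if "y \<in> S" for y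
      by (rule iter_pderiv_sum_bounded_linear[symmetric, where I = I]) (fact S | fact f | fact L | fact I | fact that)+
    have "(\<lambda>y. L k (iter_pderiv js (f k) y)) differentiable at x" if "k \<in> I" for k
      using f[OF that] x unfolding smooth_on_def by (intro differentiable_bounded_linear[OF L[OF that]]) blast
    then show "(\<lambda>y. \<Sum>k\<in>I. L k (iter_pderiv js (f k) y)) differentiable at x"
      by (intro differentiable_sum I ballI)
  qed
qed

lemma smooth_on_bounded_linear:
  assumes "open S" "smooth_on S f" "bounded_linear L"
  shows "smooth_on S (\<lambda>y. L (f y))"
  using smooth_on_sum_bounded_linear[of S "{()}" "\<lambda>_. f" "\<lambda>_. L"] assms by simp

lemma smooth_on_diff:
  fixes f g :: "real^'n::finite \<Rightarrow> 'b::real_normed_vector"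
  assumes S: "open S" and f: "smooth_on S f" and g: "smooth_on S g"
  shows "smooth_on S (\<lambda>y. f y - g y)"
proof -
  define F where "F = (\<lambda>b. if b then f else g)"
  define L :: "bool \<Rightarrow> 'b \<Rightarrow> 'b" where "L = (\<lambda>b z. if b then z else - z)"
  have bl: "bounded_linear (L b)" for b
    using bounded_linear_minus[OF bounded_linear_ident] by (cases b) (simp_all add: L_def)
  have sm: "smooth_on S (F b)" for b using f g by (cases b) (simp_all add: F_def)
  have "smooth_on S (\<lambda>y. \<Sum>b\<in>{True, False}. L b (F b y))"
    by (rule smooth_on_sum_bounded_linear[OF S sm bl]) simp
  then show ?thesis by (simp add: L_def F_def)
qed

subsection \<open>First-order operators with constant coefficients\<close>

text \<open>Gradient, divergence and curl are all of the form \<open>\<Sum>k. L k (\<partial>\<^sub>k f)\<close> with constant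
  linear maps \<open>L k\<close>. The rules for sums, smoothness and composition are proved once for this form.\<close>

definition first_order_op ::
  "('n::finite \<Rightarrow> 'b::real_normed_vector \<Rightarrow> 'c::real_normed_vector) \<Rightarrow> (real^'n \<Rightarrow> 'b) \<Rightarrow> real^'n \<Rightarrow> 'c" where
  "first_order_op L f x = (\<Sum>k\<in>UNIV. L k (pderiv_at k f x))"

lemma first_order_op_smooth:
  assumes "open S" "smooth_on S f" "\<And>k. bounded_linear (L k)"
  shows "smooth_on S (first_order_op L f)"
proof -
  have "first_order_op L f = (\<lambda>x. \<Sum>k\<in>UNIV. L k (pderiv_at k f x))" by (simp add: fun_eq_iff first_order_op_def)
  then show ?thesis
    using smooth_on_sum_bounded_linear[of S UNIV "\<lambda>k. pderiv_at k f" L] assms smooth_on_pderiv_at by auto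
qed

lemma first_order_op_diff:
  assumes "f differentiable at x" "g differentiable at x" "\<And>k. bounded_linear (L k)"
  shows "first_order_op L (\<lambda>y. f y - g y) x = first_order_op L f x - first_order_op L g x"
  using assms by (simp add: first_order_op_def pderiv_at_diff linear_diff bounded_linear.linear sum_subtractf)

lemma first_order_op_bounded_linear:
  assumes "f differentiable at x" "bounded_linear A" "\<And>k. bounded_linear (L k)" "\<And>k z. L k (A z) = B (L k z)" "linear B"
  shows "first_order_op L (\<lambda>y. A (f y)) x = B (first_order_op L f x)"
  using assms by (simp add: first_order_op_def pderiv_at_bounded_linear linear_sum)

lemma first_order_op_cong_open:
  assumes "open S" "x \<in> S" "\<And>y. y \<in> S \<Longrightarrow> f y = g y"
  shows "first_order_op L f x = first_order_op L g x"
  using assms pderiv_at_cong_open unfolding first_order_op_def by (metis (no_types, lifting))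

lemma pderiv_at_first_order_op:
  assumes "open S" "smooth_on S f" "\<And>k. bounded_linear (L k)" "x \<in> S"
  shows "pderiv_at j (first_order_op L f) x = (\<Sum>k\<in>UNIV. L k (pderiv_at j (pderiv_at k f) x))"
proof -
  have "first_order_op L f = (\<lambda>x. \<Sum>k\<in>UNIV. L k (pderiv_at k f x))" by (simp add: fun_eq_iff first_order_op_def)
  then show ?thesis
    using iter_pderiv_sum_bounded_linear[of S UNIV "\<lambda>k. pderiv_at k f" L x "[j]"] assms smooth_on_pderiv_at by auto
qed

lemma bounded_linear_euclideanI:
  fixes L :: "'a::euclidean_space \<Rightarrow> 'b::real_normed_vector"
  assumes "\<And>x y. L (x + y) = L x + L y" "\<And>r x. L (r *\<^sub>R x) = r *\<^sub>R L x"
  shows "bounded_linear L"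
  using assms linear_conv_bounded_linear linearI by metis

definition grad_coeff :: "3 \<Rightarrow> complex \<Rightarrow> complex^3" where "grad_coeff k z = axis k z"
definition div_coeff :: "3 \<Rightarrow> complex^3 \<Rightarrow> complex" where "div_coeff k z = z $ k"
definition curl_coeff :: "3 \<Rightarrow> complex^3 \<Rightarrow> complex^3" where "curl_coeff k z = ccross (axis k 1) z"

lemma bounded_linear_coeffs:
  "bounded_linear (grad_coeff k)" "bounded_linear (div_coeff k)" "bounded_linear (curl_coeff k)"
proof -
  show "bounded_linear (grad_coeff k)"
    by (rule bounded_linear_euclideanI) (auto simp: grad_coeff_def axis_def vec_eq_iff)
  have "div_coeff k = (\<lambda>z. z $ k)" by (simp add: div_coeff_def fun_eq_iff)
  then show "bounded_linear (div_coeff k)" by (simp add: bounded_linear_vec_nth)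
  show "bounded_linear (curl_coeff k)"
    by (rule bounded_linear_euclideanI)
      (simp_all add: curl_coeff_def ccross_def vec_eq_iff forall_3 distrib_left scaleR_diff_right)
qed

lemma gradient_eq: "gradient f = first_order_op grad_coeff f"
proof (rule ext)
  fix x
  have "(\<Sum>k\<in>UNIV. axis k (pderiv_at k f x) $ i) = pderiv_at i f x" for i :: 3
  proof -
    have "axis k (pderiv_at k f x) $ i = (if k = i then pderiv_at k f x else 0)" for k
      by (auto simp: axis_def)
    then show ?thesis by simp
  qed
  then show "gradient f x = first_order_op grad_coeff f x"
    unfolding gradient_def first_order_op_def grad_coeff_def by (intro vec_eq_iff[THEN iffD2]) simp
qed

lemma divergence_eq: "divergence f = first_order_op div_coeff f"
  by (simp add: fun_eq_iff divergence_def first_order_op_def div_coeff_def)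

lemma curl_eq: "curl f = first_order_op curl_coeff f"
  by (simp add: fun_eq_iff curl_def first_order_op_def curl_coeff_def ccross_def axis_def sum_3 vec_eq_iff forall_3)

lemmas smooth_on_gradient = first_order_op_smooth[where L = grad_coeff, folded gradient_eq, OF _ _ bounded_linear_coeffs(1)]
lemmas smooth_on_divergence = first_order_op_smooth[where L = div_coeff, folded divergence_eq, OF _ _ bounded_linear_coeffs(2)]
lemmas smooth_on_curl = first_order_op_smooth[where L = curl_coeff, folded curl_eq, OF _ _ bounded_linear_coeffs(3)]
lemmas gradient_diff = first_order_op_diff[where L = grad_coeff, folded gradient_eq, OF _ _ bounded_linear_coeffs(1)]
lemmas divergence_diff = first_order_op_diff[where L = div_coeff, folded divergence_eq, OF _ _ bounded_linear_coeffs(2)]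
lemmas curl_diff = first_order_op_diff[where L = curl_coeff, folded curl_eq, OF _ _ bounded_linear_coeffs(3)]
lemmas gradient_cong = first_order_op_cong_open[where L = grad_coeff, folded gradient_eq]
lemmas divergence_cong = first_order_op_cong_open[where L = div_coeff, folded divergence_eq]
lemmas curl_cong = first_order_op_cong_open[where L = curl_coeff, folded curl_eq]
lemmas pderiv_at_gradient = pderiv_at_first_order_op[where L = grad_coeff, folded gradient_eq, OF _ _ bounded_linear_coeffs(1)]
lemmas pderiv_at_divergence = pderiv_at_first_order_op[where L = div_coeff, folded divergence_eq, OF _ _ bounded_linear_coeffs(2)]
lemmas pderiv_at_curl = pderiv_at_first_order_op[where L = curl_coeff, folded curl_eq, OF _ _ bounded_linear_coeffs(3)]

lemma gradient_scaleC:
  assumes "f differentiable at x" shows "gradient (\<lambda>y. c * f y) x = c *s gradient f x"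
  unfolding gradient_eq
  by (rule first_order_op_bounded_linear[OF assms _ bounded_linear_coeffs(1)])
    (auto intro!: bounded_linear_euclideanI linearI simp: grad_coeff_def axis_def vec_eq_iff algebra_simps)

lemma divergence_scaleC:
  assumes "f differentiable at x" shows "divergence (\<lambda>y. c *s f y) x = c * divergence f x"
  unfolding divergence_eq
  by (rule first_order_op_bounded_linear[OF assms _ bounded_linear_coeffs(2)])
    (auto intro!: bounded_linear_euclideanI linearI simp: div_coeff_def vec_eq_iff algebra_simps)

lemma curl_scaleC:
  assumes "f differentiable at x" shows "curl (\<lambda>y. c *s f y) x = c *s curl f x"
  unfolding curl_eq
  by (rule first_order_op_bounded_linear[OF assms _ bounded_linear_coeffs(3)])
    (auto intro!: bounded_linear_euclideanI linearI simp: curl_coeff_def ccross_def vec_eq_iff forall_3 algebra_simps)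

context
  fixes S :: "(real^3) set"
  assumes S: "open S"
begin

lemma pderiv_at_commute_smooth:
  fixes f :: "real^3 \<Rightarrow> 'b::real_normed_vector"
  assumes "smooth_on S f" "x \<in> S"
  shows "pderiv_at i (pderiv_at j f) x = pderiv_at j (pderiv_at i f) x"
  using assms smooth_on_differentiable smooth_on_pderiv_at by (intro pderiv_at_commute[OF S]) blast+

text \<open>Written in components, the mixed second derivatives match in pairs by symmetry; the same cancellation makes the
  divergence of a curl and the curl of a gradient vanish.\<close>

lemma curl_curl:
  fixes U :: "real^3 \<Rightarrow> complex^3"
  assumes U: "smooth_on S U" and x: "x \<in> S"
  shows "curl (curl U) x = gradient (divergence U) x - laplacian U x"
  unfolding curl_eq[of "curl U"] gradient_eq[of "divergence U"] first_order_op_def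
    pderiv_at_curl[OF S U x] pderiv_at_divergence[OF S U x] laplacian_def
  using pderiv_at_commute_smooth[OF U x, of 1 2] pderiv_at_commute_smooth[OF U x, of 1 3] pderiv_at_commute_smooth[OF U x, of 2 3]
  by (simp add: sum_3 curl_coeff_def grad_coeff_def div_coeff_def ccross_def axis_def vec_eq_iff forall_3 algebra_simps)

lemma divergence_curl:
  fixes U :: "real^3 \<Rightarrow> complex^3"
  assumes U: "smooth_on S U" and x: "x \<in> S"
  shows "divergence (curl U) x = 0"
  unfolding divergence_eq[of "curl U"] first_order_op_def pderiv_at_curl[OF S U x]
  using pderiv_at_commute_smooth[OF U x, of 1 2] pderiv_at_commute_smooth[OF U x, of 1 3] pderiv_at_commute_smooth[OF U x, of 2 3]
  by (simp add: sum_3 curl_coeff_def div_coeff_def ccross_def axis_def algebra_simps)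

lemma curl_gradient:
  fixes f :: "real^3 \<Rightarrow> complex"
  assumes U: "smooth_on S f" and x: "x \<in> S"
  shows "curl (gradient f) x = 0"
  unfolding curl_eq[of "gradient f"] first_order_op_def pderiv_at_gradient[OF S U x]
  using pderiv_at_commute_smooth[OF U x, of 1 2] pderiv_at_commute_smooth[OF U x, of 1 3] pderiv_at_commute_smooth[OF U x, of 2 3]
  by (simp add: sum_3 curl_coeff_def grad_coeff_def ccross_def axis_def vec_eq_iff forall_3 algebra_simps)

lemma divergence_gradient:
  fixes f :: "real^3 \<Rightarrow> complex"
  assumes U: "smooth_on S f" and x: "x \<in> S"
  shows "divergence (gradient f) x = laplacian f x"
  unfolding divergence_eq[of "gradient f"] first_order_op_def pderiv_at_gradient[OF S U x] laplacian_def
  by (simp add: sum_3 div_coeff_def grad_coeff_def axis_def)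

end

section \<open>Boundary traces as limits of slices\<close>

text \<open>The square of the \<open>L\<^sup>2\<close> norm on \<open>C\<close>. It takes values in the extended nonnegative reals, so that
  finiteness never has to be checked before it is used.\<close>

definition sqint :: "'a::euclidean_space set \<Rightarrow> ('a \<Rightarrow> 'b::real_normed_vector) \<Rightarrow> ennreal" where
  "sqint C f = (\<integral>\<^sup>+s\<in>C. ennreal ((norm (f s))\<^sup>2) \<partial>lborel)"

lemma sqint_mono:
  assumes "\<And>s. s \<in> C \<Longrightarrow> norm (f s) \<le> norm (g s)"
  shows "sqint C f \<le> sqint C g"
  unfolding sqint_def using assms by (intro nn_integral_mono) (auto simp: indicator_def intro!: ennreal_leI power_mono)

lemma sqint_cong: "(\<And>s. s \<in> C \<Longrightarrow> f s = g s) \<Longrightarrow> sqint C f = sqint C g"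
  by (intro antisym sqint_mono) auto

lemma measurable_sqint:
  fixes f :: "'a::euclidean_space \<Rightarrow> 'b::real_normed_vector"
  assumes "compact C \<or> open C" "continuous_on C f"
  shows "(\<lambda>s. ennreal ((norm (f s))\<^sup>2) * indicator C s) \<in> borel_measurable borel"
proof -
  have C: "C \<in> sets borel" using assms(1) borel_compact borel_open by blast
  have "(\<lambda>s. indicator C s *\<^sub>R norm (f s)) \<in> borel_measurable borel"
    by (rule borel_measurable_continuous_on_indicator[OF C continuous_on_norm[OF assms(2)]])
  then have "(\<lambda>s. ennreal ((indicator C s *\<^sub>R norm (f s))\<^sup>2)) \<in> borel_measurable borel" by measurable
  moreover have "(\<lambda>s. ennreal ((indicator C s *\<^sub>R norm (f s))\<^sup>2)) = (\<lambda>s. ennreal ((norm (f s))\<^sup>2) * indicator C s)"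
    by (auto simp: fun_eq_iff indicator_def)
  ultimately show ?thesis by metis
qed

text \<open>The constants do not matter for limits zero; this replaces the triangle inequality and avoids square roots
  of extended reals.\<close>

lemma norm_add_square_le: "ennreal ((norm (a + b))\<^sup>2) \<le> 2 * ennreal ((norm a)\<^sup>2) + 2 * ennreal ((norm b)\<^sup>2)"
proof -
  have "(norm (a + b))\<^sup>2 \<le> (norm a + norm b)\<^sup>2" by (intro power_mono norm_triangle_ineq) auto
  also have "\<dots> \<le> 2 * (norm a)\<^sup>2 + 2 * (norm b)\<^sup>2"
    using zero_le_power2[of "norm a - norm b"] by (simp add: power2_eq_square algebra_simps)
  finally have "ennreal ((norm (a + b))\<^sup>2) \<le> ennreal (2 * (norm a)\<^sup>2 + 2 * (norm b)\<^sup>2)" by (rule ennreal_leI)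
  then show ?thesis by (simp add: ennreal_plus ennreal_mult)
qed

lemma sqint_add:
  fixes f g :: "'a::euclidean_space \<Rightarrow> 'b::real_normed_vector"
  assumes C: "compact C" and f: "continuous_on C f" and g: "continuous_on C g"
  shows "sqint C (\<lambda>s. f s + g s) \<le> 2 * sqint C f + 2 * sqint C g"
proof -
  note [measurable] = measurable_sqint[OF disjI1[OF C] f] measurable_sqint[OF disjI1[OF C] g]
  have "sqint C (\<lambda>s. f s + g s) \<le> (\<integral>\<^sup>+s. 2 * (ennreal ((norm (f s))\<^sup>2) * indicator C s)
      + 2 * (ennreal ((norm (g s))\<^sup>2) * indicator C s) \<partial>lborel)"
    unfolding sqint_def by (intro nn_integral_mono) (auto simp: indicator_def norm_add_square_le)
  also have "\<dots> = 2 * sqint C f + 2 * sqint C g"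
    unfolding sqint_def by (subst nn_integral_add) (auto simp: nn_integral_cmult)
  finally show ?thesis .
qed

lemma sqint_mult:
  fixes f :: "'a::euclidean_space \<Rightarrow> complex"
  assumes C: "compact C" and f: "continuous_on C f" and B: "\<And>s. s \<in> C \<Longrightarrow> norm (c s) \<le> B"
  shows "sqint C (\<lambda>s. c s * f s) \<le> ennreal (B\<^sup>2) * sqint C f"
proof -
  note [measurable] = measurable_sqint[OF disjI1[OF C] f]
  have "ennreal ((norm (c s * f s))\<^sup>2) \<le> ennreal (B\<^sup>2) * ennreal ((norm (f s))\<^sup>2)" if "s \<in> C" for s
    using B[OF that] by (subst ennreal_mult[symmetric])
      (auto intro!: ennreal_leI mult_right_mono power_mono simp: norm_mult power_mult_distrib)
  then have "sqint C (\<lambda>s. c s * f s) \<le> (\<integral>\<^sup>+s. ennreal (B\<^sup>2) * (ennreal ((norm (f s))\<^sup>2) * indicator C s) \<partial>lborel)"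
    unfolding sqint_def by (intro nn_integral_mono) (auto simp: indicator_def)
  also have "\<dots> = ennreal (B\<^sup>2) * sqint C f"
    unfolding sqint_def by (subst nn_integral_cmult) auto
  finally show ?thesis .
qed

subsection \<open>Families of functions that tend to zero in the local mean square\<close>

text \<open>The index of a family runs along an arbitrary filter: height zero is approached by single slices
  when a trace vanishes, and by pairs of slices when a trace exists.\<close>

definition l2_null :: "'a::euclidean_space set \<Rightarrow> 'i filter \<Rightarrow> ('a \<Rightarrow> 'i \<Rightarrow> 'b::real_normed_vector) \<Rightarrow> bool" where
  "l2_null V F f \<longleftrightarrow> (\<forall>C. compact C \<and> C \<subseteq> V \<longrightarrow> ((\<lambda>i. sqint C (\<lambda>s. f s i)) \<longlongrightarrow> 0) F)"

lemma l2_nullI: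
  assumes "\<And>C. compact C \<Longrightarrow> C \<subseteq> V \<Longrightarrow> \<exists>q. (q \<longlongrightarrow> 0) F \<and> eventually (\<lambda>i. sqint C (\<lambda>s. f s i) \<le> q i) F"
  shows "l2_null V F f"
  unfolding l2_null_def
proof (intro allI impI, elim conjE)
  fix C assume "compact C" "C \<subseteq> V"
  then obtain q where q: "(q \<longlongrightarrow> 0) F" "eventually (\<lambda>i. sqint C (\<lambda>s. f s i) \<le> q i) F"
    using assms by blast
  show "((\<lambda>i. sqint C (\<lambda>s. f s i)) \<longlongrightarrow> 0) F"
    by (rule tendsto_sandwich[OF _ q(2) tendsto_const q(1)]) simp
qed

lemma l2_nullD: "l2_null V F f \<Longrightarrow> compact C \<Longrightarrow> C \<subseteq> V \<Longrightarrow> ((\<lambda>i. sqint C (\<lambda>s. f s i)) \<longlongrightarrow> 0) F"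
  unfolding l2_null_def by blast

lemma l2_null_mono:
  assumes f: "l2_null V F f" and le: "eventually (\<lambda>i. \<forall>s\<in>V. norm (g s i) \<le> norm (f s i)) F"
  shows "l2_null V F g"
proof (rule l2_nullI)
  fix C assume C: "compact C" "C \<subseteq> V"
  have "eventually (\<lambda>i. sqint C (\<lambda>s. g s i) \<le> sqint C (\<lambda>s. f s i)) F"
    using le by eventually_elim (use C in \<open>auto intro!: sqint_mono\<close>)
  then show "\<exists>q. (q \<longlongrightarrow> 0) F \<and> eventually (\<lambda>i. sqint C (\<lambda>s. g s i) \<le> q i) F"
    using l2_nullD[OF f C] by blast
qed

lemma l2_null_add:
  assumes f: "l2_null V F f" "eventually (\<lambda>i. continuous_on V (\<lambda>s. f s i)) F"
    and g: "l2_null V F g" "eventually (\<lambda>i. continuous_on V (\<lambda>s. g s i)) F"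
  shows "l2_null V F (\<lambda>s i. f s i + g s i)"
proof (rule l2_nullI)
  fix C assume C: "compact C" "C \<subseteq> V"
  let ?q = "\<lambda>i. 2 * sqint C (\<lambda>s. f s i) + 2 * sqint C (\<lambda>s. g s i)"
  have "(?q \<longlongrightarrow> 2 * 0 + 2 * 0) F"
    by (intro tendsto_add ennreal_tendsto_cmult l2_nullD[OF f(1) C] l2_nullD[OF g(1) C]) auto
  moreover have "eventually (\<lambda>i. sqint C (\<lambda>s. f s i + g s i) \<le> ?q i) F"
    using f(2) g(2) by eventually_elim (intro sqint_add C(1); rule continuous_on_subset[OF _ C(2)]; assumption)
  ultimately show "\<exists>q. (q \<longlongrightarrow> 0) F \<and> eventually (\<lambda>i. sqint C (\<lambda>s. f s i + g s i) \<le> q i) F" by auto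
qed

lemma compact_bound_positive:
  fixes c :: "'a::euclidean_space \<Rightarrow> complex"
  assumes "compact C" "continuous_on C c"
  obtains B where "B > 0" "\<And>s. s \<in> C \<Longrightarrow> norm (c s) \<le> B"
proof -
  have "bounded (c ` C)" using assms compact_continuous_image compact_imp_bounded by blast
  then obtain B where "B > 0" "\<forall>x\<in>c ` C. norm x \<le> B" unfolding bounded_pos by blast
  then show ?thesis using that by blast
qed

lemma l2_null_mult:
  fixes f :: "'a::euclidean_space \<Rightarrow> 'i \<Rightarrow> complex"
  assumes f: "l2_null V F f" "eventually (\<lambda>i. continuous_on V (\<lambda>s. f s i)) F" and c: "continuous_on V c"
  shows "l2_null V F (\<lambda>s i. c s * f s i)"
proof (rule l2_nullI)
  fix C assume C: "compact C" "C \<subseteq> V"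
  obtain B where B: "\<And>s. s \<in> C \<Longrightarrow> norm (c s) \<le> B"
    using compact_bound_positive[OF C(1) continuous_on_subset[OF c C(2)]] by blast
  let ?q = "\<lambda>i. ennreal (B\<^sup>2) * sqint C (\<lambda>s. f s i)"
  have "(?q \<longlongrightarrow> ennreal (B\<^sup>2) * 0) F"
    by (intro ennreal_tendsto_cmult l2_nullD[OF f(1) C]) auto
  moreover have "eventually (\<lambda>i. sqint C (\<lambda>s. c s * f s i) \<le> ?q i) F"
    using f(2) by eventually_elim (intro sqint_mult C(1) B; (rule continuous_on_subset[OF _ C(2)])?; assumption)
  ultimately show "\<exists>q. (q \<longlongrightarrow> 0) F \<and> eventually (\<lambda>i. sqint C (\<lambda>s. c s * f s i) \<le> q i) F" by auto
qed

definition slice_null :: "'a::euclidean_space set \<Rightarrow> ('a \<Rightarrow> real \<Rightarrow> 'b::real_normed_vector) \<Rightarrow> bool" where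
  "slice_null V f \<longleftrightarrow> l2_null V (at_right 0) f"

text \<open>Such slices converge to a trace in \<open>L\<^sup>2\<close>; only the Cauchy property is recorded, so that the trace itself,
  a class of functions, never has to be named.\<close>

definition slice_cauchy :: "'a::euclidean_space set \<Rightarrow> ('a \<Rightarrow> real \<Rightarrow> 'b::real_normed_vector) \<Rightarrow> bool" where
  "slice_cauchy V f \<longleftrightarrow> l2_null V (at_right 0 \<times>\<^sub>F at_right 0) (\<lambda>s p. f s (fst p) - f s (snd p))"

definition slice_cont :: "'a::euclidean_space set \<Rightarrow> real \<Rightarrow> ('a \<Rightarrow> real \<Rightarrow> 'b::real_normed_vector) \<Rightarrow> bool" where
  "slice_cont V h f \<longleftrightarrow> (\<forall>\<tau>. 0 < \<tau> \<and> \<tau> < h \<longrightarrow> continuous_on V (\<lambda>s. f s \<tau>))"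

lemma tendsto_zero_ennreal_iff:
  fixes q :: "'i \<Rightarrow> ennreal"
  shows "(q \<longlongrightarrow> 0) F \<longleftrightarrow> (\<forall>e>0. eventually (\<lambda>i. q i \<le> ennreal e) F)"
proof
  assume L: "(q \<longlongrightarrow> 0) F"
  show "\<forall>e>0. eventually (\<lambda>i. q i \<le> ennreal e) F"
  proof (intro allI impI)
    fix e :: real assume "e > 0"
    then have "eventually (\<lambda>i. q i < ennreal e) F" by (intro order_tendstoD[OF L]) simp
    then show "eventually (\<lambda>i. q i \<le> ennreal e) F" by eventually_elim simp
  qed
next
  assume R: "\<forall>e>0. eventually (\<lambda>i. q i \<le> ennreal e) F"
  show "(q \<longlongrightarrow> 0) F"
  proof (rule order_tendstoI)
    fix a :: ennreal assume "0 < a"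
    then obtain x where x: "0 < x" "x < a" using dense by blast
    then have "x < \<infinity>" using less_le_trans[of x a \<infinity>] by (auto simp: top.not_eq_extremum)
    then obtain e where e: "x = ennreal e" "e \<ge> 0" by (cases x) auto
    then have "e > 0" using x by (cases "e = 0") auto
    with R have "eventually (\<lambda>i. q i \<le> ennreal e) F" by blast
    then show "eventually (\<lambda>i. q i < a) F" by eventually_elim (use e x le_less_trans in blast)
  qed simp
qed

lemma slice_null_iff:
  "slice_null V f \<longleftrightarrow> (\<forall>C e. compact C \<and> C \<subseteq> V \<and> 0 < e \<longrightarrow> (\<exists>\<delta>>0. \<forall>\<tau>. 0 < \<tau> \<and> \<tau> < \<delta> \<longrightarrow> sqint C (\<lambda>s. f s \<tau>) \<le> ennreal e))"
  proof -
  have "eventually P (at_right (0::real)) \<longleftrightarrow> (\<exists>\<delta>>0. \<forall>\<tau>. 0 < \<tau> \<and> \<tau> < \<delta> \<longrightarrow> P \<tau>)" for P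
    unfolding eventually_at_right_field by (simp add: imp_conjL)
  then show ?thesis unfolding slice_null_def l2_null_def tendsto_zero_ennreal_iff by auto
qed

lemma slice_cauchy_iff:
  "slice_cauchy V f \<longleftrightarrow> (\<forall>C e. compact C \<and> C \<subseteq> V \<and> 0 < e \<longrightarrow> (\<exists>\<delta>>0. \<forall>\<tau> \<tau>'.
     0 < \<tau> \<and> \<tau> < \<delta> \<and> 0 < \<tau>' \<and> \<tau>' < \<delta> \<longrightarrow> sqint C (\<lambda>s. f s \<tau> - f s \<tau>') \<le> ennreal e))"
proof -
  have "eventually P (at_right 0 \<times>\<^sub>F at_right (0::real)) \<longleftrightarrow>
      (\<exists>\<delta>>0. \<forall>\<tau> \<tau>'. 0 < \<tau> \<and> \<tau> < \<delta> \<and> 0 < \<tau>' \<and> \<tau>' < \<delta> \<longrightarrow> P (\<tau>, \<tau>'))" for P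
    unfolding eventually_prod_same eventually_at_right_field
  proof (intro iffI; elim exE conjE)
    fix R \<delta> assume "\<delta> > 0" "\<forall>y>0. y < \<delta> \<longrightarrow> R y" "\<forall>x y. R x \<longrightarrow> R y \<longrightarrow> P (x, y)"
    then show "\<exists>\<delta>>0. \<forall>\<tau> \<tau>'. 0 < \<tau> \<and> \<tau> < \<delta> \<and> 0 < \<tau>' \<and> \<tau>' < \<delta> \<longrightarrow> P (\<tau>, \<tau>')" by blast
  next
    fix \<delta> :: real assume "\<delta> > 0" "\<forall>\<tau> \<tau>'. 0 < \<tau> \<and> \<tau> < \<delta> \<and> 0 < \<tau>' \<and> \<tau>' < \<delta> \<longrightarrow> P (\<tau>, \<tau>')"
    then show "\<exists>R. (\<exists>b>0. \<forall>y>0. y < b \<longrightarrow> R y) \<and> (\<forall>x y. R x \<longrightarrow> R y \<longrightarrow> P (x, y))"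
      by (intro exI[of _ "\<lambda>\<tau>. 0 < \<tau> \<and> \<tau> < \<delta>"]) blast
  qed
  then show ?thesis unfolding slice_cauchy_def l2_null_def tendsto_zero_ennreal_iff by auto
qed

lemma eventually_height: "0 < h \<Longrightarrow> eventually (\<lambda>\<tau>. 0 < \<tau> \<and> \<tau> < h) (at_right (0::real))"
  unfolding eventually_at_right_field by blast

lemma eventually_slice_cont:
  assumes "0 < h" "slice_cont V h f"
  shows "eventually (\<lambda>\<tau>. continuous_on V (\<lambda>s. f s \<tau>)) (at_right 0)"
  using eventually_height[OF assms(1)] by eventually_elim (use assms(2) in \<open>auto simp: slice_cont_def\<close>)

lemma eventually_slice_cont_diff:
  assumes "0 < h" "slice_cont V h f"
  shows "eventually (\<lambda>p. continuous_on V (\<lambda>s. f s (fst p) - f s (snd p))) (at_right 0 \<times>\<^sub>F at_right 0)"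
  using eventually_prodI[OF eventually_slice_cont[OF assms] eventually_slice_cont[OF assms]]
  by eventually_elim (auto intro: continuous_on_diff)

lemma slice_null_mono:
  assumes f: "slice_null V f" and h: "0 < h"
    and le: "\<And>s \<tau>. s \<in> V \<Longrightarrow> 0 < \<tau> \<Longrightarrow> \<tau> < h \<Longrightarrow> norm (g s \<tau>) \<le> norm (f s \<tau>)"
  shows "slice_null V g"
  unfolding slice_null_def
proof (rule l2_null_mono)
  show "l2_null V (at_right 0) f" using f by (simp add: slice_null_def)
  show "eventually (\<lambda>\<tau>. \<forall>s\<in>V. norm (g s \<tau>) \<le> norm (f s \<tau>)) (at_right 0)"
    using eventually_height[OF h] by eventually_elim (use le in blast)
qed

lemma slice_cauchy_mono:
  assumes f: "slice_cauchy V f" and h: "0 < h"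
    and le: "\<And>s \<tau> \<tau>'. s \<in> V \<Longrightarrow> 0 < \<tau> \<Longrightarrow> \<tau> < h \<Longrightarrow> 0 < \<tau>' \<Longrightarrow> \<tau>' < h \<Longrightarrow> norm (g s \<tau> - g s \<tau>') \<le> norm (f s \<tau> - f s \<tau>')"
  shows "slice_cauchy V g"
  unfolding slice_cauchy_def
proof (rule l2_null_mono)
  show "l2_null V (at_right 0 \<times>\<^sub>F at_right 0) (\<lambda>s p. f s (fst p) - f s (snd p))" using f by (simp add: slice_cauchy_def)
  show "eventually (\<lambda>p. \<forall>s\<in>V. norm (g s (fst p) - g s (snd p)) \<le> norm (f s (fst p) - f s (snd p))) (at_right 0 \<times>\<^sub>F at_right 0)"
    using eventually_prodI[OF eventually_height[OF h] eventually_height[OF h]] by eventually_elim (use le in blast)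
qed

subsection \<open>Tangential derivatives of null slices\<close>

text \<open>The fundamental theorem of calculus followed by the Cauchy-Schwarz inequality. It controls differences of
  slices in both directions: across the boundary, and along it.\<close>

lemma increment_square_le:
  fixes p :: "real \<Rightarrow> 'b::euclidean_space"
  assumes ab: "a \<le> b"
    and p: "\<And>r. a \<le> r \<Longrightarrow> r \<le> b \<Longrightarrow> (p has_vector_derivative q r) (at r within {a..b})"
    and q: "continuous_on {a..b} q"
  shows "ennreal ((norm (p b - p a))\<^sup>2) \<le> ennreal (b - a) * sqint {a..b} q"
proof -
  have int: "integrable lborel (\<lambda>r. indicator {a..b} r *\<^sub>R q r)"
    using borel_integrable_atLeastAtMost'[OF q] by (simp add: set_integrable_def)
  have m: "(\<lambda>r. ennreal (norm (indicator {a..b} r *\<^sub>R q r))) \<in> borel_measurable lborel"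
    using borel_measurable_integrable[OF int] by measurable
  have "ennreal (norm (p b - p a)) \<le> (\<integral>\<^sup>+r. ennreal (norm (indicator {a..b} r *\<^sub>R q r)) \<partial>lborel)"
    using integral_norm_bound_ennreal[OF int] integral_FTC_atLeastAtMost[OF ab p q] by simp
  also have "\<dots> = (\<integral>\<^sup>+r. indicator {a..b} r * ennreal (norm (indicator {a..b} r *\<^sub>R q r)) \<partial>lborel)"
    by (intro nn_integral_cong) (auto simp: indicator_def)
  finally have "(ennreal (norm (p b - p a)))\<^sup>2 \<le> \<dots>\<^sup>2" by (intro power_mono) auto
  also have "\<dots> \<le> (\<integral>\<^sup>+r. (indicator {a..b} r)\<^sup>2 \<partial>lborel) * (\<integral>\<^sup>+r. (ennreal (norm (indicator {a..b} r *\<^sub>R q r)))\<^sup>2 \<partial>lborel)"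
    by (intro Cauchy_Schwarz_nn_integral m) measurable
  also have "(\<integral>\<^sup>+r. (indicator {a..b} r)\<^sup>2 \<partial>lborel) = (\<integral>\<^sup>+r. indicator {a..b} r \<partial>lborel)"
    by (intro nn_integral_cong) (auto simp: indicator_def)
  also have "\<dots> = ennreal (b - a)" using ab by simp
  also have "(\<integral>\<^sup>+r. (ennreal (norm (indicator {a..b} r *\<^sub>R q r)))\<^sup>2 \<partial>lborel) = sqint {a..b} q"
    unfolding sqint_def by (intro nn_integral_cong) (auto simp: indicator_def ennreal_power)
  finally show ?thesis by (simp add: ennreal_power)
qed

lemma nn_integral_translate:
  fixes g :: "'a::euclidean_space \<Rightarrow> ennreal"
  assumes "g \<in> borel_measurable borel"
  shows "(\<integral>\<^sup>+s. g (s + v) \<partial>lborel) = (\<integral>\<^sup>+s. g s \<partial>lborel)"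
proof -
  have "(\<integral>\<^sup>+s. g s \<partial>lborel) = (\<integral>\<^sup>+s. g s \<partial>distr lborel borel ((+) v))" by (simp add: lborel_distr_plus)
  also have "\<dots> = (\<integral>\<^sup>+s. g (v + s) \<partial>lborel)" using assms by (subst nn_integral_distr) auto
  finally show ?thesis by (simp add: add.commute)
qed

text \<open>By Fubini, averaging over short segments starting in \<open>C\<close> does not increase the mean square by more than the
  length of the segments.\<close>

lemma segment_integral_le:
  fixes k :: "real^'n::finite \<Rightarrow> 'b::real_normed_vector"
  assumes C: "compact C" and C': "compact C'" and k: "continuous_on C' k" and \<eta>: "0 \<le> \<eta>"
    and sub: "\<And>s r. s \<in> C \<Longrightarrow> 0 \<le> r \<Longrightarrow> r \<le> \<eta> \<Longrightarrow> s + r *\<^sub>R v \<in> C'"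
  shows "(\<integral>\<^sup>+s\<in>C. sqint {0..\<eta>} (\<lambda>r. k (s + r *\<^sub>R v)) \<partial>lborel) \<le> ennreal \<eta> * sqint C' k"
proof -
  define K where "K = (\<lambda>x. ennreal ((norm (k x))\<^sup>2) * indicator C' x)"
  have K[measurable]: "K \<in> borel_measurable borel" unfolding K_def by (rule measurable_sqint[OF disjI1[OF C'] k])
  have C_sets[measurable]: "C \<in> sets borel" using C borel_compact by blast
  have "(\<integral>\<^sup>+s\<in>C. sqint {0..\<eta>} (\<lambda>r. k (s + r *\<^sub>R v)) \<partial>lborel)
      = (\<integral>\<^sup>+s. \<integral>\<^sup>+r. indicator C s * (indicator {0..\<eta>} r * K (s + r *\<^sub>R v)) \<partial>lborel \<partial>lborel)"
  proof (rule nn_integral_cong)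
    fix s
    have "sqint {0..\<eta>} (\<lambda>r. k (s + r *\<^sub>R v)) = (\<integral>\<^sup>+r. indicator {0..\<eta>} r * K (s + r *\<^sub>R v) \<partial>lborel)" if "s \<in> C"
      unfolding sqint_def K_def using sub[OF that] by (intro nn_integral_cong) (auto simp: indicator_def)
    then show "sqint {0..\<eta>} (\<lambda>r. k (s + r *\<^sub>R v)) * indicator C s
      = (\<integral>\<^sup>+r. indicator C s * (indicator {0..\<eta>} r * K (s + r *\<^sub>R v)) \<partial>lborel)"
      by (auto simp: indicator_def)
  qed
  also have "\<dots> = (\<integral>\<^sup>+r. \<integral>\<^sup>+s. indicator C s * (indicator {0..\<eta>} r * K (s + r *\<^sub>R v)) \<partial>lborel \<partial>lborel)"
    by (rule lborel_pair.Fubini'[symmetric]) measurable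
  also have "\<dots> \<le> (\<integral>\<^sup>+r. indicator {0..\<eta>} r * sqint C' k \<partial>lborel)"
  proof (rule nn_integral_mono)
    fix r :: real
    have "(\<integral>\<^sup>+s. indicator C s * (indicator {0..\<eta>} r * K (s + r *\<^sub>R v)) \<partial>lborel)
        \<le> (\<integral>\<^sup>+s. indicator {0..\<eta>} r * K (s + r *\<^sub>R v) \<partial>lborel)"
      by (intro nn_integral_mono) (auto simp: indicator_def)
    also have "\<dots> = indicator {0..\<eta>} r * (\<integral>\<^sup>+s. K (s + r *\<^sub>R v) \<partial>lborel)"
      by (rule nn_integral_cmult) measurable
    also have "(\<integral>\<^sup>+s. K (s + r *\<^sub>R v) \<partial>lborel) = sqint C' k"
      by (subst nn_integral_translate[OF K]) (simp add: K_def sqint_def)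
    finally show "(\<integral>\<^sup>+s. indicator C s * (indicator {0..\<eta>} r * K (s + r *\<^sub>R v)) \<partial>lborel)
        \<le> indicator {0..\<eta>} r * sqint C' k" .
  qed
  also have "\<dots> = ennreal \<eta> * sqint C' k"
    using \<eta> by (subst nn_integral_multc) auto
  finally show ?thesis .
qed

text \<open>A boundary condition may be differentiated along the boundary. This is the closedness of the weak
  derivative, proved with difference quotients: the increment of \<open>f\<close> over a step \<open>\<eta>\<close> is the integral of
  \<open>g\<close>. At a fixed height \<open>\<tau>\<close> the slice of \<open>g\<close> is uniformly continuous, hence for small \<open>\<eta>\<close> close to its
  average over the step; by the Cauchy property this average barely changes when \<open>\<tau>\<close> is replaced by a
  much lower height \<open>\<tau>'\<close>, where the increment of \<open>f\<close> is negligible even after division by \<open>\<eta>\<close>.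
  The order of choices is \<open>\<delta>\<close>, \<open>\<tau>\<close>, \<open>\<eta>\<close>, \<open>\<tau>'\<close>.\<close>

lemma slice_null_pderiv:
  fixes f g :: "real^'n::finite \<Rightarrow> real \<Rightarrow> complex"
  assumes V: "open V" and h: "0 < h"
    and f: "slice_null V f" "slice_cont V h f" and g: "slice_cauchy V g" "slice_cont V h g"
    and der: "\<And>s \<tau>. s \<in> V \<Longrightarrow> 0 < \<tau> \<Longrightarrow> \<tau> < h \<Longrightarrow> (\<lambda>s. f s \<tau>) differentiable at s"
      "\<And>s \<tau>. s \<in> V \<Longrightarrow> 0 < \<tau> \<Longrightarrow> \<tau> < h \<Longrightarrow> pderiv_at j (\<lambda>s. f s \<tau>) s = g s \<tau>"
  shows "slice_null V g"
  unfolding slice_null_iff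
proof (intro allI impI, elim conjE)
  fix C and e :: real assume C: "compact C" "C \<subseteq> V" "0 < e"
  let ?v = "axis j 1 :: real^'n"
  obtain \<rho> where \<rho>: "\<rho> > 0" "(\<Union>x\<in>C. cball x \<rho>) \<subseteq> V"
    using compact_subset_open_imp_cball_epsilon_subset[OF C(1) V C(2)] by blast
  define C' where "C' = (\<lambda>(s, r). s + r *\<^sub>R ?v) ` (C \<times> {0..\<rho>})"
  have C'_I: "s + r *\<^sub>R ?v \<in> C'" if "s \<in> C" "0 \<le> r" "r \<le> \<rho>" for s r
    using that unfolding C'_def by force
  have C': "compact C'" unfolding C'_def
    by (intro compact_continuous_image compact_Times C compact_Icc) (auto intro!: continuous_intros simp: split_beta)
  have C'V: "C' \<subseteq> V"
  proof
    fix x assume "x \<in> C'"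
    then obtain s r where "s \<in> C" "0 \<le> r" "r \<le> \<rho>" "x = s + r *\<^sub>R ?v" unfolding C'_def by auto
    then have "x \<in> cball s \<rho>" by (simp add: dist_norm)
    then show "x \<in> V" using \<rho>(2) \<open>s \<in> C\<close> by blast
  qed
  have CC': "C \<subseteq> C'" using C'_I[of _ 0] \<rho>(1) by auto
  have e16: "0 < e / 16" using C by simp
  obtain \<delta> where \<delta>: "\<delta> > 0" "\<And>\<tau> \<tau>'. 0 < \<tau> \<and> \<tau> < \<delta> \<and> 0 < \<tau>' \<and> \<tau>' < \<delta> \<Longrightarrow> sqint C' (\<lambda>s. g s \<tau> - g s \<tau>') \<le> ennreal (e/16)"
    using g(1)[unfolded slice_cauchy_iff, rule_format, OF conjI, OF C' conjI, OF C'V e16] by blast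
  have "sqint C (\<lambda>s. g s \<tau>) \<le> ennreal e" if t: "0 < \<tau>" "\<tau> < min \<delta> h" for \<tau>
  proof -
    define m where "m = measure lborel C"
    have m: "emeasure lborel C = ennreal m" unfolding m_def
      by (rule emeasure_eq_ennreal_measure) (use emeasure_compact_finite[OF C(1)] in simp)
    have m0: "m \<ge> 0" by (simp add: m_def)
    \<comment> \<open>the errors below carry the factors 4, 4, 4 and 4, so each of them may be one sixteenth of \<open>e\<close>;
      the summand 1 covers the case that \<open>C\<close> has measure zero\<close>
    define \<epsilon> where "\<epsilon> = sqrt (e / 16 / (m + 1))"
    have \<epsilon>: "\<epsilon> > 0" using C m0 by (simp add: \<epsilon>_def)
    have \<epsilon>m: "\<epsilon>\<^sup>2 * m \<le> e / 16"
    proof -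
      have "\<epsilon>\<^sup>2 * m = e / 16 * (m / (m + 1))" using C m0 by (simp add: \<epsilon>_def)
      also have "\<dots> \<le> e / 16 * 1" using C m0 by (intro mult_left_mono) auto
      finally show ?thesis by simp
    qed
    have gc: "continuous_on C' (\<lambda>s. g s \<tau>)" 
      using g(2) t C'V unfolding slice_cont_def by (auto intro: continuous_on_subset)
    obtain d where d: "d > 0" "\<And>x x'. x \<in> C' \<Longrightarrow> x' \<in> C' \<Longrightarrow> dist x' x < d \<Longrightarrow> dist (g x' \<tau>) (g x \<tau>) < \<epsilon>"
      using compact_uniformly_continuous[OF gc C'] \<epsilon> unfolding uniformly_continuous_on_def by metis
    define \<eta> where "\<eta> = min \<rho> (d / 2)"
    have \<eta>: "0 < \<eta>" "\<eta> \<le> \<rho>" "\<eta> < d" using \<rho> d by (auto simp: \<eta>_def)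
    have "0 < \<eta>\<^sup>2 * (e / 16)" using \<eta> C by simp
    then obtain \<delta>' where \<delta>': "\<delta>' > 0" "\<And>\<tau>. 0 < \<tau> \<and> \<tau> < \<delta>' \<Longrightarrow> sqint C' (\<lambda>s. f s \<tau>) \<le> ennreal (\<eta>\<^sup>2 * (e / 16))"
      using f(1) C' C'V unfolding slice_null_iff by blast
    define \<tau>' where "\<tau>' = min \<delta>' (min \<delta> h) / 2"
    have t': "0 < \<tau>'" "\<tau>' < \<delta>'" "\<tau>' < \<delta>" "\<tau>' < h" using \<delta> \<delta>' h by (auto simp: \<tau>'_def)
    have fN: "sqint C' (\<lambda>s. f s \<tau>') \<le> ennreal (\<eta>\<^sup>2 * (e / 16))" using \<delta>'(2) t' by blast
    define k where "k = (\<lambda>s. g s \<tau>' - g s \<tau>)"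
    have kN: "sqint C' k \<le> ennreal (e / 16)" unfolding k_def using \<delta>(2) t t' by auto
    have gc': "continuous_on C' (\<lambda>s. g s \<tau>')" and fc': "continuous_on C' (\<lambda>s. f s \<tau>')"
      using g(2) f(2) t' C'V unfolding slice_cont_def by (auto intro: continuous_on_subset)
    have kc: "continuous_on C' k" unfolding k_def by (intro continuous_on_diff gc gc')
    define F where "F = (\<lambda>x. ennreal ((norm (f x \<tau>'))\<^sup>2) * indicator C' x)"
    have F[measurable]: "F \<in> borel_measurable borel" unfolding F_def by (rule measurable_sqint[OF disjI1[OF C'] fc'])
    have FN: "(\<integral>\<^sup>+x. F x \<partial>lborel) = sqint C' (\<lambda>s. f s \<tau>')" by (simp add: F_def sqint_def)
    have C_sets[measurable]: "C \<in> sets borel" using C borel_compact by blast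
    define I where "I = (\<lambda>s. sqint {0..\<eta>} (\<lambda>r. k (s + r *\<^sub>R ?v)))"
    define K where "K = (\<lambda>x. ennreal ((norm (k x))\<^sup>2) * indicator C' x)"
    have K[measurable]: "K \<in> borel_measurable borel" unfolding K_def by (rule measurable_sqint[OF disjI1[OF C'] kc])
    have I_eq: "I s * indicator C s = (\<integral>\<^sup>+r. indicator {0..\<eta>} r * K (s + r *\<^sub>R ?v) \<partial>lborel) * indicator C s" for s
    proof (cases "s \<in> C")
      case True
      have "I s = (\<integral>\<^sup>+r. indicator {0..\<eta>} r * K (s + r *\<^sub>R ?v) \<partial>lborel)"
        unfolding I_def sqint_def K_def using C'_I[OF True] \<eta> by (intro nn_integral_cong) (auto simp: indicator_def)
      then show ?thesis by simp
    qed simp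
    have I_meas[measurable]: "(\<lambda>s. I s * indicator C s) \<in> borel_measurable borel" unfolding I_eq by measurable
    have pt: "ennreal (\<eta>\<^sup>2) * (ennreal ((norm (g s \<tau>))\<^sup>2) * indicator C s)
        \<le> 4 * F (s + \<eta> *\<^sub>R ?v) + 4 * F s + ennreal (4 * \<eta>) * (I s * indicator C s) + ennreal (4 * \<eta>\<^sup>2 * \<epsilon>\<^sup>2) * indicator C s" for s
    proof (cases "s \<in> C")
      case True
      \<comment> \<open>the increment of \<open>p\<close> is the error in replacing the increment of \<open>f\<close> by \<open>\<eta> *\<^sub>R g s \<tau>\<close>\<close>
      define p where "p = (\<lambda>r. f (s + r *\<^sub>R ?v) \<tau>' - r *\<^sub>R g s \<tau>)"
      define q where "q = (\<lambda>r. g (s + r *\<^sub>R ?v) \<tau>' - g s \<tau>)"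
      have inC': "s + r *\<^sub>R ?v \<in> C'" if "0 \<le> r" "r \<le> \<eta>" for r using C'_I True that \<eta> by auto
      have der_p: "(p has_vector_derivative q r) (at r within {0..\<eta>})" if r: "0 \<le> r" "r \<le> \<eta>" for r
      proof -
        have sV: "s + r *\<^sub>R ?v \<in> V" using inC' r C'V by blast
        have "((\<lambda>r. s + r *\<^sub>R ?v) has_derivative (\<lambda>x. x *\<^sub>R ?v)) (at r within {0..\<eta>})"
          by (auto intro!: derivative_eq_intros)
        from has_derivative_compose[OF this has_derivative_pderiv_sum[OF der(1)[OF sV t'(1,4)]]]
        have "((\<lambda>r. f (s + r *\<^sub>R ?v) \<tau>') has_derivative (\<lambda>x. x *\<^sub>R g (s + r *\<^sub>R ?v) \<tau>')) (at r within {0..\<eta>})"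
          using der(2)[OF sV t'(1,4)] by (simp add: sum_axis_scaleR flip: scaleR_scaleR scaleR_sum_right)
        then have "((\<lambda>r. f (s + r *\<^sub>R ?v) \<tau>') has_vector_derivative g (s + r *\<^sub>R ?v) \<tau>') (at r within {0..\<eta>})"
          by (simp add: has_vector_derivative_def)
        moreover have "((\<lambda>r. r *\<^sub>R g s \<tau>) has_vector_derivative g s \<tau>) (at r within {0..\<eta>})"
          by (auto intro!: derivative_eq_intros simp: has_vector_derivative_def)
        ultimately show ?thesis unfolding p_def q_def by (rule has_vector_derivative_diff)
      qed
      have line_cont: "continuous_on {0..\<eta>} (\<lambda>r. F (s + r *\<^sub>R ?v))" if "continuous_on C' F" for F :: "real^'n \<Rightarrow> complex"
        by (rule continuous_on_compose2[OF that]) (auto intro!: continuous_intros inC')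
      have q_cont: "continuous_on {0..\<eta>} q" unfolding q_def
        by (intro continuous_on_diff line_cont[OF gc'] continuous_on_const)
      have inc: "ennreal ((norm (p \<eta> - p 0))\<^sup>2) \<le> ennreal \<eta> * sqint {0..\<eta>} q"
        using increment_square_le[of 0 \<eta> p q] der_p q_cont \<eta> by simp
      have "sqint {0..\<eta>} q = sqint {0..\<eta>} (\<lambda>r. k (s + r *\<^sub>R ?v) + (g (s + r *\<^sub>R ?v) \<tau> - g s \<tau>))"
        by (intro sqint_cong) (simp add: q_def k_def)
      also have "\<dots> \<le> 2 * I s + 2 * sqint {0..\<eta>} (\<lambda>r. g (s + r *\<^sub>R ?v) \<tau> - g s \<tau>)"
        unfolding I_def by (intro sqint_add compact_Icc line_cont[OF kc] continuous_on_diff line_cont[OF gc] continuous_on_const)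
      also have "sqint {0..\<eta>} (\<lambda>r. g (s + r *\<^sub>R ?v) \<tau> - g s \<tau>) \<le> sqint {0..\<eta>} (\<lambda>r. \<epsilon>)"
      proof (rule sqint_mono)
        fix r assume r: "r \<in> {0..\<eta>}"
        have "dist (s + r *\<^sub>R ?v) s < d" using r \<eta> by (simp add: dist_norm)
        then have "dist (g (s + r *\<^sub>R ?v) \<tau>) (g s \<tau>) < \<epsilon>"
          using d(2)[of s "s + r *\<^sub>R ?v"] inC' r True CC' by auto
        then show "norm (g (s + r *\<^sub>R ?v) \<tau> - g s \<tau>) \<le> norm \<epsilon>" using \<epsilon> by (simp add: dist_norm)
      qed
      also have "sqint {0..\<eta>} (\<lambda>r. \<epsilon>) = ennreal (\<eta> * \<epsilon>\<^sup>2)"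
        unfolding sqint_def using \<eta> by (subst nn_integral_cmult_indicator) (auto simp: mult.commute simp flip: ennreal_mult)
      finally have sq: "sqint {0..\<eta>} q \<le> 2 * I s + 2 * ennreal (\<eta> * \<epsilon>\<^sup>2)" by (simp add: add_left_mono mult_left_mono)
      have "\<eta> *\<^sub>R g s \<tau> = (f (s + \<eta> *\<^sub>R ?v) \<tau>' + (- f s \<tau>')) + (- (p \<eta> - p 0))" by (simp add: p_def)
      then have "ennreal ((norm (\<eta> *\<^sub>R g s \<tau>))\<^sup>2) \<le> 2 * ennreal ((norm (f (s + \<eta> *\<^sub>R ?v) \<tau>' + (- f s \<tau>')))\<^sup>2) + 2 * ennreal ((norm (p \<eta> - p 0))\<^sup>2)"
        using norm_add_square_le[of "f (s + \<eta> *\<^sub>R ?v) \<tau>' + (- f s \<tau>')" "- (p \<eta> - p 0)"] by (simp only: norm_minus_cancel)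
      also have "\<dots> \<le> 2 * (2 * F (s + \<eta> *\<^sub>R ?v) + 2 * F s) + 2 * (ennreal \<eta> * (2 * I s + 2 * ennreal (\<eta> * \<epsilon>\<^sup>2)))"
      proof (intro add_mono mult_left_mono)
        show "ennreal ((norm (f (s + \<eta> *\<^sub>R ?v) \<tau>' + - f s \<tau>'))\<^sup>2) \<le> 2 * F (s + \<eta> *\<^sub>R ?v) + 2 * F s"
          using norm_add_square_le[of "f (s + \<eta> *\<^sub>R ?v) \<tau>'" "- f s \<tau>'"] inC'[of \<eta>] \<eta> True CC' 
          by (auto simp: F_def indicator_def)
        show "ennreal ((norm (p \<eta> - p 0))\<^sup>2) \<le> ennreal \<eta> * (2 * I s + 2 * ennreal (\<eta> * \<epsilon>\<^sup>2))"
          using inc sq by (meson mult_left_mono order_trans zero_le)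
      qed auto
      also have "\<dots> = 4 * F (s + \<eta> *\<^sub>R ?v) + 4 * F s + (4 * ennreal \<eta>) * I s + 4 * (ennreal \<eta> * ennreal (\<eta> * \<epsilon>\<^sup>2))"
        by (simp add: distrib_left mult_ac add.assoc)
      also have "4 * ennreal \<eta> = ennreal (4 * \<eta>)" using \<eta> by (simp add: ennreal_mult)
      also have "4 * (ennreal \<eta> * ennreal (\<eta> * \<epsilon>\<^sup>2)) = ennreal (4 * \<eta>\<^sup>2 * \<epsilon>\<^sup>2)"
      proof -
        have "ennreal (4 * \<eta>\<^sup>2 * \<epsilon>\<^sup>2) = ennreal (4 * (\<eta> * (\<eta> * \<epsilon>\<^sup>2)))" by (simp add: power2_eq_square mult.assoc)
        then show ?thesis using \<eta> by (simp add: ennreal_mult)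
      qed
      finally have "ennreal ((norm (\<eta> *\<^sub>R g s \<tau>))\<^sup>2) \<le> 4 * F (s + \<eta> *\<^sub>R ?v) + 4 * F s + ennreal (4 * \<eta>) * I s + ennreal (4 * \<eta>\<^sup>2 * \<epsilon>\<^sup>2)" .
      moreover have "ennreal ((norm (\<eta> *\<^sub>R g s \<tau>))\<^sup>2) = ennreal (\<eta>\<^sup>2) * ennreal ((norm (g s \<tau>))\<^sup>2)"
        by (simp add: power_mult_distrib ennreal_mult)
      ultimately show ?thesis using True by simp
    qed simp
    have "ennreal (\<eta>\<^sup>2) * sqint C (\<lambda>s. g s \<tau>) = (\<integral>\<^sup>+s. ennreal (\<eta>\<^sup>2) * (ennreal ((norm (g s \<tau>))\<^sup>2) * indicator C s) \<partial>lborel)"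
      unfolding sqint_def
      using measurable_sqint[OF disjI1[OF C(1)] continuous_on_subset[OF gc CC']] by (subst nn_integral_cmult) auto
    also have "\<dots> \<le> (\<integral>\<^sup>+s. 4 * F (s + \<eta> *\<^sub>R ?v) + 4 * F s + ennreal (4 * \<eta>) * (I s * indicator C s) + ennreal (4 * \<eta>\<^sup>2 * \<epsilon>\<^sup>2) * indicator C s \<partial>lborel)"
      by (rule nn_integral_mono) (rule pt)
    also have "\<dots> = 4 * (\<integral>\<^sup>+s. F (s + \<eta> *\<^sub>R ?v) \<partial>lborel) + 4 * (\<integral>\<^sup>+s. F s \<partial>lborel)
        + ennreal (4 * \<eta>) * (\<integral>\<^sup>+s. I s * indicator C s \<partial>lborel) + ennreal (4 * \<eta>\<^sup>2 * \<epsilon>\<^sup>2) * emeasure lborel C"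
      by (simp add: nn_integral_add nn_integral_cmult)
    also have "\<dots> \<le> 4 * ennreal (\<eta>\<^sup>2 * (e / 16)) + 4 * ennreal (\<eta>\<^sup>2 * (e / 16))
        + ennreal (4 * \<eta>) * (ennreal \<eta> * ennreal (e / 16)) + ennreal (4 * \<eta>\<^sup>2 * \<epsilon>\<^sup>2) * ennreal m"
    proof -
      have "(\<integral>\<^sup>+s. I s * indicator C s \<partial>lborel) \<le> ennreal \<eta> * sqint C' k"
        unfolding I_def by (rule segment_integral_le[OF C(1) C' kc]) (use \<eta> C'_I in auto)
      then have "(\<integral>\<^sup>+s. I s * indicator C s \<partial>lborel) \<le> ennreal \<eta> * ennreal (e / 16)"
        using kN by (meson mult_left_mono order_trans zero_le)
      then show ?thesis unfolding nn_integral_translate[OF F] FN m using fN by (intro add_mono mult_left_mono) auto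
    qed
    also have "\<dots> = ennreal (4 * (\<eta>\<^sup>2 * (e / 16)) + 4 * (\<eta>\<^sup>2 * (e / 16)) + 4 * \<eta> * (\<eta> * (e / 16)) + 4 * \<eta>\<^sup>2 * \<epsilon>\<^sup>2 * m)"
    proof -
      have four: "4 * ennreal x = ennreal (4 * x)" if "x \<ge> 0" for x
        using that by (simp add: ennreal_mult)
      have nn: "0 \<le> \<eta>\<^sup>2 * (e / 16)" "0 \<le> \<eta>" "0 \<le> e / 16" using \<eta> C by simp_all
      have "ennreal (4 * \<eta>) * (ennreal \<eta> * ennreal (e / 16)) = ennreal (4 * \<eta> * (\<eta> * (e / 16)))"
        using nn by (metis ennreal_mult mult_nonneg_nonneg zero_le_numeral)
      moreover have "ennreal (4 * \<eta>\<^sup>2 * \<epsilon>\<^sup>2) * ennreal m = ennreal (4 * \<eta>\<^sup>2 * \<epsilon>\<^sup>2 * m)"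
        using m0 by (intro ennreal_mult[symmetric]) auto
      ultimately show ?thesis using nn m0
        by (simp only: four) (simp only: ennreal_plus[symmetric] mult_nonneg_nonneg zero_le_numeral zero_le_power2 add_nonneg_nonneg)
    qed
    also have "\<dots> \<le> ennreal (\<eta>\<^sup>2 * e)"
    proof (rule ennreal_leI)
      have "4 * \<eta>\<^sup>2 * (\<epsilon>\<^sup>2 * m) \<le> 4 * \<eta>\<^sup>2 * (e / 16)" using \<epsilon>m by (intro mult_left_mono) auto
      then show "4 * (\<eta>\<^sup>2 * (e / 16)) + 4 * (\<eta>\<^sup>2 * (e / 16)) + 4 * \<eta> * (\<eta> * (e / 16)) + 4 * \<eta>\<^sup>2 * \<epsilon>\<^sup>2 * m \<le> \<eta>\<^sup>2 * e"
        by (simp add: power2_eq_square algebra_simps)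
    qed
    also have "\<dots> = ennreal (\<eta>\<^sup>2) * ennreal e" using C by (simp add: ennreal_mult)
    finally have "ennreal (\<eta>\<^sup>2) * sqint C (\<lambda>s. g s \<tau>) \<le> ennreal (\<eta>\<^sup>2) * ennreal e" .
    then show ?thesis using \<eta> by (subst (asm) ennreal_mult_le_mult_iff) auto
  qed
  then show "\<exists>\<delta>>0. \<forall>\<tau>. 0 < \<tau> \<and> \<tau> < \<delta> \<longrightarrow> sqint C (\<lambda>s. g s \<tau>) \<le> ennreal e"
    using \<delta>(1) h by (intro exI[of _ "min \<delta> h"]) auto
qed

section \<open>Graph charts of the boundary\<close>

subsection \<open>Integration in graph coordinates\<close>

definition lift3 :: "real^2 \<Rightarrow> real \<Rightarrow> real^3" where
  "lift3 s t = vector [s $ 1, s $ 2, t]"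

lemma lift3_nth [simp]: "lift3 s t $ 1 = s $ 1" "lift3 s t $ 2 = s $ 2" "lift3 s t $ 3 = t"
  by (simp_all add: lift3_def)

lemma graph_point_lift3: "graph_point Q \<phi> s \<tau> = Q *v lift3 s (\<phi> s + \<tau>)"
  by (simp add: graph_point_def lift3_def)

lemma bounded_linear_lift3: "bounded_linear (\<lambda>p. lift3 (fst p) (snd p))"
  by (intro linear_conv_bounded_linear[THEN iffD1] linearI) (auto simp: vec_eq_iff forall_3)

lemma continuous_on_lift3 [continuous_intros]:
  assumes "continuous_on S f" "continuous_on S g"
  shows "continuous_on S (\<lambda>x. lift3 (f x) (g x))"
  using bounded_linear.continuous_on[OF bounded_linear_lift3 continuous_on_Pair[OF assms]] by simp

lemma prod_Basis_cart: "(\<Prod>b\<in>(Basis :: (real^'n::finite) set). F b) = (\<Prod>i\<in>UNIV. F (axis i 1))"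
proof -
  have "(Basis :: (real^'n) set) = range (\<lambda>i. axis i 1)" by (auto simp: Basis_vec_def)
  moreover have "inj (\<lambda>i::'n. axis i (1::real))" by (auto simp: inj_on_def axis_eq_axis)
  ultimately show ?thesis using prod.reindex[of "\<lambda>i::'n. axis i (1::real)" UNIV F] by (metis comp_apply prod.cong)
qed

lemma emeasure_lborel_box_cart:
  fixes l u :: "real^'n::finite"
  assumes "\<And>i. l $ i \<le> u $ i"
  shows "emeasure lborel (box l u) = ennreal (\<Prod>i\<in>UNIV. u $ i - l $ i)"
proof -
  have "l \<bullet> b \<le> u \<bullet> b" if "b \<in> Basis" for b
    using that assms by (auto simp: Basis_vec_def inner_axis)
  then show ?thesis by (simp add: prod_Basis_cart inner_axis)
qed

lemma borel_measurable_lift3_pair: "(\<lambda>p. lift3 (fst p) (snd p)) \<in> borel_measurable borel"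
  by (rule borel_measurable_continuous_onI[OF bounded_linear.continuous_on[OF bounded_linear_lift3 continuous_on_id]])

lemma vimage_lift3_box:
  "(\<lambda>p. lift3 (fst p) (snd p)) -` box l u = box (vector [l$1, l$2]) (vector [u$1, u$2]) \<times> {l$3 <..< u$3}"
proof -
  have "lift3 s t \<in> box l u \<longleftrightarrow> s \<in> box (vector [l$1, l$2]) (vector [u$1, u$2]) \<and> t \<in> {l$3 <..< u$3}" for s t
    unfolding mem_box_cart forall_3 forall_2 by simp
  then show ?thesis unfolding set_eq_iff vimage_eq mem_Times_iff by blast
qed

lemma distr_lift3: "distr lborel borel (\<lambda>p. lift3 (fst p) (snd p)) = lborel"
proof (rule lborel_eqI[symmetric])
  fix l u :: "real^3" assume le: "\<And>b. b \<in> Basis \<Longrightarrow> l \<bullet> b \<le> u \<bullet> b"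
  have le': "l $ i \<le> u $ i" for i
  proof -
    have "l \<bullet> axis i 1 \<le> u \<bullet> axis i 1" by (rule le) (simp add: axis_in_Basis_iff)
    then show ?thesis by (simp add: inner_axis)
  qed
  let ?A = "box (vector [l$1, l$2]) (vector [u$1, u$2]) :: (real^2) set"
  have "emeasure (distr lborel borel (\<lambda>p. lift3 (fst p) (snd p))) (box l u) = emeasure lborel (?A \<times> {l$3 <..< u$3})"
    using borel_measurable_lift3_pair by (subst emeasure_distr) (simp_all only: vimage_lift3_box measurable_lborel2 space_lborel space_borel Int_UNIV_right sets_lborel borel_open open_box)
  also have "\<dots> = emeasure (lborel \<Otimes>\<^sub>M lborel) (?A \<times> {l$3 <..< u$3})" unfolding lborel_prod ..
  also have "\<dots> = emeasure lborel ?A * emeasure lborel {l$3 <..< u$3}"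
    by (rule lborel.emeasure_pair_measure_Times) simp_all
  also have "emeasure lborel ?A = ennreal ((u$1 - l$1) * (u$2 - l$2))"
  proof -
    have "vector [l$1, l$2] $ i \<le> (vector [u$1, u$2] :: real^2) $ i" for i
      using le'[of 1] le'[of 2] exhaust_2[of i] by auto
    then have "emeasure lborel ?A = ennreal (\<Prod>i\<in>UNIV. (vector [u$1, u$2] :: real^2) $ i - vector [l$1, l$2] $ i)"
      by (rule emeasure_lborel_box_cart)
    then show ?thesis by (simp only: UNIV_2 vector_2) simp
  qed
  also have "emeasure lborel {l$3 <..< u$3} = ennreal (u$3 - l$3)" using le'[of 3] by simp
  also have "ennreal ((u$1 - l$1) * (u$2 - l$2)) * ennreal (u$3 - l$3) = ennreal (\<Prod>b\<in>Basis. (u - l) \<bullet> b)"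
  proof -
    have "0 \<le> u$i - l$i" for i using le'[of i] by simp
    then have "ennreal ((u$1 - l$1) * (u$2 - l$2)) * ennreal (u$3 - l$3) = ennreal ((u$1 - l$1) * (u$2 - l$2) * (u$3 - l$3))"
      by (intro ennreal_mult[symmetric] mult_nonneg_nonneg)
    moreover have "(\<Prod>b\<in>Basis. (u - l) \<bullet> b) = (u$1 - l$1) * (u$2 - l$2) * (u$3 - l$3)"
      unfolding prod_Basis_cart UNIV_3 by (simp add: inner_axis)
    ultimately show ?thesis by simp
  qed
  finally show "emeasure (distr lborel borel (\<lambda>p. lift3 (fst p) (snd p))) (box l u) = ennreal (\<Prod>b\<in>Basis. (u - l) \<bullet> b)" .
qed simp

lemma orthogonal_matrix_cancel:
  fixes Q :: "real^'n::finite^'n"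
  assumes "orthogonal_matrix Q"
  shows "transpose Q *v (Q *v x) = x" "Q *v (transpose Q *v x) = x"
  using assms unfolding orthogonal_matrix_def matrix_vector_mul_assoc by (simp_all only: matrix_vector_mul_lid)

lemma orthogonal_matrix_transformation:
  fixes Q :: "real^'n::finite^'n"
  assumes "orthogonal_matrix Q"
  shows "orthogonal_transformation (\<lambda>x. Q *v x)"
  using assms by (simp add: orthogonal_transformation_matrix matrix_of_matrix_vector_mul)

text \<open>Orthogonal maps preserve the measure of boxes, and boxes determine Lebesgue measure.\<close>

lemma distr_orthogonal_matrix:
  fixes Q :: "real^'n::{finite,wellorder}^'n::{finite,wellorder}"
  assumes Q: "orthogonal_matrix Q"
  shows "distr lborel borel (\<lambda>x. Q *v x) = lborel"
proof (rule lborel_eqI[symmetric])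
  fix l u :: "real^'n::{finite,wellorder}" assume le: "\<And>b. b \<in> Basis \<Longrightarrow> l \<bullet> b \<le> u \<bullet> b"
  let ?B = "(\<lambda>x. transpose Q *v x) ` box l u"
  have emeasure_eq: "emeasure lborel S = ennreal (measure lebesgue S)"
    if "S \<in> sets borel" "S \<in> lmeasurable" for S :: "(real^'n::{finite,wellorder}) set"
  proof -
    have "emeasure lborel S = emeasure lebesgue S" using that(1) by (simp add: emeasure_completion)
    also have "\<dots> = ennreal (measure lebesgue S)" using that(2) by (intro emeasure_eq_ennreal_measure fmeasurableD2)
    finally show ?thesis .
  qed
  have ot: "orthogonal_transformation (\<lambda>x. transpose Q *v x)"
    using Q by (intro orthogonal_matrix_transformation) simp
  have vim: "(\<lambda>x. Q *v x) -` box l u = ?B"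
  proof (intro set_eqI iffI)
    show "x \<in> ?B" if "x \<in> (\<lambda>x. Q *v x) -` box l u" for x
      using that orthogonal_matrix_cancel(1)[OF Q, of x] by (metis imageI vimageE)
    show "x \<in> (\<lambda>x. Q *v x) -` box l u" if "x \<in> ?B" for x
      using that orthogonal_matrix_cancel(2)[OF Q] by (metis imageE vimageI)
  qed
  have meas: "(\<lambda>x. Q *v x) \<in> borel_measurable borel"
    by (intro borel_measurable_continuous_onI) (simp add: linear_continuous_on)
  have B: "?B \<in> sets borel"
    using measurable_sets[OF meas, of "box l u"] vim by simp
  have lm: "box l u \<in> lmeasurable" by simp
  have "?B \<in> lmeasurable" by (rule measurable_orthogonal_image[OF ot lm])
  then have "emeasure lborel ?B = ennreal (measure lebesgue ?B)" by (rule emeasure_eq[OF B])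
  also have "measure lebesgue ?B = measure lebesgue (box l u)" by (rule measure_orthogonal_image[OF ot lm])
  also have "ennreal \<dots> = emeasure lborel (box l u)" by (rule emeasure_eq[symmetric, OF _ lm]) simp
  finally have "emeasure lborel ?B = ennreal (\<Prod>b\<in>Basis. (u - l) \<bullet> b)" using le by simp
  then show "emeasure (distr lborel borel (\<lambda>x. Q *v x)) (box l u) = ennreal (\<Prod>b\<in>Basis. (u - l) \<bullet> b)"
    using meas vim by (subst emeasure_distr) auto
qed simp

lemma borel_measurable_lift3:
  assumes G[measurable]: "G \<in> borel_measurable borel"
  shows "(\<lambda>(s, t). G (Q *v lift3 s t) :: ennreal) \<in> borel_measurable borel"
proof -
  have "(\<lambda>p. Q *v lift3 (fst p) (snd p)) \<in> borel_measurable borel"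
    by (intro borel_measurable_continuous_onI bounded_linear.continuous_on[OF matrix_vector_mul_bounded_linear]
      continuous_on_lift3 continuous_intros)
  then show ?thesis using G unfolding split_beta by (rule measurable_compose)
qed

lemma measurable_graph_fibre_integral:
  fixes \<phi> :: "real^2 \<Rightarrow> real"
  assumes G: "G \<in> borel_measurable borel"
  shows "(\<lambda>s. \<integral>\<^sup>+t. G (graph_point Q \<phi> s t) \<partial>lborel) \<in> borel_measurable borel"
    and "(\<integral>\<^sup>+t. G (graph_point Q \<phi> s t) \<partial>lborel) = (\<integral>\<^sup>+t. G (Q *v lift3 s t) \<partial>lborel)"
proof -
  have m: "(\<lambda>(s, t). G (Q *v lift3 s t) :: ennreal) \<in> borel_measurable (lborel \<Otimes>\<^sub>M lborel)"
    using borel_measurable_lift3[OF G] by (simp add: lborel_prod)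
  have m1: "(\<lambda>t. G (Q *v lift3 s t)) \<in> borel_measurable borel" for s
    using measurable_compose[OF measurable_Pair1' m, of s] by simp
  show eq: "(\<integral>\<^sup>+t. G (graph_point Q \<phi> s t) \<partial>lborel) = (\<integral>\<^sup>+t. G (Q *v lift3 s t) \<partial>lborel)" for s
    using nn_integral_real_affine[OF m1, of 1 s "\<phi> s"] by (simp add: graph_point_lift3)
  show "(\<lambda>s. \<integral>\<^sup>+t. G (graph_point Q \<phi> s t) \<partial>lborel) \<in> borel_measurable borel"
    unfolding eq using lborel.borel_measurable_nn_integral[OF m] by simp
qed

text \<open>Graph coordinates preserve volume: they are a shear along the vertical axis, which is a translation for
  each fixed \<open>s\<close>, followed by an orthogonal map.\<close>

lemma nn_integral_graph_coordinates:
  fixes \<phi> :: "real^2 \<Rightarrow> real"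
  assumes Q: "orthogonal_matrix Q" and G: "G \<in> borel_measurable borel"
  shows "(\<integral>\<^sup>+s. \<integral>\<^sup>+t. G (graph_point Q \<phi> s t) \<partial>lborel \<partial>lborel) = (\<integral>\<^sup>+x. G x \<partial>lborel)"
proof -
  have m: "(\<lambda>(s, t). G (Q *v lift3 s t) :: ennreal) \<in> borel_measurable (lborel \<Otimes>\<^sub>M lborel)"
    using borel_measurable_lift3[OF G] by (simp add: lborel_prod)
  have mQ: "(\<lambda>x. Q *v x) \<in> borel_measurable borel"
    by (intro borel_measurable_continuous_onI) (simp add: linear_continuous_on)
  have mL: "(\<lambda>p. lift3 (fst p) (snd p)) \<in> borel_measurable borel"
    by (intro borel_measurable_continuous_onI bounded_linear.continuous_on[OF bounded_linear_lift3] continuous_on_id)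
  have "(\<integral>\<^sup>+s. \<integral>\<^sup>+t. G (graph_point Q \<phi> s t) \<partial>lborel \<partial>lborel) = (\<integral>\<^sup>+s. \<integral>\<^sup>+t. G (Q *v lift3 s t) \<partial>lborel \<partial>lborel)"
    by (simp add: measurable_graph_fibre_integral(2)[OF G])
  also have "\<dots> = (\<integral>\<^sup>+p. G (Q *v lift3 (fst p) (snd p)) \<partial>(lborel \<Otimes>\<^sub>M lborel))"
    using lborel.nn_integral_fst[OF m] unfolding case_prod_unfold by simp
  also have "\<dots> = (\<integral>\<^sup>+p. G (Q *v lift3 (fst p) (snd p)) \<partial>lborel)" by (simp add: lborel_prod)
  also have "\<dots> = (\<integral>\<^sup>+x. G (Q *v x) \<partial>distr lborel borel (\<lambda>p. lift3 (fst p) (snd p)))"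
    using measurable_compose[OF mQ G] mL by (subst nn_integral_distr) auto
  also have "\<dots> = (\<integral>\<^sup>+x. G (Q *v x) \<partial>lborel)" by (simp add: distr_lift3)
  also have "\<dots> = (\<integral>\<^sup>+x. G x \<partial>distr lborel borel (\<lambda>x. Q *v x))"
    using mQ G by (subst nn_integral_distr) auto
  finally show ?thesis by (simp add: distr_orthogonal_matrix[OF Q])
qed

subsection \<open>The exterior side of a chart\<close>

locale graph_chart_exterior =
  fixes D :: "(real^3) set" and Q :: "real^3^3" and \<phi> :: "real^2 \<Rightarrow> real" and V :: "(real^2) set" and h :: real
  assumes C21: "C21_on V \<phi>" and chart: "graph_chart D Q \<phi> V h"
begin

abbreviation "pt \<equiv> graph_point Q \<phi>"
abbreviation "nrm \<equiv> unit_normal Q \<phi>"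

lemma Q: "orthogonal_matrix Q" and V: "open V" and h: "0 < h"
  and below: "\<And>s \<tau>. s \<in> V \<Longrightarrow> \<bar>\<tau>\<bar> < h \<Longrightarrow> pt s \<tau> \<in> D \<longleftrightarrow> \<tau> < 0"
  using chart unfolding graph_chart_def by blast+

lemma phi_differentiable: "s \<in> V \<Longrightarrow> \<phi> differentiable (at s)"
  and pderiv_phi_differentiable: "s \<in> V \<Longrightarrow> pderiv_at i \<phi> differentiable (at s)"
  using C21 unfolding C21_on_def by blast+

lemma phi_cont: "continuous_on V \<phi>" and pderiv_phi_cont: "continuous_on V (pderiv_at i \<phi>)"
  by (auto intro!: continuous_at_imp_continuous_on
      intro: differentiable_imp_continuous_within[OF phi_differentiable]
        differentiable_imp_continuous_within[OF pderiv_phi_differentiable])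

lemma pderiv2_phi_cont: "continuous_on V (pderiv_at i (pderiv_at j \<phi>))"
  using C21 unfolding C21_on_def by (meson lipschitz_on_continuous_on)

text \<open>Young's theorem applies because the first partial derivatives of a \<open>C21_on\<close> function are differentiable.\<close>

lemma phi_hessian_symmetric:
  "s \<in> V \<Longrightarrow> pderiv_at i (pderiv_at j \<phi>) s = pderiv_at j (pderiv_at i \<phi>) s"
  using pderiv_at_commute[OF V] phi_differentiable pderiv_phi_differentiable by blast

lemma graph_point_cont: "continuous_on (V \<times> UNIV) (\<lambda>(s, \<tau>). pt s \<tau>)"
proof -
  have "continuous_on (V \<times> (UNIV :: real set)) (\<lambda>p. \<phi> (fst p))"
    by (rule continuous_on_compose2[OF phi_cont]) (auto intro: continuous_intros)
  then show ?thesis unfolding case_prod_unfold graph_point_lift3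
    by (intro bounded_linear.continuous_on[OF matrix_vector_mul_bounded_linear] continuous_intros)
qed

lemma graph_point_slice_cont: "continuous_on V (\<lambda>s. pt s \<tau>)"
proof -
  have "continuous_on V (\<lambda>s. (s, \<tau>))" by (intro continuous_intros)
  from continuous_on_compose2[OF graph_point_cont this] show ?thesis by auto
qed

text \<open>The points between the graph and its translate by \<open>h\<close> form an open set that does not meet \<open>D\<close>, so this set does not
  meet the closure either.\<close>

lemma graph_point_exterior:
  assumes "s \<in> V" "0 < \<tau>" "\<tau> < h"
  shows "pt s \<tau> \<in> - closure D"
proof -
  define c where "c = (\<lambda>x. transpose Q *v x)"
  define p where "p = (\<lambda>x. vector [c x $ 1, c x $ 2] :: real^2)"
  define O1 where "O1 = p -` V"
  define O2 where "O2 = {x \<in> O1. 0 < c x $ 3 - \<phi> (p x) \<and> c x $ 3 - \<phi> (p x) < h}"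
  have c_lin: "bounded_linear c" unfolding c_def by (rule matrix_vector_mul_bounded_linear)
  have "bounded_linear (\<lambda>y::real^3. vector [y $ 1, y $ 2] :: real^2)"
    by (intro linear_conv_bounded_linear[THEN iffD1] linearI) (simp_all add: vec_eq_iff forall_2)
  then have p_cont: "continuous_on UNIV p" unfolding p_def
    using bounded_linear_compose[OF _ c_lin] by (intro linear_continuous_on) auto
  have "open O1" unfolding O1_def using V p_cont by (intro open_vimage) auto
  moreover have "continuous_on O1 (\<lambda>x. c x $ 3 - \<phi> (p x))"
  proof (intro continuous_on_diff)
    show "continuous_on O1 (\<lambda>x. \<phi> (p x))"
      by (rule continuous_on_compose2[OF phi_cont continuous_on_subset[OF p_cont]]) (auto simp: O1_def)
    show "continuous_on O1 (\<lambda>x. c x $ 3)"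
      by (intro continuous_on_component bounded_linear.continuous_on[OF c_lin] continuous_on_id)
  qed
  ultimately have "open (O1 \<inter> (\<lambda>x. c x $ 3 - \<phi> (p x)) -` {0<..<h})"
    by (intro continuous_open_preimage) auto
  moreover have "O1 \<inter> (\<lambda>x. c x $ 3 - \<phi> (p x)) -` {0<..<h} = O2" by (auto simp: O2_def)
  ultimately have O2: "open O2" by simp
  have "x \<notin> D" if "x \<in> O2" for x
  proof -
    have "lift3 (p x) (\<phi> (p x) + (c x $ 3 - \<phi> (p x))) = c x" by (simp add: p_def vec_eq_iff forall_3)
    then have "pt (p x) (c x $ 3 - \<phi> (p x)) = x"
      using orthogonal_matrix_cancel(2)[OF Q] by (simp only: graph_point_lift3 c_def)
    then show ?thesis using below[of "p x" "c x $ 3 - \<phi> (p x)"] that by (auto simp: O2_def O1_def)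
  qed
  then have "O2 \<inter> D = {}" by blast
  then have "O2 \<inter> closure D = {}" using O2 open_Int_closure_eq_empty by blast
  moreover have "pt s \<tau> \<in> O2"
  proof -
    have "c (pt s \<tau>) = lift3 s (\<phi> s + \<tau>)"
      using orthogonal_matrix_cancel(1)[OF Q] by (simp only: graph_point_lift3 c_def)
    moreover from this have "p (pt s \<tau>) = s" by (simp add: p_def vec_eq_iff forall_2)
    ultimately show ?thesis using assms by (simp add: O2_def O1_def)
  qed
  ultimately show ?thesis by blast
qed

lemma graph_point_regular: "s \<in> V \<Longrightarrow> pt s 0 \<in> regular_points D"
  using C21 chart unfolding regular_points_def C21_chart_def by blast

end

lemma sqint_Un_finite:
  fixes u :: "real^'n::finite \<Rightarrow> 'b::real_normed_vector"
  assumes "open A" "open B" "continuous_on A u" "continuous_on B u" "sqint A u < \<infinity>" "sqint B u < \<infinity>"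
  shows "sqint (A \<union> B) u < \<infinity>"
proof -
  note [measurable] = measurable_sqint[OF disjI2[OF assms(1)] assms(3)] measurable_sqint[OF disjI2[OF assms(2)] assms(4)]
  have "sqint (A \<union> B) u \<le> (\<integral>\<^sup>+x. ennreal ((norm (u x))\<^sup>2) * indicator A x + ennreal ((norm (u x))\<^sup>2) * indicator B x \<partial>lborel)"
    unfolding sqint_def by (intro nn_integral_mono) (auto simp: indicator_def)
  also have "\<dots> = sqint A u + sqint B u" unfolding sqint_def by (rule nn_integral_add) auto
  also have "\<dots> < \<infinity>" using assms by simp
  finally show ?thesis .
qed

lemma sobolev_bounded_iff: "sobolev_bounded k S f \<longleftrightarrow> (\<forall>js. length js \<le> k \<longrightarrow> sqint S (iter_pderiv js f) < \<infinity>)"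
  by (simp add: sobolev_bounded_def sqint_def)

lemma sobolev_bounded_Union:
  assumes "finite \<W>" "closed D" "smooth_on (- D) u"
    and "\<And>W. W \<in> \<W> \<Longrightarrow> open W \<and> sobolev_bounded k (W - D) u"
  shows "sobolev_bounded k (\<Union>\<W> - D) u"
  using assms(1,4)
proof (induction \<W> rule: finite_induct)
  case empty
  then show ?case by (simp add: sobolev_bounded_iff sqint_def)
next
  case (insert W \<W>)
  have o: "open (W - D)" "open (\<Union>\<W> - D)" using insert.prems assms(2) by auto
  show ?case unfolding sobolev_bounded_iff
  proof (intro allI impI)
    fix js :: "3 list" assume js: "length js \<le> k"
    have c: "continuous_on (- D) (iter_pderiv js u)"
      using smooth_on_continuous_on smooth_on_iter_pderiv assms(3) by blast
    have "sqint ((W - D) \<union> (\<Union>\<W> - D)) (iter_pderiv js u) < \<infinity>"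
    proof (rule sqint_Un_finite[OF o])
      show "continuous_on (W - D) (iter_pderiv js u)" by (rule continuous_on_subset[OF c]) blast
      show "continuous_on (\<Union>\<W> - D) (iter_pderiv js u)" by (rule continuous_on_subset[OF c]) blast
      show "sqint (W - D) (iter_pderiv js u) < \<infinity>" using insert.prems js by (simp add: sobolev_bounded_iff)
      show "sqint (\<Union>\<W> - D) (iter_pderiv js u) < \<infinity>" using insert.IH insert.prems js by (simp add: sobolev_bounded_iff)
    qed
    then show "sqint (\<Union>(insert W \<W>) - D) (iter_pderiv js u) < \<infinity>" by (simp add: Un_Diff)
  qed
qed

lemma norm_sum3_square_le:
  fixes a :: "3 \<Rightarrow> 'b::real_normed_vector"
  assumes "\<And>k. \<bar>c k\<bar> \<le> 1"
  shows "(norm (\<Sum>k\<in>UNIV. c k *\<^sub>R a k))\<^sup>2 \<le> 3 * (\<Sum>k\<in>UNIV. (norm (a k))\<^sup>2)"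
proof -
  have "norm (\<Sum>k\<in>UNIV. c k *\<^sub>R a k) \<le> (\<Sum>k\<in>UNIV. norm (a k))"
    using assms by (intro sum_norm_le) (simp add: mult_left_le_one_le)
  then have "(norm (\<Sum>k\<in>UNIV. c k *\<^sub>R a k))\<^sup>2 \<le> (\<Sum>k\<in>UNIV. norm (a k))\<^sup>2" by (intro power_mono) auto
  also have "\<dots> \<le> 3 * (\<Sum>k\<in>UNIV. (norm (a k))\<^sup>2)"
  proof -
    have "3 * (x\<^sup>2 + y\<^sup>2 + z\<^sup>2) - (x + y + z)\<^sup>2 = (x - y)\<^sup>2 + (y - z)\<^sup>2 + (x - z)\<^sup>2" for x y z :: real
      by (simp add: power2_eq_square algebra_simps)
    then have "(x + y + z)\<^sup>2 \<le> 3 * (x\<^sup>2 + y\<^sup>2 + z\<^sup>2)" for x y z :: real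
      by (metis add_nonneg_nonneg diff_ge_0_iff_ge zero_le_power2)
    then show ?thesis by (simp add: sum_3)
  qed
  finally show ?thesis .
qed

context graph_chart_exterior
begin

text \<open>Sobolev bounds are given near single points; finitely many of these neighbourhoods cover a compact part of
  the boundary.\<close>

lemma sobolev_neighbourhood:
  assumes C: "compact C" "C \<subseteq> V" and u: "smooth_on (- closure D) u" "Hk_near_regular_pieces k D u"
  obtains S \<delta> where "open S" "S \<subseteq> - closure D" "sobolev_bounded k S u" "0 < \<delta>" "\<delta> \<le> h"
    "\<And>s \<tau>. s \<in> C \<Longrightarrow> 0 < \<tau> \<Longrightarrow> \<tau> < \<delta> \<Longrightarrow> pt s \<tau> \<in> S"
proof -
  define K where "K = (\<lambda>s. pt s 0) ` C"
  have K: "compact K" unfolding K_def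
    using C graph_point_slice_cont by (intro compact_continuous_image) (auto intro: continuous_on_subset)
  define \<W> where "\<W> = {W. open W \<and> sobolev_bounded k (W - closure D) u}"
  have "K \<subseteq> \<Union>\<W>"
  proof
    fix y assume "y \<in> K"
    then have "y \<in> regular_points D" using graph_point_regular C unfolding K_def by blast
    then show "y \<in> \<Union>\<W>" using u(2) unfolding Hk_near_regular_pieces_def \<W>_def by blast
  qed
  then obtain \<W>' where W': "\<W>' \<subseteq> \<W>" "finite \<W>'" "K \<subseteq> \<Union>\<W>'"
    using compactE[OF K] unfolding \<W>_def by (metis (no_types, lifting) mem_Collect_eq)
  have oW: "open (\<Union>\<W>')" using W'(1) unfolding \<W>_def by blast
  obtain \<epsilon> where \<epsilon>: "\<epsilon> > 0" "(\<Union>x\<in>K. cball x \<epsilon>) \<subseteq> \<Union>\<W>'"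
    using compact_subset_open_imp_cball_epsilon_subset[OF K oW W'(3)] by blast
  show thesis
  proof (rule that[of "\<Union>\<W>' - closure D" "min \<epsilon> h"])
    show "sobolev_bounded k (\<Union>\<W>' - closure D) u"
      using W' u(1) by (intro sobolev_bounded_Union) (auto simp: \<W>_def)
    fix s \<tau> assume s: "s \<in> C" and \<tau>: "0 < \<tau>" "\<tau> < min \<epsilon> h"
    have "pt s \<tau> - pt s 0 = Q *v (lift3 s (\<phi> s + \<tau>) - lift3 s (\<phi> s + 0))"
      by (simp only: graph_point_lift3 matrix_vector_mult_diff_distrib)
    also have "lift3 s (\<phi> s + \<tau>) - lift3 s (\<phi> s + 0) = \<tau> *\<^sub>R axis 3 1" by (simp add: vec_eq_iff forall_3 axis_def)
    finally have "norm (pt s \<tau> - pt s 0) = \<bar>\<tau>\<bar>"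
      using orthogonal_transformation_norm[OF orthogonal_matrix_transformation[OF Q]] by simp
    then have "pt s \<tau> \<in> cball (pt s 0) \<epsilon>"
      using \<tau> by (simp add: dist_norm norm_minus_commute)
    then have "pt s \<tau> \<in> \<Union>\<W>'" using \<epsilon>(2) s unfolding K_def by blast
    then show "pt s \<tau> \<in> \<Union>\<W>' - closure D"
      using graph_point_exterior[of s \<tau>] s C \<tau> by auto
  qed (use oW \<epsilon> h in auto)
qed

lemma slice_cont_smooth:
  assumes "smooth_on (- closure D) u"
  shows "slice_cont V h (\<lambda>s \<tau>. u (pt s \<tau>))"
  unfolding slice_cont_def
  using graph_point_exterior
  by (auto intro!: continuous_on_compose2[OF smooth_on_continuous_on[OF assms] graph_point_slice_cont])

text \<open>Functions that are \<open>H\<^sup>1\<close> near the boundary have a trace: slices at heights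
  \<open>\<tau>\<close> and \<open>\<tau>'\<close> differ in \<open>L\<^sup>2\<close> by at most a constant times the square root of \<open>\<bar>\<tau> - \<tau>'\<bar>\<close> times the
  \<open>L\<^sup>2\<close> norm of the gradient.\<close>

lemma slice_cauchy_H1:
  fixes u :: "real^3 \<Rightarrow> 'b::euclidean_space"
  assumes u: "smooth_on (- closure D) u" "Hk_near_regular_pieces 1 D u"
  shows "slice_cauchy V (\<lambda>s \<tau>. u (pt s \<tau>))"
  unfolding slice_cauchy_iff
proof (intro allI impI, elim conjE)
  fix C and e :: real assume C: "compact C" "C \<subseteq> V" and e: "0 < e"
  obtain S \<delta> where S: "open S" "S \<subseteq> - closure D" "sobolev_bounded 1 S u" and \<delta>: "0 < \<delta>" "\<delta> \<le> h"
    and FS: "\<And>s \<tau>. s \<in> C \<Longrightarrow> 0 < \<tau> \<Longrightarrow> \<tau> < \<delta> \<Longrightarrow> pt s \<tau> \<in> S"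
    using sobolev_neighbourhood[OF C u] by metis
  have uS: "smooth_on S u" using u(1) S(2) by (rule smooth_on_subset)
  have cont: "continuous_on S (pderiv_at k u)" for k
    by (intro smooth_on_continuous_on smooth_on_pderiv_at uS)
  define G where "G = (\<lambda>x. \<Sum>k\<in>UNIV. 3 * (ennreal ((norm (pderiv_at k u x))\<^sup>2) * indicator S x))"
  have m[measurable]: "(\<lambda>x. ennreal ((norm (pderiv_at k u x))\<^sup>2) * indicator S x) \<in> borel_measurable borel" for k
    by (rule measurable_sqint[OF disjI2[OF S(1)] cont])
  have G[measurable]: "G \<in> borel_measurable borel" unfolding G_def by measurable
  have "(\<integral>\<^sup>+x. G x \<partial>lborel) = (\<Sum>k\<in>UNIV. 3 * sqint S (pderiv_at k u))"
    unfolding G_def sqint_def by (subst nn_integral_sum) (auto simp: nn_integral_cmult)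
  also have "\<dots> < \<infinity>"
  proof -
    have "sqint S (pderiv_at k u) < \<infinity>" for k
      using S(3)[unfolded sobolev_bounded_iff, rule_format, of "[k]"] by simp
    then show ?thesis by (simp add: sum_3 ennreal_mult_less_top)
  qed
  finally obtain M where M: "(\<integral>\<^sup>+x. G x \<partial>lborel) = ennreal M" "M \<ge> 0"
    by (cases "\<integral>\<^sup>+x. G x \<partial>lborel") auto
  define n where "n = Q *v axis 3 1"
  have n1: "\<bar>n $ k\<bar> \<le> 1" for k
    using component_le_norm_cart[of n k] orthogonal_transformation_norm[OF orthogonal_matrix_transformation[OF Q]]
    by (simp add: n_def)
  define \<delta>' where "\<delta>' = min \<delta> (e / (M + 1))"
  have \<delta>': "\<delta>' > 0" "\<delta>' \<le> \<delta>" using \<delta> e M by (auto simp: \<delta>'_def)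
  have \<delta>M: "\<delta>' * M \<le> e"
  proof -
    have "\<delta>' * M \<le> (e / (M + 1)) * (M + 1)" using e M by (intro mult_mono) (auto simp: \<delta>'_def)
    then show ?thesis using M by simp
  qed
  have le: "sqint C (\<lambda>s. u (pt s \<tau>) - u (pt s \<tau>')) \<le> ennreal e" if t: "0 < \<tau>'" "\<tau>' \<le> \<tau>" "\<tau> < \<delta>'" for \<tau> \<tau>'
  proof -
    have pt: "ennreal ((norm (u (pt s \<tau>) - u (pt s \<tau>')))\<^sup>2) \<le> ennreal \<delta>' * (\<integral>\<^sup>+r. G (pt s r) \<partial>lborel)" if s: "s \<in> C" for s
    proof -
      define q where "q = (\<lambda>r. \<Sum>k\<in>UNIV. n $ k *\<^sub>R pderiv_at k u (pt s r))"
      have inS: "pt s r \<in> S" if "r \<in> {\<tau>'..\<tau>}" for r using that t s \<delta>' by (intro FS) auto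
      have F_eq: "pt s r = pt s 0 + r *\<^sub>R n" for r
      proof -
        have "lift3 s (\<phi> s + r) = lift3 s (\<phi> s + 0) + r *\<^sub>R axis 3 1" by (simp add: vec_eq_iff forall_3 axis_def)
        then show ?thesis unfolding graph_point_lift3 n_def
          by (simp only: matrix_vector_right_distrib matrix_vector_mult_scaleR)
      qed
      have der: "((\<lambda>r. u (pt s r)) has_vector_derivative q r) (at r within {\<tau>'..\<tau>})" if r: "\<tau>' \<le> r" "r \<le> \<tau>" for r
      proof -
        have "((\<lambda>r. pt s 0 + r *\<^sub>R n) has_derivative (\<lambda>x. x *\<^sub>R n)) (at r within {\<tau>'..\<tau>})"
          by (auto intro!: derivative_eq_intros)
        then have d1: "(pt s has_derivative (\<lambda>x. x *\<^sub>R n)) (at r within {\<tau>'..\<tau>})" by (simp only: F_eq[symmetric])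
        have "u differentiable at (pt s r)" using smooth_on_differentiable[OF uS] inS r by auto
        from has_derivative_compose[OF d1 has_derivative_pderiv_sum[OF this]]
        show ?thesis unfolding q_def has_vector_derivative_def
          by (simp add: scaleR_sum_right)
      qed
      have "continuous_on {\<tau>'..\<tau>} (\<lambda>r. pt s 0 + r *\<^sub>R n)" by (intro continuous_intros)
      then have Fc: "continuous_on {\<tau>'..\<tau>} (pt s)" by (simp only: F_eq[symmetric])
      have qc: "continuous_on {\<tau>'..\<tau>} q" unfolding q_def
        by (intro continuous_on_sum continuous_on_scaleR continuous_on_const continuous_on_compose2[OF cont Fc]) (use inS in auto)
      have "ennreal ((norm (u (pt s \<tau>) - u (pt s \<tau>')))\<^sup>2) \<le> ennreal (\<tau> - \<tau>') * sqint {\<tau>'..\<tau>} q"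
        by (rule increment_square_le[OF t(2) der qc])
      also have "\<dots> \<le> ennreal \<delta>' * (\<integral>\<^sup>+r. G (pt s r) \<partial>lborel)"
      proof (rule mult_mono)
        show "ennreal (\<tau> - \<tau>') \<le> ennreal \<delta>'" using t by (intro ennreal_leI) auto
        show "sqint {\<tau>'..\<tau>} q \<le> (\<integral>\<^sup>+r. G (pt s r) \<partial>lborel)"
          unfolding sqint_def
        proof (rule nn_integral_mono)
          fix r
          have "ennreal ((norm (q r))\<^sup>2) \<le> G (pt s r)" if "r \<in> {\<tau>'..\<tau>}"
          proof -
            have "ennreal ((norm (q r))\<^sup>2) \<le> ennreal (3 * (\<Sum>k\<in>UNIV. (norm (pderiv_at k u (pt s r)))\<^sup>2))"
              unfolding q_def by (intro ennreal_leI norm_sum3_square_le n1)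
            also have "\<dots> = G (pt s r)"
              using inS[OF that] unfolding G_def by (simp add: sum_3 ennreal_mult ennreal_plus distrib_left)
            finally show ?thesis .
          qed
          then show "ennreal ((norm (q r))\<^sup>2) * indicator {\<tau>'..\<tau>} r \<le> G (pt s r)" by (simp add: indicator_def)
        qed
      qed auto
      finally show ?thesis .
    qed
    have "sqint C (\<lambda>s. u (pt s \<tau>) - u (pt s \<tau>')) \<le> (\<integral>\<^sup>+s. ennreal \<delta>' * (\<integral>\<^sup>+r. G (pt s r) \<partial>lborel) \<partial>lborel)"
      unfolding sqint_def using pt by (intro nn_integral_mono) (auto simp: indicator_def)
    also have "\<dots> = ennreal \<delta>' * (\<integral>\<^sup>+s. \<integral>\<^sup>+r. G (pt s r) \<partial>lborel \<partial>lborel)"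
      using measurable_graph_fibre_integral(1)[OF G] by (intro nn_integral_cmult) simp
    also have "\<dots> = ennreal (\<delta>' * M)"
      using nn_integral_graph_coordinates[OF Q G] M \<delta>' by (simp add: ennreal_mult)
    also have "\<dots> \<le> ennreal e" using \<delta>M by (rule ennreal_leI)
    finally show ?thesis .
  qed
  have "sqint C (\<lambda>s. u (pt s \<tau>) - u (pt s \<tau>')) \<le> ennreal e"
    if t: "0 < \<tau> \<and> \<tau> < \<delta>' \<and> 0 < \<tau>' \<and> \<tau>' < \<delta>'" for \<tau> \<tau>'
  proof (cases "\<tau>' \<le> \<tau>")
    case False
    have "sqint C (\<lambda>s. u (pt s \<tau>) - u (pt s \<tau>')) = sqint C (\<lambda>s. u (pt s \<tau>') - u (pt s \<tau>))"
      by (simp add: sqint_def norm_minus_commute)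
    then show ?thesis using le[of \<tau> \<tau>'] t False by simp
  qed (use le t in auto)
  then show "\<exists>\<delta>>0. \<forall>\<tau> \<tau>'. 0 < \<tau> \<and> \<tau> < \<delta> \<and> 0 < \<tau>' \<and> \<tau>' < \<delta> \<longrightarrow> sqint C (\<lambda>s. u (pt s \<tau>) - u (pt s \<tau>')) \<le> ennreal e"
    using \<delta>'(1) by blast
qed

end

section \<open>Geometry of the boundary\<close>

subsection \<open>Pairing real vectors with complex fields\<close>

text \<open>Normals and tangents are real vectors, the fields are complex; the pairing is bilinear and does not conjugate.\<close>

definition rdot :: "real^3 \<Rightarrow> complex^3 \<Rightarrow> complex" where
  "rdot a u = cdot (cvec a) u"

lemma rdot_sum: "rdot a u = (\<Sum>k\<in>UNIV. complex_of_real (a $ k) * u $ k)"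
  by (simp add: rdot_def cdot_def cvec_def)

lemma bounded_bilinear_rdot: "bounded_bilinear rdot"
  unfolding bilinear_conv_bounded_bilinear[symmetric] bilinear_def
  by (auto intro!: linearI simp: rdot_sum sum_3 algebra_simps scaleR_conv_of_real[where 'a = complex])

definition dir_deriv :: "real^3 \<Rightarrow> (real^3 \<Rightarrow> 'b::real_normed_vector) \<Rightarrow> real^3 \<Rightarrow> 'b" where
  "dir_deriv a u x = (\<Sum>k\<in>UNIV. a $ k *\<^sub>R pderiv_at k u x)"

lemma rdot_dir_deriv:
  "rdot b (dir_deriv a U x) = (\<Sum>k\<in>UNIV. \<Sum>l\<in>UNIV. complex_of_real (a $ k) * complex_of_real (b $ l) * pderiv_at k U x $ l)"
  by (simp add: rdot_sum dir_deriv_def sum_3 scaleR_conv_of_real[where 'a = complex] algebra_simps)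

text \<open>On a pair of tangents the curl is the antisymmetric part of the derivative; this turns the normal component of a
  curl into tangential derivatives.\<close>

lemma rdot_curl_cross:
  "rdot (cross3 a b) (curl U x) = rdot b (dir_deriv a U x) - rdot a (dir_deriv b U x)"
  unfolding rdot_dir_deriv unfolding rdot_sum by (simp add: cross3_def curl_def sum_3 algebra_simps)

lemma rdot_ccross_curl:
  "rdot t (ccross (cvec n) (curl U x)) = rdot n (dir_deriv t U x) - rdot t (dir_deriv n U x)"
  unfolding rdot_dir_deriv unfolding rdot_sum by (simp add: ccross_def cvec_def curl_def sum_3 algebra_simps)

text \<open>Lagrange's identity. For a unit vector \<open>n\<close> and \<open>t\<close> orthogonal to it, the component of \<open>u\<close> along \<open>t\<close> is
  recovered from the cross product of \<open>n\<close> with \<open>u\<close>.\<close>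

lemma rdot_lagrange:
  "rdot (cross3 n t) (ccross (cvec n) u) = complex_of_real (n \<bullet> n) * rdot t u - complex_of_real (n \<bullet> t) * rdot n u"
  by (simp add: rdot_sum cross3_def ccross_def cvec_def inner_vec_def sum_3 algebra_simps)

lemma rdot_ccross_self: "rdot n (ccross (cvec n) u) = 0"
  by (simp add: rdot_sum ccross_def cvec_def sum_3 algebra_simps)

lemma rdot_traction:
  assumes "U differentiable at x"
  shows "rdot b (traction lam \<mu> U n x) = complex_of_real (2 * \<mu>) * rdot b (dir_deriv n U x)
    + complex_of_real (lam * (n \<bullet> b)) * divergence U x + complex_of_real \<mu> * rdot b (ccross (cvec n) (curl U x))"
proof -
  have "gradient (\<lambda>z. U z $ j) x = (\<chi> i. pderiv_at i U x $ j)" for j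
    by (simp add: gradient_def vec_eq_iff pderiv_at_bounded_linear[OF bounded_linear_vec_nth assms])
  then show ?thesis unfolding traction_def rdot_dir_deriv unfolding rdot_sum
    by (simp add: cdot_def cvec_def inner_vec_def sum_3 scaleR_conv_of_real[where 'a = complex] algebra_simps)
qed

subsection \<open>The moving frame of a chart\<close>

context graph_chart_exterior
begin

abbreviation "d\<phi> \<equiv> \<lambda>i s. pderiv_at i \<phi> s"
abbreviation "hess \<equiv> \<lambda>i j s. pderiv_at i (pderiv_at j \<phi>) s"

text \<open>The frame \<open>tangent 1\<close>, \<open>tangent 2\<close>, \<open>conormal\<close> is not normalised, so that it depends polynomially on the
  gradient of \<open>\<phi>\<close> and its derivatives are entries of the Hessian; \<open>horizontal 1\<close>, \<open>horizontal 2\<close>, \<open>vertical\<close>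
  are the columns of \<open>Q\<close>.\<close>

definition tangent :: "2 \<Rightarrow> real^2 \<Rightarrow> real^3" where
  "tangent j s = Q *v lift3 (axis j 1) (d\<phi> j s)"

definition vertical :: "real^3" where "vertical = Q *v axis 3 1"

definition horizontal :: "2 \<Rightarrow> real^3" where "horizontal j = Q *v lift3 (axis j 1) 0"

definition conormal :: "real^2 \<Rightarrow> real^3" where
  "conormal s = Q *v lift3 (- (\<chi> i. d\<phi> i s)) 1"

definition area :: "real^2 \<Rightarrow> real" where
  "area s = sqrt (1 + (d\<phi> 1 s)\<^sup>2 + (d\<phi> 2 s)\<^sup>2)"

lemma area_pos: "area s > 0" and area_square: "(area s)\<^sup>2 = 1 + (d\<phi> 1 s)\<^sup>2 + (d\<phi> 2 s)\<^sup>2"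
  by (simp_all add: area_def add_pos_nonneg add_nonneg_nonneg)

lemma tangent_eq: "tangent j s = horizontal j + d\<phi> j s *\<^sub>R vertical"
proof -
  have "lift3 (axis j 1) (d\<phi> j s) = lift3 (axis j 1) 0 + d\<phi> j s *\<^sub>R axis 3 1"
    by (simp add: vec_eq_iff forall_3 axis_def)
  then show ?thesis unfolding tangent_def horizontal_def vertical_def
    by (simp only: matrix_vector_right_distrib matrix_vector_mult_scaleR)
qed

lemma conormal_eq: "conormal s = vertical - d\<phi> 1 s *\<^sub>R horizontal 1 - d\<phi> 2 s *\<^sub>R horizontal 2"
proof -
  have "lift3 (- (\<chi> i. d\<phi> i s)) 1 = axis 3 1 - d\<phi> 1 s *\<^sub>R lift3 (axis 1 1) 0 - d\<phi> 2 s *\<^sub>R lift3 (axis 2 1) 0"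
    by (simp add: vec_eq_iff forall_3 axis_def)
  then show ?thesis unfolding conormal_def horizontal_def vertical_def
    by (simp only: matrix_vector_mult_diff_distrib matrix_vector_mult_scaleR)
qed

lemma Q_inner: "(Q *v x) \<bullet> (Q *v y) = x \<bullet> y"
  using orthogonal_matrix_transformation[OF Q] by (simp add: orthogonal_transformation_def)

lemma inner_frame:
  "vertical \<bullet> vertical = 1" "horizontal i \<bullet> vertical = 0" "vertical \<bullet> horizontal i = 0"
  "horizontal i \<bullet> horizontal j = (if i = j then 1 else 0)"
  unfolding vertical_def horizontal_def Q_inner
  using exhaust_2[of i] exhaust_2[of j] by (auto simp: inner_vec_def sum_3 axis_def)

lemma frame_complete:
  "horizontal 1 $ k * horizontal 1 $ l + horizontal 2 $ k * horizontal 2 $ l + vertical $ k * vertical $ l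
    = (if k = l then 1 else 0)"
proof -
  have e: "horizontal 1 = column 1 Q" "horizontal 2 = column 2 Q" "vertical = column 3 Q"
  proof -
    have "lift3 (axis 1 1) 0 = axis 1 1" "lift3 (axis 2 1) 0 = axis 2 1"
      by (simp_all add: vec_eq_iff forall_3 axis_def)
    then show "horizontal 1 = column 1 Q" "horizontal 2 = column 2 Q" "vertical = column 3 Q"
      by (simp_all add: horizontal_def vertical_def matrix_vector_mult_basis)
  qed
  have "(Q ** transpose Q) $ k $ l = (if k = l then 1 else 0)"
    using Q by (simp add: orthogonal_matrix_def mat_def)
  then show ?thesis unfolding e by (simp add: matrix_matrix_mult_def transpose_def column_def sum_3)
qed

text \<open>The tangential coefficients are the entries of the inverse first fundamental form, multiplied by its
  determinant \<open>(area s)\<^sup>2\<close>; the conormal has the square length \<open>(area s)\<^sup>2\<close>.\<close>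

lemma trace_in_frame:
  fixes M :: "3 \<Rightarrow> 3 \<Rightarrow> complex" and s :: "real^2"
  defines "B \<equiv> \<lambda>a b. \<Sum>k\<in>UNIV. \<Sum>l\<in>UNIV. complex_of_real (a $ k) * complex_of_real (b $ l) * M k l"
    and "g1 \<equiv> complex_of_real (1 + (d\<phi> 1 s)\<^sup>2)" and "g2 \<equiv> complex_of_real (1 + (d\<phi> 2 s)\<^sup>2)"
    and "g12 \<equiv> complex_of_real (d\<phi> 1 s * d\<phi> 2 s)"
  shows "complex_of_real ((area s)\<^sup>2) * (\<Sum>k\<in>UNIV. M k k) = B (conormal s) (conormal s)
    + g2 * B (tangent 1 s) (tangent 1 s) + g1 * B (tangent 2 s) (tangent 2 s)
    - g12 * (B (tangent 1 s) (tangent 2 s) + B (tangent 2 s) (tangent 1 s))"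
proof -
  let ?p = "d\<phi> 1 s" and ?q = "d\<phi> 2 s"
  let ?N = "conormal s" and ?T = "\<lambda>j. tangent j s"
  have pt: "?N $ k * ?N $ l + (1 + ?q\<^sup>2) * (?T 1 $ k * ?T 1 $ l) + (1 + ?p\<^sup>2) * (?T 2 $ k * ?T 2 $ l)
     - ?p * ?q * (?T 1 $ k * ?T 2 $ l + ?T 2 $ k * ?T 1 $ l) = (if k = l then (area s)\<^sup>2 else 0)" for k l
  proof -
    have "?N $ k * ?N $ l + (1 + ?q\<^sup>2) * (?T 1 $ k * ?T 1 $ l) + (1 + ?p\<^sup>2) * (?T 2 $ k * ?T 2 $ l)
     - ?p * ?q * (?T 1 $ k * ?T 2 $ l + ?T 2 $ k * ?T 1 $ l)
      = (1 + ?p\<^sup>2 + ?q\<^sup>2) * (horizontal 1 $ k * horizontal 1 $ l + horizontal 2 $ k * horizontal 2 $ l + vertical $ k * vertical $ l)"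
      \<comment> \<open>both sides are quadratic in the columns of \<open>Q\<close>; their completeness relation is only used afterwards\<close>
      unfolding conormal_eq tangent_eq by (simp add: power2_eq_square) algebra
    then show ?thesis unfolding frame_complete area_square by simp
  qed
  have "B ?N ?N + g2 * B (?T 1) (?T 1) + g1 * B (?T 2) (?T 2) - g12 * (B (?T 1) (?T 2) + B (?T 2) (?T 1))
    = (\<Sum>k\<in>UNIV. \<Sum>l\<in>UNIV. complex_of_real (?N $ k * ?N $ l + (1 + ?q\<^sup>2) * (?T 1 $ k * ?T 1 $ l) + (1 + ?p\<^sup>2) * (?T 2 $ k * ?T 2 $ l)
     - ?p * ?q * (?T 1 $ k * ?T 2 $ l + ?T 2 $ k * ?T 1 $ l)) * M k l)"
    unfolding B_def g1_def g2_def g12_def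
    by (simp add: sum.distrib sum_subtractf sum_distrib_left distrib_left distrib_right left_diff_distrib right_diff_distrib mult_ac add_ac)
  also have "\<dots> = (\<Sum>k\<in>UNIV. \<Sum>l\<in>UNIV. if k = l then complex_of_real ((area s)\<^sup>2) * M k l else 0)"
    unfolding pt by (intro sum.cong refl) auto
  also have "\<dots> = complex_of_real ((area s)\<^sup>2) * (\<Sum>k\<in>UNIV. M k k)"
    by (simp add: sum_distrib_left)
  finally show ?thesis by simp
qed

lemma vector_in_frame:
  fixes a :: "complex^3" and s :: "real^2"
  defines "c1 \<equiv> complex_of_real (1 + (d\<phi> 2 s)\<^sup>2) * rdot (tangent 1 s) a - complex_of_real (d\<phi> 1 s * d\<phi> 2 s) * rdot (tangent 2 s) a"
    and "c2 \<equiv> complex_of_real (1 + (d\<phi> 1 s)\<^sup>2) * rdot (tangent 2 s) a - complex_of_real (d\<phi> 1 s * d\<phi> 2 s) * rdot (tangent 1 s) a"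
  shows "complex_of_real ((area s)\<^sup>2) * a $ m = rdot (conormal s) a * complex_of_real (conormal s $ m)
    + c1 * complex_of_real (tangent 1 s $ m) + c2 * complex_of_real (tangent 2 s $ m)"
proof -
  have B: "(\<Sum>k\<in>UNIV. \<Sum>l\<in>UNIV. complex_of_real (v $ k) * complex_of_real (w $ l) * (if l = m then a $ k else 0))
    = rdot v a * complex_of_real (w $ m)" for v w :: "real^3"
  proof -
    have "(\<Sum>l\<in>UNIV. complex_of_real (v $ k) * complex_of_real (w $ l) * (if l = m then a $ k else 0))
      = complex_of_real (v $ k) * a $ k * complex_of_real (w $ m)" for k
    proof -
      have "complex_of_real (v $ k) * complex_of_real (w $ l) * (if l = m then a $ k else 0)
        = (if l = m then complex_of_real (v $ k) * a $ k * complex_of_real (w $ l) else 0)" for l by simp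
      then show ?thesis by (simp only: sum.delta finite UNIV_I if_True)
    qed
    then show ?thesis by (simp add: rdot_sum sum_distrib_right)
  qed
  have "complex_of_real ((area s)\<^sup>2) * (\<Sum>k\<in>UNIV. if k = m then a $ k else 0) = complex_of_real ((area s)\<^sup>2) * a $ m" by simp
  then show ?thesis using trace_in_frame[where M = "\<lambda>k l. if l = m then a $ k else 0" and s = s] unfolding B c1_def c2_def
    by (simp add: algebra_simps)
qed

lemma conormal_tangent [simp]: "conormal s \<bullet> tangent j s = 0" "tangent j s \<bullet> conormal s = 0"
  and conormal_square: "conormal s \<bullet> conormal s = (area s)\<^sup>2"
  unfolding conormal_eq tangent_eq area_square
  using exhaust_2[of j] by (auto simp: inner_frame algebra_simps power2_eq_square)

lemma tangent_inner: "tangent i s \<bullet> tangent j s = (if i = j then 1 else 0) + d\<phi> i s * d\<phi> j s"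
  unfolding tangent_eq by (simp add: inner_frame algebra_simps)

lemma unit_normal_eq: "nrm s = (1 / area s) *\<^sub>R conormal s"
proof -
  have v: "vector [- d\<phi> 1 s, - d\<phi> 2 s, 1] = lift3 (- (\<chi> i. d\<phi> i s)) 1"
    by (simp add: vec_eq_iff forall_3)
  have "norm (lift3 (- (\<chi> i. d\<phi> i s)) 1) = area s"
    by (simp add: norm_eq_sqrt_inner inner_vec_def sum_3 area_def power2_eq_square add_ac)
  then show ?thesis unfolding unit_normal_def v sgn_div_norm conormal_def
    by (simp add: matrix_vector_mult_scaleR divide_inverse)
qed

lemma unit_normal_unit: "nrm s \<bullet> nrm s = 1"
  using area_pos[of s] by (simp add: unit_normal_eq conormal_square power2_eq_square)

lemma unit_normal_tangent: "nrm s \<bullet> tangent j s = 0"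
  by (simp add: unit_normal_eq)

text \<open>The matrix \<open>Q\<close> may be a reflection, so the cross product of the tangents is plus or minus the conormal. The sign
  is not determined: only the square of the proportionality factor is needed to recover conormal components.\<close>

lemma rdot_conormal_cross:
  "complex_of_real ((area s)\<^sup>2) * rdot (conormal s) c
     = complex_of_real (conormal s \<bullet> cross3 (tangent 1 s) (tangent 2 s)) * rdot (cross3 (tangent 1 s) (tangent 2 s)) c"
proof -
  let ?X = "cross3 (tangent 1 s) (tangent 2 s)" and ?N = "conormal s" and ?A = "(area s)\<^sup>2"
  have rc: "rdot v (cvec w) = complex_of_real (v \<bullet> w)" for v w
    by (simp add: rdot_sum cvec_def inner_vec_def)
  have X: "?A * ?X $ m = (?N \<bullet> ?X) * ?N $ m" for m
  proof -
    have "complex_of_real (?A * ?X $ m) = complex_of_real ((?N \<bullet> ?X) * ?N $ m)"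
      using vector_in_frame[of s "cvec ?X" m] by (simp add: rc dot_cross_self) (simp add: cvec_def)
    then show ?thesis unfolding of_real_eq_iff .
  qed
  have "?A * (?X \<bullet> ?X) = (\<Sum>m\<in>UNIV. (?A * ?X $ m) * ?X $ m)" by (simp add: inner_vec_def sum_distrib_left mult.assoc)
  also have "\<dots> = (?N \<bullet> ?X)\<^sup>2" unfolding X by (simp add: inner_vec_def power2_eq_square sum_distrib_left mult.assoc)
  finally have "(?N \<bullet> ?X)\<^sup>2 = ?A * (?X \<bullet> ?X)" by simp
  also have "?X \<bullet> ?X = ?A"
  proof -
    have "?X \<bullet> ?X + (tangent 1 s \<bullet> tangent 2 s)\<^sup>2 = (tangent 1 s \<bullet> tangent 1 s) * (tangent 2 s \<bullet> tangent 2 s)"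
      using norm_cross_dot[of "tangent 1 s" "tangent 2 s"] by (simp only: power_mult_distrib power2_norm_eq_inner)
    then show ?thesis using area_square[of s] by (simp add: tangent_inner algebra_simps power2_eq_square)
  qed
  finally have sq: "(?N \<bullet> ?X)\<^sup>2 = ?A * ?A" .
  have "complex_of_real ?A * rdot ?X c = (\<Sum>m\<in>UNIV. complex_of_real (?A * ?X $ m) * c $ m)"
    by (simp add: rdot_sum sum_distrib_left mult.assoc)
  also have "\<dots> = complex_of_real (?N \<bullet> ?X) * rdot ?N c"
    unfolding X by (simp add: rdot_sum sum_distrib_left mult.assoc)
  finally have "complex_of_real (?N \<bullet> ?X) * (complex_of_real ?A * rdot ?X c) = complex_of_real ((?N \<bullet> ?X)\<^sup>2) * rdot ?N c"
    by (simp add: power2_eq_square)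
  then have "complex_of_real ?A * (complex_of_real ?A * rdot ?N c) = complex_of_real ?A * (complex_of_real (?N \<bullet> ?X) * rdot ?X c)"
    unfolding sq by (simp add: algebra_simps)
  moreover have "complex_of_real ?A \<noteq> 0" using area_pos[of s] by simp
  ultimately show "complex_of_real ?A * rdot ?N c = complex_of_real (?N \<bullet> ?X) * rdot ?X c"
    using mult_left_cancel by blast
qed

end

subsection \<open>Principal curvatures in a chart\<close>

text \<open>A symmetric form \<open>h\<close> is diagonalised relative to a positive definite form \<open>g\<close>. One eigenvalue comes from the
  quadratic \<open>det (h - \<eta> g)\<close>, whose value at \<open>h11 / g11\<close> is not positive; the second eigenvector is the
  \<open>g\<close>-orthogonal direction.\<close>

lemma simultaneous_diagonalization:
  fixes h11 h12 h22 g11 g12 g22 :: real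
  assumes g: "g11 > 0" and a: "g11 * g22 - g12\<^sup>2 > 0"
  obtains \<eta> \<eta>' w1 w2 w1' w2' where
    "h11 * w1 + h12 * w2 = \<eta> * (g11 * w1 + g12 * w2)" "h12 * w1 + h22 * w2 = \<eta> * (g12 * w1 + g22 * w2)"
    "h11 * w1' + h12 * w2' = \<eta>' * (g11 * w1' + g12 * w2')" "h12 * w1' + h22 * w2' = \<eta>' * (g12 * w1' + g22 * w2')"
    "w1 * w2' - w2 * w1' \<noteq> 0"
    "(\<eta> + \<eta>') * (g11 * g22 - g12\<^sup>2) = h11 * g22 + h22 * g11 - 2 * h12 * g12"
proof -
  define a where "a = g11 * g22 - g12\<^sup>2"
  define B where "B = h11 * g22 + h22 * g11 - 2 * h12 * g12"
  define c where "c = h11 * h22 - h12\<^sup>2"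
  have a0: "a > 0" using assms by (simp add: a_def)
  have det: "a * x\<^sup>2 - B * x + c = (h11 - x * g11) * (h22 - x * g22) - (h12 - x * g12)\<^sup>2" for x
    by (simp add: a_def B_def c_def power2_eq_square algebra_simps)
  have "a * (h11/g11)\<^sup>2 - B * (h11/g11) + c \<le> 0" unfolding det using g by simp
  then have "4 * a * (a * (h11/g11)\<^sup>2 - B * (h11/g11) + c) \<le> 0" using a0 by (simp add: mult_nonneg_nonpos)
  moreover have square: "4 * a * (a * x\<^sup>2 - B * x + c) = (2 * a * x - B)\<^sup>2 - (B\<^sup>2 - 4 * a * c)" for x
    by (simp add: power2_eq_square algebra_simps)
  ultimately have "(2 * a * (h11/g11) - B)\<^sup>2 - (B\<^sup>2 - 4 * a * c) \<le> 0" by (simp only:)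
  then have "0 \<le> B\<^sup>2 - 4 * a * c" using zero_le_power2[of "2 * a * (h11/g11) - B"] by linarith
  then have sq: "(sqrt (B\<^sup>2 - 4 * a * c))\<^sup>2 = B\<^sup>2 - 4 * a * c" by simp
  define \<eta> where "\<eta> = (B + sqrt (B\<^sup>2 - 4 * a * c)) / (2 * a)"
  define \<eta>' where "\<eta>' = B / a - \<eta>"
  have "2 * a * \<eta> - B = sqrt (B\<^sup>2 - 4 * a * c)" using a0 by (simp add: \<eta>_def)
  then have "4 * a * (a * \<eta>\<^sup>2 - B * \<eta> + c) = 0"
    using sq unfolding square by simp
  then have "a * \<eta>\<^sup>2 - B * \<eta> + c = 0" using a0 by simp
  then have sing: "(h11 - \<eta> * g11) * (h22 - \<eta> * g22) = (h12 - \<eta> * g12)\<^sup>2" unfolding det by simp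
  define m11 m12 m22 where "m11 = h11 - \<eta> * g11" and "m12 = h12 - \<eta> * g12" and "m22 = h22 - \<eta> * g22"
  have sing': "m11 * m22 = m12 * m12" using sing by (simp add: m11_def m12_def m22_def power2_eq_square)
  obtain w1 w2 where w: "m11 * w1 + m12 * w2 = 0" "m12 * w1 + m22 * w2 = 0" "w1 \<noteq> 0 \<or> w2 \<noteq> 0"
  proof (cases "m11 = 0 \<and> m12 = 0")
    case True
    show thesis
    proof (cases "m22 = 0")
      case True then show thesis using that[of 1 0] \<open>m11 = 0 \<and> m12 = 0\<close> by simp
    next
      case False then show thesis using that[of 1 0] \<open>m11 = 0 \<and> m12 = 0\<close> by simp
    qed
  next
    case False
    then show thesis using that[of m12 "- m11"] sing' by (auto simp: algebra_simps)
  qed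
  define w1' w2' where "w1' = - (g12 * w1 + g22 * w2)" and "w2' = g11 * w1 + g12 * w2"
  have e1: "h11 * w1 + h12 * w2 = \<eta> * (g11 * w1 + g12 * w2)" "h12 * w1 + h22 * w2 = \<eta> * (g12 * w1 + g22 * w2)"
    using w(1,2) by (simp_all add: m11_def m12_def m22_def algebra_simps)
  have B\<eta>: "\<eta>' * a = B - \<eta> * a" using a0 by (simp add: \<eta>'_def algebra_simps)
  have gw': "g11 * w1' + g12 * w2' = - (a * w2)" "g12 * w1' + g22 * w2' = a * w1"
    by (simp_all add: w1'_def w2'_def a_def power2_eq_square algebra_simps)
  have "h11 * w1' + h12 * w2' = - (B * w2) + g11 * (h12 * w1 + h22 * w2) - g12 * (h11 * w1 + h12 * w2)"
    by (simp add: w1'_def w2'_def B_def algebra_simps)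
  also have "\<dots> = - (B * w2) - \<eta> * (g11 * w1' + g12 * w2')"
    unfolding e1 by (simp add: w1'_def w2'_def algebra_simps)
  also have "\<dots> = - ((B - \<eta> * a) * w2)" unfolding gw' by (simp add: algebra_simps)
  also have "\<dots> = \<eta>' * (g11 * w1' + g12 * w2')" unfolding gw' B\<eta>[symmetric] by simp
  finally have e2: "h11 * w1' + h12 * w2' = \<eta>' * (g11 * w1' + g12 * w2')" .
  have "h12 * w1' + h22 * w2' = B * w1 + g12 * (h12 * w1 + h22 * w2) - g22 * (h11 * w1 + h12 * w2)"
    by (simp add: w1'_def w2'_def B_def algebra_simps)
  also have "\<dots> = B * w1 - \<eta> * (g12 * w1' + g22 * w2')"
    unfolding e1 by (simp add: w1'_def w2'_def algebra_simps)
  also have "\<dots> = (B - \<eta> * a) * w1" unfolding gw' by (simp add: algebra_simps)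
  also have "\<dots> = \<eta>' * (g12 * w1' + g22 * w2')" unfolding gw' B\<eta>[symmetric] by simp
  finally have e3: "h12 * w1' + h22 * w2' = \<eta>' * (g12 * w1' + g22 * w2')" .
  show thesis
  proof (rule that[OF e1 e2 e3])
    show "w1 * w2' - w2 * w1' \<noteq> 0"
    proof -
      have "g11 * (w1 * w2' - w2 * w1') = (g11 * w1 + g12 * w2)\<^sup>2 + a * w2\<^sup>2"
        by (simp add: w1'_def w2'_def a_def power2_eq_square algebra_simps)
      moreover have "(g11 * w1 + g12 * w2)\<^sup>2 + a * w2\<^sup>2 > 0"
      proof (cases "w2 = 0")
        case True then show ?thesis using w(3) g by simp
      next
        case False then show ?thesis using a0 by (simp add: add_nonneg_pos)
      qed
      ultimately show ?thesis by auto
    qed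
    show "(\<eta> + \<eta>') * (g11 * g22 - g12\<^sup>2) = h11 * g22 + h22 * g11 - 2 * h12 * g12"
      using a0 by (simp add: \<eta>'_def flip: a_def B_def)
  qed
qed

context graph_chart_exterior
begin

lemma graph_point_has_derivative:
  assumes "s \<in> V"
  shows "((\<lambda>s. pt s \<tau>) has_derivative (\<lambda>w. \<Sum>j\<in>UNIV. w $ j *\<^sub>R tangent j s)) (at s)"
proof -
  have "((\<lambda>s. (s, \<phi> s + \<tau>)) has_derivative (\<lambda>w. (w, \<Sum>k\<in>UNIV. w $ k *\<^sub>R d\<phi> k s))) (at s)"
    by (auto intro!: derivative_eq_intros has_derivative_pderiv_sum phi_differentiable assms)
  from bounded_linear.has_derivative[OF matrix_vector_mul_bounded_linear bounded_linear.has_derivative[OF bounded_linear_lift3 this]]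
  have "((\<lambda>s. pt s \<tau>) has_derivative (\<lambda>w. Q *v lift3 w (\<Sum>k\<in>UNIV. w $ k *\<^sub>R d\<phi> k s))) (at s)"
    by (simp add: graph_point_lift3)
  moreover have "Q *v lift3 w (\<Sum>k\<in>UNIV. w $ k *\<^sub>R d\<phi> k s) = (\<Sum>j\<in>UNIV. w $ j *\<^sub>R tangent j s)" for w
  proof -
    have "lift3 w (\<Sum>k\<in>UNIV. w $ k *\<^sub>R d\<phi> k s) = w $ 1 *\<^sub>R lift3 (axis 1 1) (d\<phi> 1 s) + w $ 2 *\<^sub>R lift3 (axis 2 1) (d\<phi> 2 s)"
      by (simp add: vec_eq_iff forall_3 sum_2 axis_def)
    then show ?thesis unfolding tangent_def sum_2
      by (simp only: matrix_vector_right_distrib matrix_vector_mult_scaleR)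
  qed
  ultimately show ?thesis by simp
qed

lemma conormal_has_derivative:
  assumes "s \<in> V"
  shows "(conormal has_derivative (\<lambda>w. - (\<Sum>j\<in>UNIV. (\<Sum>k\<in>UNIV. w $ k * hess k j s) *\<^sub>R horizontal j))) (at s)"
proof -
  have "conormal = (\<lambda>s. vertical - d\<phi> 1 s *\<^sub>R horizontal 1 - d\<phi> 2 s *\<^sub>R horizontal 2)"
    by (rule ext) (rule conormal_eq)
  moreover have "((\<lambda>s. vertical - d\<phi> 1 s *\<^sub>R horizontal 1 - d\<phi> 2 s *\<^sub>R horizontal 2) has_derivative
      (\<lambda>w. - (\<Sum>j\<in>UNIV. (\<Sum>k\<in>UNIV. w $ k * hess k j s) *\<^sub>R horizontal j))) (at s)"
    by (auto intro!: derivative_eq_intros has_derivative_pderiv_sum[OF pderiv_phi_differentiable[OF assms]] simp: sum_2)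
  ultimately show ?thesis by simp
qed

text \<open>The hypothesis says that \<open>w\<close> is an eigenvector of the Hessian relative to the first fundamental form. The
  derivative of the conormal along \<open>w\<close> is then \<open>- \<eta>\<close> times the tangent vector belonging to \<open>w\<close>, up to a multiple of the
  conormal, and normalisation removes this multiple.\<close>

lemma weingarten_eigenvector:
  assumes s: "s \<in> V" and w: "\<And>j. (\<Sum>k\<in>UNIV. w $ k * hess k j s) = \<eta> * (w $ j + d\<phi> j s * (\<Sum>k\<in>UNIV. w $ k * d\<phi> k s))"
  shows "frechet_derivative (nrm) (at s) w
    = (- \<eta> / area s) *\<^sub>R frechet_derivative (\<lambda>s. pt s 0) (at s) w"
proof -
  let ?h = "\<lambda>w j. \<Sum>k\<in>UNIV. w $ k * hess k j s"
  let ?c = "\<Sum>k\<in>UNIV. w $ k * d\<phi> k s"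
  let ?dN = "\<lambda>w. - (\<Sum>j\<in>UNIV. ?h w j *\<^sub>R horizontal j)"
  let ?dW = "\<lambda>w. (d\<phi> 1 s * ?h w 1 + d\<phi> 2 s * ?h w 2) / area s"
  have "(area has_derivative ?dW) (at s)"
  proof -
    have pos: "1 + (d\<phi> 1 s)\<^sup>2 + (d\<phi> 2 s)\<^sup>2 > 0" by (simp add: add_pos_nonneg)
    have "((\<lambda>s. sqrt (1 + (d\<phi> 1 s)\<^sup>2 + (d\<phi> 2 s)\<^sup>2)) has_derivative ?dW) (at s)"
      unfolding area_def using pos
      by (auto intro!: derivative_eq_intros has_derivative_pderiv_sum[OF pderiv_phi_differentiable[OF s]]
          simp: sum_2 field_simps fun_eq_iff)
    moreover have "area = (\<lambda>s. sqrt (1 + (d\<phi> 1 s)\<^sup>2 + (d\<phi> 2 s)\<^sup>2))" by (rule ext) (rule area_def)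
    ultimately show ?thesis by simp
  qed
  then have "((\<lambda>s. (1 / area s) *\<^sub>R conormal s) has_derivative
      (\<lambda>w. (1 / area s) *\<^sub>R ?dN w - (?dW w / (area s)\<^sup>2) *\<^sub>R conormal s)) (at s)"
    using area_pos[of s] conormal_has_derivative[OF s]
    by (auto intro!: derivative_eq_intros simp: power2_eq_square divide_inverse fun_eq_iff)
  moreover have "nrm = (\<lambda>s. (1 / area s) *\<^sub>R conormal s)" by (rule ext) (rule unit_normal_eq)
  ultimately have "(nrm has_derivative
      (\<lambda>w. (1 / area s) *\<^sub>R ?dN w - (?dW w / (area s)\<^sup>2) *\<^sub>R conormal s)) (at s)" by (simp only:)
  from frechet_derivative_at[OF this]
  have nu: "frechet_derivative (nrm) (at s) w = (1 / area s) *\<^sub>R ?dN w - (?dW w / (area s)\<^sup>2) *\<^sub>R conormal s"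
    by (rule fun_cong[OF sym])
  have P: "frechet_derivative (\<lambda>s. pt s 0) (at s) w = (\<Sum>j\<in>UNIV. w $ j *\<^sub>R tangent j s)"
    by (subst frechet_derivative_at[OF graph_point_has_derivative[OF s], symmetric]) simp
  have dN: "?dN w = - \<eta> *\<^sub>R (\<Sum>j\<in>UNIV. w $ j *\<^sub>R tangent j s) + (\<eta> * ?c) *\<^sub>R conormal s"
    unfolding w conormal_eq tangent_eq by (simp add: sum_2 algebra_simps)
  have "d\<phi> 1 s * ?h w 1 + d\<phi> 2 s * ?h w 2 = \<eta> * ?c * (area s)\<^sup>2"
    unfolding w area_square by (simp add: sum_2 algebra_simps power2_eq_square)
  then have dW: "?dW w / (area s)\<^sup>2 = \<eta> * ?c / area s" using area_pos[of s] by simp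
  show ?thesis unfolding nu P dW dN by (simp add: algebra_simps divide_inverse)
qed

text \<open>Admissibility constrains every pair of principal curvatures, and so says nothing until such a pair is exhibited.
  The second statement is the formula for the mean curvature of a graph, the third one says that a surface
  without curvature is flat.\<close>

lemma principal_curvatures_chart:
  assumes s: "s \<in> V"
  obtains \<kappa>1 \<kappa>2 where "principal_curvatures D (pt s 0) \<kappa>1 \<kappa>2"
    "(1 + (d\<phi> 2 s)\<^sup>2) * hess 1 1 s + (1 + (d\<phi> 1 s)\<^sup>2) * hess 2 2 s - 2 * (d\<phi> 1 s * d\<phi> 2 s) * hess 1 2 s = - (\<kappa>1 + \<kappa>2) * area s ^ 3"
    "\<kappa>1 = 0 \<and> \<kappa>2 = 0 \<longrightarrow> (\<forall>i j. hess i j s = 0)"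
proof -
  let ?p = "d\<phi> 1 s" and ?q = "d\<phi> 2 s"
  have hsym: "hess 2 1 s = hess 1 2 s" by (rule phi_hessian_symmetric[OF s])
  have det: "(1 + ?p\<^sup>2) * (1 + ?q\<^sup>2) - (?p * ?q)\<^sup>2 = (area s)\<^sup>2"
    unfolding area_square by (simp add: power2_eq_square algebra_simps)
  have pos: "1 + ?p\<^sup>2 > 0" "(1 + ?p\<^sup>2) * (1 + ?q\<^sup>2) - (?p * ?q)\<^sup>2 > 0"
    unfolding det using area_pos[of s] by (simp_all add: add_pos_nonneg)
  obtain \<eta> \<eta>' w1 w2 w1' w2' where ev:
    "hess 1 1 s * w1 + hess 1 2 s * w2 = \<eta> * ((1 + ?p\<^sup>2) * w1 + (?p * ?q) * w2)"
    "hess 1 2 s * w1 + hess 2 2 s * w2 = \<eta> * ((?p * ?q) * w1 + (1 + ?q\<^sup>2) * w2)"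
    "hess 1 1 s * w1' + hess 1 2 s * w2' = \<eta>' * ((1 + ?p\<^sup>2) * w1' + (?p * ?q) * w2')"
    "hess 1 2 s * w1' + hess 2 2 s * w2' = \<eta>' * ((?p * ?q) * w1' + (1 + ?q\<^sup>2) * w2')"
    and ind: "w1 * w2' - w2 * w1' \<noteq> 0"
    and tr: "(\<eta> + \<eta>') * ((1 + ?p\<^sup>2) * (1 + ?q\<^sup>2) - (?p * ?q)\<^sup>2)
      = hess 1 1 s * (1 + ?q\<^sup>2) + hess 2 2 s * (1 + ?p\<^sup>2) - 2 * hess 1 2 s * (?p * ?q)"
    by (rule simultaneous_diagonalization[OF pos, of "hess 1 1 s" "hess 1 2 s" "hess 2 2 s"]) blast
  let ?w = "vector [w1, w2] :: real^2" and ?w' = "vector [w1', w2'] :: real^2"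
  have eig: "(\<Sum>k\<in>UNIV. ?w $ k * hess k j s) = \<eta> * (?w $ j + d\<phi> j s * (\<Sum>k\<in>UNIV. ?w $ k * d\<phi> k s))"
    "(\<Sum>k\<in>UNIV. ?w' $ k * hess k j s) = \<eta>' * (?w' $ j + d\<phi> j s * (\<Sum>k\<in>UNIV. ?w' $ k * d\<phi> k s))" for j
    using exhaust_2[of j] ev hsym by (auto simp: sum_2 power2_eq_square algebra_simps)
  have nz: "?w \<noteq> 0" "?w' \<noteq> 0" "?w \<noteq> ?w'" and indep: "independent {?w, ?w'}"
  proof -
    have comb: "a = 0 \<and> b = 0" if "a *\<^sub>R ?w + b *\<^sub>R ?w' = 0" for a b
    proof -
      have "a * w1 + b * w1' = 0" "a * w2 + b * w2' = 0"
        using that by (simp_all add: vec_eq_iff forall_2)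
      then have "a * (w1 * w2' - w2 * w1') = 0" "b * (w1 * w2' - w2 * w1') = 0" by algebra+
      then show ?thesis using ind by simp
    qed
    show "?w \<noteq> 0" using comb[of 1 0] by auto
    show "?w' \<noteq> 0" using comb[of 0 1] by auto
    show ne: "?w \<noteq> ?w'" using comb[of 1 "-1"] by auto
    show "independent {?w, ?w'}"
      unfolding independent_insert[of ?w "{?w'}"]
      using \<open>?w' \<noteq> 0\<close> ne comb[of 1 "- _"] by (auto simp: span_singleton algebra_simps)
  qed
  show thesis
  proof (rule that[of "- \<eta> / area s" "- \<eta>' / area s"])
    show "principal_curvatures D (pt s 0) (- \<eta> / area s) (- \<eta>' / area s)"
      unfolding principal_curvatures_def
      using C21 chart s nz(3) indep weingarten_eigenvector[OF s eig(1)] weingarten_eigenvector[OF s eig(2)]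
      by (intro exI[of _ Q] exI[of _ \<phi>] exI[of _ V] exI[of _ s] exI[of _ ?w] exI[of _ ?w']) (auto simp: C21_chart_def)
    show "(1 + ?q\<^sup>2) * hess 1 1 s + (1 + ?p\<^sup>2) * hess 2 2 s - 2 * (?p * ?q) * hess 1 2 s
        = - (- \<eta> / area s + - \<eta>' / area s) * area s ^ 3"
    proof -
      have "- (- \<eta> / area s + - \<eta>' / area s) * area s ^ 3 = (\<eta> + \<eta>') * (area s)\<^sup>2"
        using area_pos[of s] by (simp add: field_simps power2_eq_square power3_eq_cube)
      then show ?thesis using tr unfolding det by (simp add: algebra_simps)
    qed
    have "hess i j s = 0" if "- \<eta> / area s = 0 \<and> - \<eta>' / area s = 0" for i j
    proof -
    from that have "\<eta> = 0" "\<eta>' = 0" using area_pos[of s] by auto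
    then have z: "hess 1 1 s * w1 + hess 1 2 s * w2 = 0" "hess 1 2 s * w1 + hess 2 2 s * w2 = 0"
      "hess 1 1 s * w1' + hess 1 2 s * w2' = 0" "hess 1 2 s * w1' + hess 2 2 s * w2' = 0" using ev by auto
    have "hess 1 1 s * (w1 * w2' - w2 * w1') = 0" "hess 1 2 s * (w1 * w2' - w2 * w1') = 0" "hess 2 2 s * (w1 * w2' - w2 * w1') = 0"
      using z by algebra+
    then have "hess 1 1 s = 0" "hess 1 2 s = 0" "hess 2 2 s = 0" using ind by auto
    then show "hess i j s = 0" using exhaust_2[of i] exhaust_2[of j] hsym by auto
    qed
    then show "- \<eta> / area s = 0 \<and> - \<eta>' / area s = 0 \<longrightarrow> (\<forall>i j. hess i j s = 0)" by blast
  qed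
qed

lemma regular_piece: "s \<in> V \<Longrightarrow> \<exists>\<Gamma>\<in>regular_pieces D. pt s 0 \<in> \<Gamma>"
  using graph_point_regular[of s] Union_components[of "regular_points D"] unfolding regular_pieces_def by blast

lemma mean_curvature_zero:
  assumes s: "s \<in> V" and H: "zero_mean_curvature_at D (pt s 0)"
  shows "(1 + (d\<phi> 2 s)\<^sup>2) * hess 1 1 s + (1 + (d\<phi> 1 s)\<^sup>2) * hess 2 2 s - 2 * (d\<phi> 1 s * d\<phi> 2 s) * hess 1 2 s = 0"
proof -
  obtain \<kappa>1 \<kappa>2 where "principal_curvatures D (pt s 0) \<kappa>1 \<kappa>2"
    "(1 + (d\<phi> 2 s)\<^sup>2) * hess 1 1 s + (1 + (d\<phi> 1 s)\<^sup>2) * hess 2 2 s - 2 * (d\<phi> 1 s * d\<phi> 2 s) * hess 1 2 s = - (\<kappa>1 + \<kappa>2) * area s ^ 3"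
    by (rule principal_curvatures_chart[OF s])
  moreover from this(1) have "\<kappa>1 + \<kappa>2 = 0" using H unfolding zero_mean_curvature_at_def by auto
  ultimately show ?thesis by simp
qed

lemma flat_hessian_zero:
  assumes s: "s \<in> V" and H: "zero_mean_curvature_at D (pt s 0)"
    and K: "zero_gaussian_curvature_at D (pt s 0)"
  shows "hess i j s = 0"
proof -
  obtain \<kappa>1 \<kappa>2 where pc: "principal_curvatures D (pt s 0) \<kappa>1 \<kappa>2"
    and z: "\<kappa>1 = 0 \<and> \<kappa>2 = 0 \<longrightarrow> (\<forall>i j. hess i j s = 0)"
    by (rule principal_curvatures_chart[OF s])
  have "\<kappa>1 + \<kappa>2 = 0" "\<kappa>1 * \<kappa>2 = 0"
    using pc H K unfolding zero_mean_curvature_at_def zero_gaussian_curvature_at_def by auto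
  then show ?thesis using z by auto
qed

end

section \<open>Vanishing traces and their tangential derivatives\<close>

subsection \<open>Sums and products of traces\<close>

definition trace_regular :: "'a::euclidean_space set \<Rightarrow> real \<Rightarrow> ('a \<Rightarrow> real \<Rightarrow> 'b::real_normed_vector) \<Rightarrow> bool" where
  "trace_regular V h f \<longleftrightarrow> slice_cont V h f \<and> slice_cauchy V f"

definition trace_zero :: "'a::euclidean_space set \<Rightarrow> real \<Rightarrow> ('a \<Rightarrow> real \<Rightarrow> 'b::real_normed_vector) \<Rightarrow> bool" where
  "trace_zero V h f \<longleftrightarrow> slice_cont V h f \<and> slice_null V f"

lemma slice_cont_add: "slice_cont V h f \<Longrightarrow> slice_cont V h g \<Longrightarrow> slice_cont V h (\<lambda>s \<tau>. f s \<tau> + g s \<tau>)"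
  unfolding slice_cont_def by (auto intro: continuous_on_add)

lemma slice_cont_mult:
  fixes f :: "'a::euclidean_space \<Rightarrow> real \<Rightarrow> complex"
  shows "slice_cont V h f \<Longrightarrow> continuous_on V c \<Longrightarrow> slice_cont V h (\<lambda>s \<tau>. c s * f s \<tau>)"
  unfolding slice_cont_def by (auto intro: continuous_on_mult)

lemma slice_cont_component:
  fixes w :: "'a::euclidean_space \<Rightarrow> real \<Rightarrow> complex^3"
  assumes "slice_cont V h w"
  shows "slice_cont V h (\<lambda>s \<tau>. w s \<tau> $ k)"
  unfolding slice_cont_def
proof (intro allI impI)
  fix \<tau> assume "0 < \<tau> \<and> \<tau> < h"
  then have "continuous_on V (\<lambda>s. w s \<tau>)" using assms unfolding slice_cont_def by blast
  then show "continuous_on V (\<lambda>s. w s \<tau> $ k)" by (rule continuous_on_component)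
qed

lemma slice_cont_cong:
  assumes "slice_cont V h f" "\<And>s \<tau>. s \<in> V \<Longrightarrow> 0 < \<tau> \<Longrightarrow> \<tau> < h \<Longrightarrow> g s \<tau> = f s \<tau>"
  shows "slice_cont V h g"
  unfolding slice_cont_def
proof (intro allI impI)
  fix \<tau> assume t: "0 < \<tau> \<and> \<tau> < h"
  then have "continuous_on V (\<lambda>s. f s \<tau>)" using assms(1) unfolding slice_cont_def by blast
  then show "continuous_on V (\<lambda>s. g s \<tau>)" using assms(2) t by (subst continuous_on_cong) auto
qed

context
  fixes V :: "'a::euclidean_space set" and h :: real
  assumes h: "0 < h"
begin

lemma trace_zero_add: "trace_zero V h f \<Longrightarrow> trace_zero V h g \<Longrightarrow> trace_zero V h (\<lambda>s \<tau>. f s \<tau> + g s \<tau>)"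
  unfolding trace_zero_def slice_null_def
  using l2_null_add eventually_slice_cont[OF h] slice_cont_add by blast

lemma trace_zero_mult:
  fixes f :: "'a \<Rightarrow> real \<Rightarrow> complex"
  shows "trace_zero V h f \<Longrightarrow> continuous_on V c \<Longrightarrow> trace_zero V h (\<lambda>s \<tau>. c s * f s \<tau>)"
  unfolding trace_zero_def slice_null_def
  using l2_null_mult eventually_slice_cont[OF h] slice_cont_mult by blast

lemma trace_regular_add:
  assumes "trace_regular V h f" "trace_regular V h g"
  shows "trace_regular V h (\<lambda>s \<tau>. f s \<tau> + g s \<tau>)"
  using l2_null_add[OF _ eventually_slice_cont_diff[OF h, of V f] _ eventually_slice_cont_diff[OF h, of V g]]
    slice_cont_add[of V h f g] assms
  unfolding trace_regular_def slice_cauchy_def by (simp add: add_diff_add)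

lemma trace_regular_mult:
  fixes f :: "'a \<Rightarrow> real \<Rightarrow> complex"
  assumes "trace_regular V h f" "continuous_on V c"
  shows "trace_regular V h (\<lambda>s \<tau>. c s * f s \<tau>)"
  using l2_null_mult[OF _ eventually_slice_cont_diff[OF h, of V f] assms(2)] slice_cont_mult[of V h f c] assms
  unfolding trace_regular_def slice_cauchy_def by (simp add: right_diff_distrib)

lemma trace_zero_cong:
  assumes f: "trace_zero V h f" and eq: "\<And>s \<tau>. s \<in> V \<Longrightarrow> 0 < \<tau> \<Longrightarrow> \<tau> < h \<Longrightarrow> g s \<tau> = f s \<tau>"
  shows "trace_zero V h g"
  unfolding trace_zero_def
proof
  show "slice_cont V h g" by (rule slice_cont_cong[OF _ eq]) (use f in \<open>simp add: trace_zero_def\<close>)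
  have "slice_null V f" using f by (simp add: trace_zero_def)
  then show "slice_null V g" by (rule slice_null_mono[OF _ h]) (simp only: eq order_refl)
qed

lemma trace_zero_0: "trace_zero V h (\<lambda>s \<tau>. 0)"
  by (simp add: trace_zero_def slice_cont_def slice_null_def l2_null_def sqint_def)

lemma trace_regular_0: "trace_regular V h (\<lambda>s \<tau>. 0)"
  unfolding trace_regular_def slice_cont_def slice_cauchy_def l2_null_def sqint_def by simp

lemma trace_zero_sum:
  assumes "finite I" "\<And>i. i \<in> I \<Longrightarrow> trace_zero V h (f i)"
  shows "trace_zero V h (\<lambda>s \<tau>. \<Sum>i\<in>I. f i s \<tau>)"
  using assms
proof (induction I rule: finite_induct)
  case empty
  then show ?case by (simp add: trace_zero_0)
next
  case (insert a I)
  then show ?case using trace_zero_add[of "f a" "\<lambda>s \<tau>. \<Sum>i\<in>I. f i s \<tau>"] by simp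
qed

lemma trace_regular_sum:
  assumes "finite I" "\<And>i. i \<in> I \<Longrightarrow> trace_regular V h (f i)"
  shows "trace_regular V h (\<lambda>s \<tau>. \<Sum>i\<in>I. f i s \<tau>)"
  using assms
proof (induction I rule: finite_induct)
  case empty
  then show ?case by (simp add: trace_regular_0)
next
  case (insert a I)
  then show ?case using trace_regular_add[of "f a" "\<lambda>s \<tau>. \<Sum>i\<in>I. f i s \<tau>"] by simp
qed

lemma trace_zero_component:
  fixes w :: "'a \<Rightarrow> real \<Rightarrow> complex^3"
  assumes "trace_zero V h w" shows "trace_zero V h (\<lambda>s \<tau>. w s \<tau> $ k)"
proof -
  have "slice_null V (\<lambda>s \<tau>. w s \<tau> $ k)"
  proof (rule slice_null_mono[OF _ h])
    show "slice_null V w" using assms by (simp add: trace_zero_def)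
    show "norm (w s \<tau> $ k) \<le> norm (w s \<tau>)" for s \<tau> by (rule Finite_Cartesian_Product.norm_nth_le)
  qed
  then show ?thesis using assms slice_cont_component[of V h w k] by (simp add: trace_zero_def)
qed

lemma trace_regular_component:
  fixes w :: "'a \<Rightarrow> real \<Rightarrow> complex^3"
  assumes "trace_regular V h w" shows "trace_regular V h (\<lambda>s \<tau>. w s \<tau> $ k)"
proof -
  have "slice_cauchy V (\<lambda>s \<tau>. w s \<tau> $ k)"
  proof (rule slice_cauchy_mono[OF _ h])
    show "slice_cauchy V w" using assms by (simp add: trace_regular_def)
    show "norm (w s \<tau> $ k - w s \<tau>' $ k) \<le> norm (w s \<tau> - w s \<tau>')" for s \<tau> \<tau>'
      using Finite_Cartesian_Product.norm_nth_le[of "w s \<tau> - w s \<tau>'" k] by simp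
  qed
  then show ?thesis using assms slice_cont_component[of V h w k] by (simp add: trace_regular_def)
qed

text \<open>Coefficients depending on the boundary point only are harmless; this applies in particular to the frame.\<close>

lemma trace_zero_rdot:
  assumes "trace_zero V h w" "continuous_on V c"
  shows "trace_zero V h (\<lambda>s \<tau>. rdot (c s) (w s \<tau>))"
  unfolding rdot_sum
proof (rule trace_zero_sum)
  fix k :: 3
  have "continuous_on V (\<lambda>s. complex_of_real (c s $ k))" by (intro continuous_intros assms(2))
  then show "trace_zero V h (\<lambda>s \<tau>. complex_of_real (c s $ k) * w s \<tau> $ k)"
    by (rule trace_zero_mult[OF trace_zero_component[OF assms(1)]])
qed simp

lemma trace_regular_rdot:
  assumes "trace_regular V h w" "continuous_on V c"
  shows "trace_regular V h (\<lambda>s \<tau>. rdot (c s) (w s \<tau>))"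
  unfolding rdot_sum
proof (rule trace_regular_sum)
  fix k :: 3
  have "continuous_on V (\<lambda>s. complex_of_real (c s $ k))" by (intro continuous_intros assms(2))
  then show "trace_regular V h (\<lambda>s \<tau>. complex_of_real (c s $ k) * w s \<tau> $ k)"
    by (rule trace_regular_mult[OF trace_regular_component[OF assms(1)]])
qed simp

lemma trace_zero_vector:
  fixes w :: "'a \<Rightarrow> real \<Rightarrow> complex^3"
  assumes "\<And>k. trace_zero V h (\<lambda>s \<tau>. w s \<tau> $ k)"
  shows "trace_zero V h w"
proof -
  have c: "slice_cont V h (\<lambda>s \<tau>. w s \<tau> $ k)" and n: "slice_null V (\<lambda>s \<tau>. w s \<tau> $ k)" for k
    using assms unfolding trace_zero_def by auto
  have "slice_cont V h w"
    unfolding slice_cont_def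
  proof (intro allI impI)
    fix \<tau> assume t: "0 < \<tau> \<and> \<tau> < h"
    have "continuous_on V (\<lambda>s. w s \<tau> $ k)" for k using c[of k] t unfolding slice_cont_def by blast
    then have "continuous_on V (\<lambda>s. \<chi> k. w s \<tau> $ k)" by (rule continuous_on_vec_lambda)
    then show "continuous_on V (\<lambda>s. w s \<tau>)" by simp
  qed
  moreover have "slice_null V w"
  proof -
    \<comment> \<open>the norm of a vector is bounded by the sum of the norms of its components\<close>
    have "trace_zero V h (\<lambda>s \<tau>. complex_of_real (norm (w s \<tau> $ k)))" for k
      unfolding trace_zero_def
    proof
      show "slice_cont V h (\<lambda>s \<tau>. complex_of_real (norm (w s \<tau> $ k)))"
        using c[of k] unfolding slice_cont_def by (auto intro!: continuous_on_of_real continuous_on_norm)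
      show "slice_null V (\<lambda>s \<tau>. complex_of_real (norm (w s \<tau> $ k)))"
        by (rule slice_null_mono[OF n[of k] h]) simp
    qed
    then have "trace_zero V h (\<lambda>s \<tau>. \<Sum>k\<in>UNIV. complex_of_real (norm (w s \<tau> $ k)))"
      by (rule trace_zero_sum[rotated]) simp
    then have "slice_null V (\<lambda>s \<tau>. \<Sum>k\<in>UNIV. complex_of_real (norm (w s \<tau> $ k)))" by (simp add: trace_zero_def)
    then show ?thesis
    proof (rule slice_null_mono[OF _ h])
      fix s \<tau>
      have "norm (w s \<tau>) \<le> (\<Sum>k\<in>UNIV. norm (w s \<tau> $ k))"
        unfolding norm_vec_def by (rule L2_set_le_sum) simp
      also have "\<dots> = norm (\<Sum>k\<in>UNIV. complex_of_real (norm (w s \<tau> $ k)))"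
      proof -
        have "(\<Sum>k\<in>UNIV. complex_of_real (norm (w s \<tau> $ k))) = complex_of_real (\<Sum>k\<in>UNIV. norm (w s \<tau> $ k))"
          by simp
        moreover have "0 \<le> (\<Sum>k\<in>UNIV. norm (w s \<tau> $ k))" by (rule sum_nonneg) simp
        ultimately show ?thesis by (simp only: norm_of_real abs_of_nonneg)
      qed
      finally show "norm (w s \<tau>) \<le> norm (\<Sum>k\<in>UNIV. complex_of_real (norm (w s \<tau> $ k)))" .
    qed
  qed
  ultimately show ?thesis by (simp add: trace_zero_def)
qed

end

subsection \<open>Sobolev regularity of derivatives\<close>

lemma sobolev_bounded_mono: "sobolev_bounded k S f \<Longrightarrow> l \<le> k \<Longrightarrow> sobolev_bounded l S f"
  unfolding sobolev_bounded_def by auto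

lemma Hk_near_regular_pieces_mono: "Hk_near_regular_pieces k D f \<Longrightarrow> l \<le> k \<Longrightarrow> Hk_near_regular_pieces l D f"
  unfolding Hk_near_regular_pieces_def by (meson sobolev_bounded_mono)

lemma sobolev_bounded_first_order_op:
  fixes f :: "real^3 \<Rightarrow> 'b::real_normed_vector" and L :: "3 \<Rightarrow> 'b \<Rightarrow> 'c::real_normed_vector"
  assumes S: "open S" and f: "smooth_on S f" and L: "\<And>k. bounded_linear (L k)" and H: "sobolev_bounded (Suc k) S f"
  shows "sobolev_bounded k S (first_order_op L f)"
  unfolding sobolev_bounded_iff
proof (intro allI impI)
  fix js :: "3 list" assume js: "length js \<le> k"
  define a where "a = (\<lambda>k. iter_pderiv (js @ [k]) f)"
  have "\<exists>B. \<forall>k x. norm (L k x) \<le> B * norm x"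
  proof -
    define B where "B = (\<lambda>k. onorm (L k))"
    have B: "norm (L k x) \<le> norm x * B k" for k x
      unfolding B_def using onorm[OF L[of k], of x] by (simp add: mult.commute)
    have "norm (L k x) \<le> (\<Sum>k\<in>UNIV. \<bar>B k\<bar>) * norm x" for k x
    proof -
      have "B k \<le> \<bar>B k\<bar>" by simp
      also have "\<bar>B k\<bar> \<le> (\<Sum>k\<in>UNIV. \<bar>B k\<bar>)" by (rule member_le_sum) auto
      finally have "norm x * B k \<le> norm x * (\<Sum>k\<in>UNIV. \<bar>B k\<bar>)" by (rule mult_left_mono) simp
      with B[of k x] show ?thesis by (simp add: mult.commute)
    qed
    then show ?thesis by blast
  qed
  then obtain B where B: "\<And>k x. norm (L k x) \<le> B * norm x" by blast
  have ae: "iter_pderiv js (first_order_op L f) x = (\<Sum>k\<in>UNIV. L k (a k x))" if "x \<in> S" for x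
  proof -
    have "iter_pderiv js (\<lambda>y. \<Sum>k\<in>UNIV. L k (pderiv_at k f y)) x = (\<Sum>k\<in>UNIV. L k (iter_pderiv js (pderiv_at k f) x))"
      by (rule iter_pderiv_sum_bounded_linear[OF S smooth_on_pderiv_at[OF f] L _ that]) simp
    moreover have "first_order_op L f = (\<lambda>y. \<Sum>k\<in>UNIV. L k (pderiv_at k f y))"
      by (simp add: fun_eq_iff first_order_op_def)
    ultimately show ?thesis by (simp add: a_def iter_pderiv_append)
  qed
  have m[measurable]: "(\<lambda>x. ennreal ((norm (a k x))\<^sup>2) * indicator S x) \<in> borel_measurable borel" for k
    unfolding a_def by (rule measurable_sqint[OF disjI2[OF S] smooth_on_continuous_on[OF smooth_on_iter_pderiv[OF f]]])
  have fin: "sqint S (a k') < \<infinity>" for k'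
    using H[unfolded sobolev_bounded_iff, rule_format, of "js @ [k']"] js by (simp add: a_def)
  have "sqint S (iter_pderiv js (first_order_op L f)) \<le> (\<integral>\<^sup>+x. (\<Sum>k\<in>UNIV. ennreal (3 * B\<^sup>2) * (ennreal ((norm (a k x))\<^sup>2) * indicator S x)) \<partial>lborel)"
    unfolding sqint_def
  proof (rule nn_integral_mono)
    fix x
    have "ennreal ((norm (iter_pderiv js (first_order_op L f) x))\<^sup>2) \<le> (\<Sum>k\<in>UNIV. ennreal (3 * B\<^sup>2) * ennreal ((norm (a k x))\<^sup>2))" if x: "x \<in> S"
    proof -
      have "(norm (\<Sum>k\<in>UNIV. L k (a k x)))\<^sup>2 \<le> 3 * (\<Sum>k\<in>UNIV. (norm (L k (a k x)))\<^sup>2)"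
        using norm_sum3_square_le[of "\<lambda>_. 1" "\<lambda>k. L k (a k x)"] by simp
      also have "\<dots> \<le> 3 * (\<Sum>k\<in>UNIV. (B * norm (a k x))\<^sup>2)"
        by (intro mult_left_mono sum_mono power_mono B) auto
      also have "\<dots> = (\<Sum>k\<in>UNIV. (3 * B\<^sup>2) * (norm (a k x))\<^sup>2)" by (simp add: sum_distrib_left power_mult_distrib mult.assoc)
      finally have "ennreal ((norm (\<Sum>k\<in>UNIV. L k (a k x)))\<^sup>2) \<le> ennreal (\<Sum>k\<in>UNIV. (3 * B\<^sup>2) * (norm (a k x))\<^sup>2)" by (rule ennreal_leI)
      also have "\<dots> = (\<Sum>k\<in>UNIV. ennreal (3 * B\<^sup>2) * ennreal ((norm (a k x))\<^sup>2))"
      proof -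
        have "ennreal ((3 * B\<^sup>2) * (norm (a k x))\<^sup>2) = ennreal (3 * B\<^sup>2) * ennreal ((norm (a k x))\<^sup>2)" for k
          by (rule ennreal_mult) simp_all
        then show ?thesis by (simp only: sum_ennreal[symmetric] zero_le_mult_iff zero_le_power2 zero_le_numeral simp_thms)
      qed
      finally show ?thesis unfolding ae[OF x] .
    qed
    then show "ennreal ((norm (iter_pderiv js (first_order_op L f) x))\<^sup>2) * indicator S x
        \<le> (\<Sum>k\<in>UNIV. ennreal (3 * B\<^sup>2) * (ennreal ((norm (a k x))\<^sup>2) * indicator S x))"
      by (auto simp: indicator_def)
  qed
  also have "\<dots> = (\<Sum>k\<in>UNIV. ennreal (3 * B\<^sup>2) * sqint S (a k))"
    unfolding sqint_def by (subst nn_integral_sum) (auto simp: nn_integral_cmult)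
  also have "\<dots> < \<infinity>" using fin by (simp add: sum_3 ennreal_mult_less_top)
  finally show "sqint S (iter_pderiv js (first_order_op L f)) < \<infinity>" .
qed

lemma Hk_first_order_op:
  fixes f :: "real^3 \<Rightarrow> 'b::real_normed_vector" and L :: "3 \<Rightarrow> 'b \<Rightarrow> 'c::real_normed_vector"
  assumes f: "smooth_on (- closure D) f" and L: "\<And>k. bounded_linear (L k)" and H: "Hk_near_regular_pieces (Suc k) D f"
  shows "Hk_near_regular_pieces k D (first_order_op L f)"
  unfolding Hk_near_regular_pieces_def
proof
  fix y assume "y \<in> regular_points D"
  then obtain W where W: "open W" "y \<in> W" "sobolev_bounded (Suc k) (W - closure D) f"
    using H unfolding Hk_near_regular_pieces_def by blast
  have "smooth_on (W - closure D) f" by (rule smooth_on_subset[OF f]) blast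
  then have "sobolev_bounded k (W - closure D) (first_order_op L f)"
    using W L by (intro sobolev_bounded_first_order_op) auto
  then show "\<exists>W. open W \<and> y \<in> W \<and> sobolev_bounded k (W - closure D) (first_order_op L f)" using W by blast
qed

lemma pderiv_at_eq_first_order_op: "pderiv_at i f = first_order_op (\<lambda>k z. if k = i then z else 0) f"
  by (simp add: fun_eq_iff first_order_op_def)

lemma Hk_pderiv_at:
  assumes "smooth_on (- closure D) f" "Hk_near_regular_pieces (Suc k) D f"
  shows "Hk_near_regular_pieces k D (pderiv_at i f)"
proof -
  have "bounded_linear (\<lambda>z::'a. if k = i then z else 0)" for k by (cases "k = i") (auto simp: bounded_linear_zero)
  then show ?thesis unfolding pderiv_at_eq_first_order_op by (rule Hk_first_order_op[OF assms(1) _ assms(2)])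
qed

lemmas Hk_divergence = Hk_first_order_op[where L = div_coeff, folded divergence_eq, OF _ bounded_linear_coeffs(2)]
lemmas Hk_curl = Hk_first_order_op[where L = curl_coeff, folded curl_eq, OF _ bounded_linear_coeffs(3)]

subsection \<open>Tangential differentiation of boundary conditions\<close>

lemma ccross_nth:
  "ccross a b $ 1 = a $ 2 * b $ 3 - a $ 3 * b $ 2"
  "ccross a b $ 2 = a $ 3 * b $ 1 - a $ 1 * b $ 3"
  "ccross a b $ 3 = a $ 1 * b $ 2 - a $ 2 * b $ 1"
  by (simp_all add: ccross_def)

lemma cross3_nth:
  "cross3 a b $ 1 = a $ 2 * b $ 3 - a $ 3 * b $ 2"
  "cross3 a b $ 2 = a $ 3 * b $ 1 - a $ 1 * b $ 3"
  "cross3 a b $ 3 = a $ 1 * b $ 2 - a $ 2 * b $ 1"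
  by (simp_all add: cross3_def)

lemma cvec_nth: "cvec a $ k = complex_of_real (a $ k)"
  by (simp add: cvec_def)

context graph_chart_exterior
begin

lemma trace_regular_field:
  fixes u :: "real^3 \<Rightarrow> 'b::euclidean_space"
  assumes "smooth_on (- closure D) u" "Hk_near_regular_pieces 1 D u"
  shows "trace_regular V h (\<lambda>s \<tau>. u (pt s \<tau>))"
  unfolding trace_regular_def using slice_cont_smooth slice_cauchy_H1 assms by blast

lemma field_chain_rule:
  assumes u: "smooth_on (- closure D) u" and s: "s \<in> V" "0 < \<tau>" "\<tau> < h"
  shows "((\<lambda>s. u (pt s \<tau>)) has_derivative (\<lambda>w. \<Sum>j\<in>UNIV. w $ j *\<^sub>R dir_deriv (tangent j s) u (pt s \<tau>))) (at s)"
proof -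
  have "u differentiable at (pt s \<tau>)"
    using smooth_on_differentiable[OF u] graph_point_exterior[OF s] by blast
  from has_derivative_compose[OF graph_point_has_derivative[OF s(1)] has_derivative_pderiv_sum[OF this]]
  have "((\<lambda>s. u (pt s \<tau>)) has_derivative
    (\<lambda>w. \<Sum>k\<in>UNIV. (\<Sum>j\<in>UNIV. w $ j *\<^sub>R tangent j s) $ k *\<^sub>R pderiv_at k u (pt s \<tau>))) (at s)" .
  moreover have "(\<Sum>k\<in>UNIV. (\<Sum>j\<in>UNIV. w $ j *\<^sub>R tangent j s) $ k *\<^sub>R pderiv_at k u (pt s \<tau>))
    = (\<Sum>j\<in>UNIV. w $ j *\<^sub>R dir_deriv (tangent j s) u (pt s \<tau>))" for w
    unfolding dir_deriv_def by (simp add: sum_2 sum_3 algebra_simps)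
  ultimately show ?thesis by simp
qed

lemma tangent_cont: "continuous_on V (tangent j)"
  and conormal_cont: "continuous_on V conormal"
  and area_cont: "continuous_on V area"
  unfolding tangent_eq[abs_def] conormal_eq[abs_def] area_def[abs_def]
  by (intro continuous_intros pderiv_phi_cont)+

lemma unit_normal_cont: "continuous_on V (nrm)"
  unfolding unit_normal_eq[abs_def] using area_pos
  by (intro continuous_intros area_cont conormal_cont) (auto simp: less_le)

lemma trace_zero_tangential_deriv:
  fixes v :: "real^3 \<Rightarrow> complex"
  assumes v: "smooth_on (- closure D) v" "Hk_near_regular_pieces 2 D v"
    and z: "trace_zero V h (\<lambda>s \<tau>. v (pt s \<tau>))"
  shows "trace_zero V h (\<lambda>s \<tau>. dir_deriv (tangent j s) v (pt s \<tau>))"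
proof -
  have r: "trace_regular V h (\<lambda>s \<tau>. dir_deriv (tangent j s) v (pt s \<tau>))"
    unfolding dir_deriv_def scaleR_conv_of_real
  proof (rule trace_regular_sum[OF h])
    fix k :: 3
    have "Hk_near_regular_pieces 1 D (pderiv_at k v)"
      using v by (intro Hk_pderiv_at) (simp_all add: numeral_2_eq_2)
    then have "trace_regular V h (\<lambda>s \<tau>. pderiv_at k v (pt s \<tau>))"
      by (rule trace_regular_field[OF smooth_on_pderiv_at[OF v(1)]])
    then show "trace_regular V h (\<lambda>s \<tau>. complex_of_real (tangent j s $ k) * pderiv_at k v (pt s \<tau>))"
      by (rule trace_regular_mult[OF h]) (intro continuous_intros tangent_cont)
  qed simp
  have "slice_null V (\<lambda>s \<tau>. dir_deriv (tangent j s) v (pt s \<tau>))"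
  proof (rule slice_null_pderiv[OF V h])
    fix s \<tau> assume s: "s \<in> V" "0 < \<tau>" "\<tau> < h"
    show "(\<lambda>s. v (pt s \<tau>)) differentiable at s"
      using field_chain_rule[OF v(1) s] unfolding differentiable_def by blast
    show "pderiv_at j (\<lambda>s. v (pt s \<tau>)) s = dir_deriv (tangent j s) v (pt s \<tau>)"
      unfolding pderiv_at_eqI[OF field_chain_rule[OF v(1) s]] sum_axis_scaleR by simp
  qed (use z r in \<open>auto simp: trace_zero_def trace_regular_def\<close>)
  then show ?thesis using r by (simp add: trace_zero_def trace_regular_def)
qed

lemma trace_regular_rdot_dir_deriv:
  assumes U: "smooth_on (- closure D) U" "Hk_near_regular_pieces 2 D U"
    and a: "continuous_on V a" and b: "continuous_on V b"
  shows "trace_regular V h (\<lambda>s \<tau>. rdot (b s) (dir_deriv (a s) U (pt s \<tau>)))"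
proof -
  have eq: "rdot (b s) (dir_deriv (a s) U x) = (\<Sum>k\<in>UNIV. complex_of_real (a s $ k) * rdot (b s) (pderiv_at k U x))" for s x
    unfolding rdot_dir_deriv unfolding rdot_sum by (simp add: sum_distrib_left mult.assoc)
  have H1: "Hk_near_regular_pieces 1 D (pderiv_at k U)" for k
    using U by (intro Hk_pderiv_at) (simp_all add: numeral_2_eq_2)
  have "trace_regular V h (\<lambda>s \<tau>. complex_of_real (a s $ k) * rdot (b s) (pderiv_at k U (pt s \<tau>)))" for k
    by (rule trace_regular_mult[OF h trace_regular_rdot[OF h trace_regular_field[OF smooth_on_pderiv_at[OF U(1)] H1] b]])
      (intro continuous_intros a)
  then show ?thesis unfolding eq by (rule trace_regular_sum[OF h, rotated]) simp
qed

text \<open>Differentiating a boundary condition whose coefficients \<open>c\<close> move with the frame also produces the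
  derivative of \<open>c\<close>; this is where curvature enters.\<close>

lemma trace_zero_tangential_deriv_rdot:
  assumes U: "smooth_on (- closure D) U" "Hk_near_regular_pieces 2 D U"
    and c: "continuous_on V c" "\<And>s. s \<in> V \<Longrightarrow> c differentiable at s" "continuous_on V c'" "\<And>s. s \<in> V \<Longrightarrow> pderiv_at j c s = c' s"
    and z: "trace_zero V h (\<lambda>s \<tau>. rdot (c s) (U (pt s \<tau>)))"
  shows "trace_zero V h (\<lambda>s \<tau>. rdot (c' s) (U (pt s \<tau>))
      + rdot (c s) (dir_deriv (tangent j s) U (pt s \<tau>)))"
proof -
  have H1: "Hk_near_regular_pieces 1 D U" by (rule Hk_near_regular_pieces_mono[OF U(2)]) simp
  have r: "trace_regular V h (\<lambda>s \<tau>. rdot (c' s) (U (pt s \<tau>))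
      + rdot (c s) (dir_deriv (tangent j s) U (pt s \<tau>)))"
    by (rule trace_regular_add[OF h trace_regular_rdot[OF h trace_regular_field[OF U(1) H1] c(3)]
        trace_regular_rdot_dir_deriv[OF U tangent_cont c(1)]])
  have "slice_null V (\<lambda>s \<tau>. rdot (c' s) (U (pt s \<tau>))
      + rdot (c s) (dir_deriv (tangent j s) U (pt s \<tau>)))"
  proof (rule slice_null_pderiv[OF V h])
    fix s \<tau> assume s: "s \<in> V" "0 < \<tau>" "\<tau> < h"
    note d = bounded_bilinear.FDERIV[OF bounded_bilinear_rdot has_derivative_pderiv_sum[OF c(2)[OF s(1)]] field_chain_rule[OF U(1) s]]
    show "(\<lambda>s. rdot (c s) (U (pt s \<tau>))) differentiable at s"
      using d unfolding differentiable_def by blast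
    show "pderiv_at j (\<lambda>s. rdot (c s) (U (pt s \<tau>))) s = rdot (c' s) (U (pt s \<tau>))
      + rdot (c s) (dir_deriv (tangent j s) U (pt s \<tau>))"
      unfolding pderiv_at_eqI[OF d] sum_axis_scaleR using c(4)[OF s(1)] by (simp add: add.commute)
  qed (use z r in \<open>auto simp: trace_zero_def trace_regular_def\<close>)
  then show ?thesis using r by (simp add: trace_zero_def trace_regular_def)
qed

lemma slice_cont_normal_cross:
  assumes w: "slice_cont V h w"
  shows "slice_cont V h (\<lambda>s \<tau>. ccross (cvec (nrm s)) (w s \<tau>))"
  unfolding slice_cont_def
proof (intro allI impI)
  fix \<tau> assume t: "0 < \<tau> \<and> \<tau> < h"
  then have c: "continuous_on V (\<lambda>s. w s \<tau>)" using w unfolding slice_cont_def by blast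
  have "continuous_on V (\<lambda>s. ccross (cvec (nrm s)) (w s \<tau>) $ k)" for k
    using exhaust_3[of k] c
    by (elim disjE; simp only: ccross_nth cvec_nth) (intro continuous_intros unit_normal_cont; assumption)+
  then have "continuous_on V (\<lambda>s. \<chi> k. ccross (cvec (nrm s)) (w s \<tau>) $ k)" by (rule continuous_on_vec_lambda)
  then show "continuous_on V (\<lambda>s. ccross (cvec (nrm s)) (w s \<tau>))" by simp
qed

text \<open>The conormal part of a field drops out of its cross product with the normal, and the two tangents see
  all of the rest.\<close>

lemma trace_zero_tangential_iff:
  assumes w: "slice_cont V h w"
  shows "slice_null V (\<lambda>s \<tau>. ccross (cvec (nrm s)) (w s \<tau>)) \<longleftrightarrow>
    (\<forall>j. trace_zero V h (\<lambda>s \<tau>. rdot (tangent j s) (w s \<tau>)))"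
proof
  have ccont: "slice_cont V h (\<lambda>s \<tau>. ccross (cvec (nrm s)) (w s \<tau>))" by (rule slice_cont_normal_cross[OF w])
  { assume "slice_null V (\<lambda>s \<tau>. ccross (cvec (nrm s)) (w s \<tau>))"
    then have z: "trace_zero V h (\<lambda>s \<tau>. ccross (cvec (nrm s)) (w s \<tau>))" using ccont by (simp add: trace_zero_def)
    show "\<forall>j. trace_zero V h (\<lambda>s \<tau>. rdot (tangent j s) (w s \<tau>))"
    proof
      fix j
      have "trace_zero V h (\<lambda>s \<tau>. rdot (cross3 (nrm s) (tangent j s)) (ccross (cvec (nrm s)) (w s \<tau>)))"
        by (intro trace_zero_rdot[OF h z] continuous_on_cross unit_normal_cont tangent_cont)
      then show "trace_zero V h (\<lambda>s \<tau>. rdot (tangent j s) (w s \<tau>))"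
        by (simp add: rdot_lagrange unit_normal_unit unit_normal_tangent)
    qed }
  assume t: "\<forall>j. trace_zero V h (\<lambda>s \<tau>. rdot (tangent j s) (w s \<tau>))"
  define c1 where "c1 = (\<lambda>s a. complex_of_real (1 + (d\<phi> 2 s)\<^sup>2) * rdot (tangent 1 s) a + complex_of_real (- (d\<phi> 1 s * d\<phi> 2 s)) * rdot (tangent 2 s) a)"
  define c2 where "c2 = (\<lambda>s a. complex_of_real (1 + (d\<phi> 1 s)\<^sup>2) * rdot (tangent 2 s) a + complex_of_real (- (d\<phi> 1 s * d\<phi> 2 s)) * rdot (tangent 1 s) a)"
  have "trace_zero V h (\<lambda>s \<tau>. c1 s (w s \<tau>))" "trace_zero V h (\<lambda>s \<tau>. c2 s (w s \<tau>))"
    unfolding c1_def c2_def using t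
    by (intro trace_zero_add[OF h] trace_zero_mult[OF h]; auto intro!: continuous_intros pderiv_phi_cont)+
  note c12 = this
  have "trace_zero V h (\<lambda>s \<tau>. ccross (cvec (nrm s)) (w s \<tau>) $ m)" for m
  proof -
    have eq: "ccross (cvec (nrm s)) a $ m = complex_of_real (cross3 (nrm s) (tangent 1 s) $ m / (area s)\<^sup>2) * c1 s a
        + complex_of_real (cross3 (nrm s) (tangent 2 s) $ m / (area s)\<^sup>2) * c2 s a" for s a
    proof -
      let ?A = "complex_of_real ((area s)\<^sup>2)"
      have A0: "?A \<noteq> 0" using area_pos[of s] by simp
      have f: "?A * a $ k = rdot (conormal s) a * complex_of_real (conormal s $ k)
          + c1 s a * complex_of_real (tangent 1 s $ k) + c2 s a * complex_of_real (tangent 2 s $ k)" for k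
        using vector_in_frame[of s a k] by (simp add: c1_def c2_def)
      have n: "nrm s $ k = conormal s $ k / area s" for k by (simp add: unit_normal_eq)
      have pq: "?A * (complex_of_real (nrm s $ p) * a $ q - complex_of_real (nrm s $ q) * a $ p)
        = complex_of_real (nrm s $ p * tangent 1 s $ q - nrm s $ q * tangent 1 s $ p) * c1 s a
        + complex_of_real (nrm s $ p * tangent 2 s $ q - nrm s $ q * tangent 2 s $ p) * c2 s a" for p q
      proof -
        have "?A * (complex_of_real (nrm s $ p) * a $ q - complex_of_real (nrm s $ q) * a $ p)
          = complex_of_real (nrm s $ p) * (?A * a $ q) - complex_of_real (nrm s $ q) * (?A * a $ p)"
          by (simp add: algebra_simps)
        then show ?thesis unfolding f by (simp add: n algebra_simps)
      qed
      have "?A * ccross (cvec (nrm s)) a $ m = complex_of_real (cross3 (nrm s) (tangent 1 s) $ m) * c1 s a + complex_of_real (cross3 (nrm s) (tangent 2 s) $ m) * c2 s a"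
        using exhaust_3[of m] by (elim disjE; simp only: ccross_nth cvec_nth cross3_nth pq)
      then show ?thesis using A0 by (simp add: field_simps)
    qed
    show ?thesis unfolding eq
      using area_pos by (intro trace_zero_add[OF h] trace_zero_mult[OF h] c12)
        (auto intro!: continuous_intros continuous_on_cross unit_normal_cont tangent_cont area_cont simp: less_le)
  qed
  then have "trace_zero V h (\<lambda>s \<tau>. ccross (cvec (nrm s)) (w s \<tau>))" by (rule trace_zero_vector[OF h])
  then show "slice_null V (\<lambda>s \<tau>. ccross (cvec (nrm s)) (w s \<tau>))" by (simp add: trace_zero_def)
qed

end

section \<open>Transfer of the boundary conditions\<close>

lemma vanishes_on_boundary_iff:
  "vanishes_on_boundary D B \<longleftrightarrow> (\<forall>Q \<phi> V. C21_chart D Q \<phi> V \<longrightarrow>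
     slice_null V (\<lambda>s \<tau>. B (unit_normal Q \<phi> s) (graph_point Q \<phi> s \<tau>)))"
  unfolding vanishes_on_boundary_def slice_null_def l2_null_def sqint_def by blast

lemma rdot_gradient: "rdot a (gradient f x) = dir_deriv a f x"
  by (simp add: rdot_sum gradient_def dir_deriv_def scaleR_conv_of_real)

lemma rdot_add: "rdot a (u + v) = rdot a u + rdot a v"
  and rdot_scale: "rdot a (c *s u) = c * rdot a u"
  and rdot_scaleR_left: "rdot (r *\<^sub>R a) u = complex_of_real r * rdot a u"
  by (simp_all add: rdot_sum sum_3 algebra_simps)

context graph_chart_exterior
begin

lemma rdot_unit_normal: "rdot (nrm s) u = complex_of_real (1 / area s) * rdot (conormal s) u"
  unfolding unit_normal_eq rdot_scaleR_left ..

lemma rdot_conormal: "rdot (conormal s) u = complex_of_real (area s) * rdot (nrm s) u"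
  unfolding rdot_unit_normal using area_pos[of s] by simp

lemma divergence_in_frame:
  "complex_of_real ((area s)\<^sup>2) * divergence U x = rdot (conormal s) (dir_deriv (conormal s) U x)
    + complex_of_real (1 + (d\<phi> 2 s)\<^sup>2) * rdot (tangent 1 s) (dir_deriv (tangent 1 s) U x)
    + complex_of_real (1 + (d\<phi> 1 s)\<^sup>2) * rdot (tangent 2 s) (dir_deriv (tangent 2 s) U x)
    - complex_of_real (d\<phi> 1 s * d\<phi> 2 s) * (rdot (tangent 2 s) (dir_deriv (tangent 1 s) U x) + rdot (tangent 1 s) (dir_deriv (tangent 2 s) U x))"
  using trace_in_frame[of s "\<lambda>k l. pderiv_at k U x $ l"] unfolding rdot_dir_deriv divergence_def .

lemma tangent_differentiable:
  assumes "s \<in> V"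
  shows "tangent j differentiable at s" "pderiv_at i (tangent j) s = hess i j s *\<^sub>R vertical"
proof -
  have "tangent j = (\<lambda>s. horizontal j + d\<phi> j s *\<^sub>R vertical)" by (rule ext) (rule tangent_eq)
  moreover have "((\<lambda>s. horizontal j + d\<phi> j s *\<^sub>R vertical) has_derivative (\<lambda>w. (\<Sum>k\<in>UNIV. w $ k *\<^sub>R hess k j s) *\<^sub>R vertical)) (at s)"
    by (auto intro!: derivative_eq_intros has_derivative_pderiv_sum[OF pderiv_phi_differentiable[OF assms]])
  ultimately have d: "(tangent j has_derivative (\<lambda>w. (\<Sum>k\<in>UNIV. w $ k *\<^sub>R hess k j s) *\<^sub>R vertical)) (at s)" by (simp only:)
  show "tangent j differentiable at s" using d unfolding differentiable_def by blast
  show "pderiv_at i (tangent j) s = hess i j s *\<^sub>R vertical"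
    unfolding pderiv_at_eqI[OF d] sum_axis_scaleR by simp
qed

lemma conormal_differentiable:
  assumes "s \<in> V" "\<And>i j. hess i j s = 0"
  shows "conormal differentiable at s" "pderiv_at i conormal s = 0"
  using conormal_has_derivative[OF assms(1)] pderiv_at_eqI[OF conormal_has_derivative[OF assms(1)], of i] assms(2)
  unfolding differentiable_def by auto

text \<open>Cross products of the normal with the curl are rewritten by directional derivatives, so that only entries of the
  Jacobian of \<open>U\<close> occur.\<close>

lemma slice_cont_rdot_traction:
  assumes U: "smooth_on (- closure D) U" "Hk_near_regular_pieces 2 D U" and b: "continuous_on V b"
  shows "slice_cont V h (\<lambda>s \<tau>. rdot (b s) (traction lam \<mu> U (nrm s) (pt s \<tau>)))"
proof -
  have H1: "Hk_near_regular_pieces 1 D (divergence U)"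
    using U by (intro Hk_divergence) (simp_all add: numeral_2_eq_2)
  have div: "trace_regular V h (\<lambda>s \<tau>. divergence U (pt s \<tau>))"
    by (rule trace_regular_field[OF smooth_on_divergence[OF open_Compl[OF closed_closure] U(1)] H1])
  have J: "trace_regular V h (\<lambda>s \<tau>. rdot (b s) (dir_deriv (nrm s) U (pt s \<tau>)))"
    "trace_regular V h (\<lambda>s \<tau>. rdot (nrm s) (dir_deriv (b s) U (pt s \<tau>)))"
    by (rule trace_regular_rdot_dir_deriv[OF U unit_normal_cont b] trace_regular_rdot_dir_deriv[OF U b unit_normal_cont])+
  have "trace_regular V h (\<lambda>s \<tau>. complex_of_real \<mu> * rdot (b s) (dir_deriv (nrm s) U (pt s \<tau>))
      + (complex_of_real (lam * (nrm s \<bullet> b s)) * divergence U (pt s \<tau>)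
      + complex_of_real \<mu> * rdot (nrm s) (dir_deriv (b s) U (pt s \<tau>))))"
    by (rule trace_regular_add[OF h trace_regular_mult[OF h J(1)] trace_regular_add[OF h trace_regular_mult[OF h div] trace_regular_mult[OF h J(2)]]])
      (intro continuous_intros unit_normal_cont b)+
  then have "slice_cont V h (\<lambda>s \<tau>. complex_of_real \<mu> * rdot (b s) (dir_deriv (nrm s) U (pt s \<tau>))
      + (complex_of_real (lam * (nrm s \<bullet> b s)) * divergence U (pt s \<tau>)
      + complex_of_real \<mu> * rdot (nrm s) (dir_deriv (b s) U (pt s \<tau>))))" by (simp add: trace_regular_def)
  then show ?thesis
  proof (rule slice_cont_cong)
    fix s \<tau> assume s: "s \<in> V" "0 < \<tau>" "\<tau> < h"
    have "U differentiable at (pt s \<tau>)"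
      using smooth_on_differentiable[OF U(1)] graph_point_exterior[OF s] by blast
    then show "rdot (b s) (traction lam \<mu> U (nrm s) (pt s \<tau>)) = complex_of_real \<mu> * rdot (b s) (dir_deriv (nrm s) U (pt s \<tau>))
      + (complex_of_real (lam * (nrm s \<bullet> b s)) * divergence U (pt s \<tau>)
      + complex_of_real \<mu> * rdot (nrm s) (dir_deriv (b s) U (pt s \<tau>)))"
      by (simp add: rdot_traction rdot_ccross_curl algebra_simps)
  qed
qed

lemma rdot_axis: "rdot (axis k 1) u = u $ k"
  using exhaust_3[of k] by (auto simp: rdot_sum sum_3 axis_def)

lemma slice_cont_traction:
  assumes U: "smooth_on (- closure D) U" "Hk_near_regular_pieces 2 D U"
  shows "slice_cont V h (\<lambda>s \<tau>. traction lam \<mu> U (nrm s) (pt s \<tau>))"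
  unfolding slice_cont_def
proof (intro allI impI)
  fix \<tau> assume t: "0 < \<tau> \<and> \<tau> < h"
  have "continuous_on V (\<lambda>s. traction lam \<mu> U (nrm s) (pt s \<tau>) $ k)" for k
    using slice_cont_rdot_traction[OF U continuous_on_const, of "axis k 1" lam \<mu>] t
    unfolding slice_cont_def rdot_axis by blast
  then have "continuous_on V (\<lambda>s. \<chi> k. traction lam \<mu> U (nrm s) (pt s \<tau>) $ k)"
    by (rule continuous_on_vec_lambda)
  then show "continuous_on V (\<lambda>s. traction lam \<mu> U (nrm s) (pt s \<tau>))" by simp
qed

text \<open>Differentiating the tangential components of \<open>U\<close> along the boundary expresses the tangential entries of the
  Jacobian by the Hessian of \<open>\<phi>\<close> times the vertical component of \<open>U\<close>. In the tangential part \<open>Z\<close> of the divergence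
  the Hessian is contracted with the inverse first fundamental form; this contraction is the mean curvature and
  vanishes. So on the boundary the divergence is the normal derivative of the normal component, and the normal
  traction is \<open>lam + 2 * \<mu>\<close> times the divergence.\<close>

lemma fourth_kind_divergence:
  assumes U: "smooth_on (- closure D) U" "Hk_near_regular_pieces 3 D U"
    and mean: "\<And>s. s \<in> V \<Longrightarrow> zero_mean_curvature_at D (pt s 0)"
    and lame: "lam + 2 * \<mu> \<noteq> 0"
    and bc1: "slice_null V (\<lambda>s \<tau>. ccross (cvec (nrm s)) (U (pt s \<tau>)))"
    and bc2: "slice_null V (\<lambda>s \<tau>. rdot (nrm s) (traction lam \<mu> U (nrm s) (pt s \<tau>)))"
  shows "trace_zero V h (\<lambda>s \<tau>. divergence U (pt s \<tau>))"
proof -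
  have H2: "Hk_near_regular_pieces 2 D U" by (rule Hk_near_regular_pieces_mono[OF U(2)]) simp
  have cont: "slice_cont V h (\<lambda>s \<tau>. U (pt s \<tau>))" by (rule slice_cont_smooth[OF U(1)])
  define Y where "Y = (\<lambda>i j s \<tau>. rdot (hess i j s *\<^sub>R vertical) (U (pt s \<tau>)) + rdot (tangent j s) (dir_deriv (tangent i s) U (pt s \<tau>)))"
  define Z where "Z = (\<lambda>s \<tau>. complex_of_real (1 + (d\<phi> 2 s)\<^sup>2) * Y 1 1 s \<tau> + complex_of_real (1 + (d\<phi> 1 s)\<^sup>2) * Y 2 2 s \<tau>
      + complex_of_real (- (d\<phi> 1 s * d\<phi> 2 s)) * (Y 1 2 s \<tau> + Y 2 1 s \<tau>))"
  have Y: "trace_zero V h (Y i j)" for i j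
    unfolding Y_def
  proof (rule trace_zero_tangential_deriv_rdot[OF U(1) H2 tangent_cont tangent_differentiable(1) _ tangent_differentiable(2)])
    show "continuous_on V (\<lambda>s. hess i j s *\<^sub>R vertical)" by (intro continuous_intros pderiv2_phi_cont)
    show "trace_zero V h (\<lambda>s \<tau>. rdot (tangent j s) (U (pt s \<tau>)))"
      using trace_zero_tangential_iff[OF cont] bc1 by blast
  qed
  have eq: "complex_of_real (1 / (area s)\<^sup>2) *
      (complex_of_real ((area s)\<^sup>2) * rdot (nrm s) (traction lam \<mu> U (nrm s) (pt s \<tau>))
        + complex_of_real (2 * \<mu>) * Z s \<tau>)
      = complex_of_real (lam + 2 * \<mu>) * divergence U (pt s \<tau>)" if s: "s \<in> V" and \<tau>: "0 < \<tau>" "\<tau> < h" for s \<tau>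
  proof -
    let ?A = "complex_of_real ((area s)\<^sup>2)" and ?x = "pt s \<tau>"
    let ?B = "\<lambda>a b. rdot b (dir_deriv a U ?x)"
    have dU: "U differentiable at ?x"
      using smooth_on_differentiable[OF U(1)] graph_point_exterior[OF s \<tau>] by blast
    have n: "?A * ?B (nrm s) (nrm s) = ?B (conormal s) (conormal s)"
    proof -
      have "dir_deriv (nrm s) U ?x = (1 / area s) *\<^sub>R dir_deriv (conormal s) U ?x"
        by (simp add: dir_deriv_def unit_normal_eq scaleR_sum_right)
      then have "?B (nrm s) (nrm s) = complex_of_real (1 / area s) * (complex_of_real (1 / area s) * ?B (conormal s) (conormal s))"
        unfolding rdot_unit_normal by (simp add: rdot_sum sum_distrib_left scaleR_conv_of_real[where 'a = complex] algebra_simps)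
      then show ?thesis using area_pos[of s] by (simp add: power2_eq_square)
    qed
    have tr: "?A * rdot (nrm s) (traction lam \<mu> U (nrm s) ?x)
        = complex_of_real (2 * \<mu>) * ?B (conormal s) (conormal s) + complex_of_real lam * (?A * divergence U ?x)"
      unfolding rdot_traction[OF dU] rdot_ccross_self unit_normal_unit n[symmetric] by (simp add: algebra_simps)
    have mz: "complex_of_real (1 + (d\<phi> 2 s)\<^sup>2) * complex_of_real (hess 1 1 s) + complex_of_real (1 + (d\<phi> 1 s)\<^sup>2) * complex_of_real (hess 2 2 s)
        = complex_of_real (d\<phi> 1 s * d\<phi> 2 s) * (complex_of_real (hess 1 2 s) + complex_of_real (hess 2 1 s))"
      using mean_curvature_zero[OF s mean[OF s]] phi_hessian_symmetric[OF s, of 2 1]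
      by (simp only: of_real_mult[symmetric] of_real_add[symmetric] of_real_eq_iff) simp
    have sumY: "Z s \<tau>
        = ?A * divergence U ?x - ?B (conormal s) (conormal s)"
    proof -
      have "Z s \<tau>
        = (complex_of_real (1 + (d\<phi> 2 s)\<^sup>2) * complex_of_real (hess 1 1 s) + complex_of_real (1 + (d\<phi> 1 s)\<^sup>2) * complex_of_real (hess 2 2 s)
            - complex_of_real (d\<phi> 1 s * d\<phi> 2 s) * (complex_of_real (hess 1 2 s) + complex_of_real (hess 2 1 s))) * rdot vertical (U ?x)
          + (complex_of_real (1 + (d\<phi> 2 s)\<^sup>2) * ?B (tangent 1 s) (tangent 1 s) + complex_of_real (1 + (d\<phi> 1 s)\<^sup>2) * ?B (tangent 2 s) (tangent 2 s)
            - complex_of_real (d\<phi> 1 s * d\<phi> 2 s) * (?B (tangent 1 s) (tangent 2 s) + ?B (tangent 2 s) (tangent 1 s)))"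
        unfolding Z_def Y_def rdot_scaleR_left by (simp only: of_real_minus) algebra
      then show ?thesis unfolding divergence_in_frame mz by simp
    qed
    have "?A \<noteq> 0" using area_pos[of s] by simp
    then show ?thesis unfolding tr sumY by (simp add: field_simps)
  qed
  have "trace_zero V h (\<lambda>s \<tau>. rdot (nrm s) (traction lam \<mu> U (nrm s) (pt s \<tau>)))"
    unfolding trace_zero_def using bc2 slice_cont_rdot_traction[OF U(1) H2 unit_normal_cont] by blast
  moreover have "trace_zero V h Z"
    unfolding Z_def by (intro trace_zero_add[OF h] trace_zero_mult[OF h] Y continuous_intros pderiv_phi_cont)
  ultimately have "trace_zero V h (\<lambda>s \<tau>. complex_of_real (1 / (area s)\<^sup>2) *
      (complex_of_real ((area s)\<^sup>2) * rdot (nrm s) (traction lam \<mu> U (nrm s) (pt s \<tau>)) + complex_of_real (2 * \<mu>) * Z s \<tau>))"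
    using area_pos
    by (intro trace_zero_mult[OF h] trace_zero_add[OF h])
      (auto intro!: continuous_intros area_cont simp: less_le)
  from trace_zero_cong[OF h this eq[symmetric]]
  have "trace_zero V h (\<lambda>s \<tau>. complex_of_real (lam + 2 * \<mu>) * divergence U (pt s \<tau>))" .
  from trace_zero_mult[OF h this continuous_on_const, of "1 / complex_of_real (lam + 2 * \<mu>)"]
  show ?thesis
  proof (rule trace_zero_cong[OF h])
    have "complex_of_real (lam + 2 * \<mu>) \<noteq> 0" using lame by (metis of_real_eq_0_iff)
    then show "divergence U (pt s \<tau>) = 1 / complex_of_real (lam + 2 * \<mu>) * (complex_of_real (lam + 2 * \<mu>) * divergence U (pt s \<tau>))" for s \<tau>
      by (metis (no_types) mult.assoc mult.left_neutral nonzero_eq_divide_eq)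
  qed
qed

text \<open>The tangential part of the gradient of a function that vanishes on the boundary vanishes. By the differential equation
  \<open>curl (curl U)\<close> is a combination of such a gradient and of \<open>U\<close>, whose tangential part vanishes as well.\<close>

lemma fourth_kind_curl_curl:
  assumes U: "smooth_on (- closure D) U" "Hk_near_regular_pieces 3 D U"
    and div: "trace_zero V h (\<lambda>s \<tau>. divergence U (pt s \<tau>))"
    and bc1: "slice_null V (\<lambda>s \<tau>. ccross (cvec (nrm s)) (U (pt s \<tau>)))"
    and pde: "\<And>x. x \<in> - closure D \<Longrightarrow> curl (curl U) x = a *s gradient (divergence U) x + b *s U x"
  shows "slice_null V (\<lambda>s \<tau>. ccross (cvec (nrm s)) (curl (curl U) (pt s \<tau>)))"
proof -
  have ext: "open (- closure D)" by (rule open_Compl[OF closed_closure])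
  have divs: "smooth_on (- closure D) (divergence U)" "Hk_near_regular_pieces 2 D (divergence U)"
    using U by (auto intro!: smooth_on_divergence Hk_divergence simp: numeral_3_eq_3 numeral_2_eq_2)
  have cont: "slice_cont V h (\<lambda>s \<tau>. U (pt s \<tau>))" "slice_cont V h (\<lambda>s \<tau>. curl (curl U) (pt s \<tau>))"
    by (rule slice_cont_smooth[OF U(1)], rule slice_cont_smooth[OF smooth_on_curl[OF ext smooth_on_curl[OF ext U(1)]]])
  have "trace_zero V h (\<lambda>s \<tau>. rdot (tangent j s) (curl (curl U) (pt s \<tau>)))" for j
  proof -
    have "trace_zero V h (\<lambda>s \<tau>. rdot (tangent j s) (U (pt s \<tau>)))"
      using trace_zero_tangential_iff[OF cont(1)] bc1 by blast
    then have "trace_zero V h (\<lambda>s \<tau>. a * dir_deriv (tangent j s) (divergence U) (pt s \<tau>) + b * rdot (tangent j s) (U (pt s \<tau>)))"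
      by (intro trace_zero_add[OF h] trace_zero_mult[OF h trace_zero_tangential_deriv[OF divs div] continuous_on_const]
          trace_zero_mult[OF h _ continuous_on_const])
    then show ?thesis
      by (rule trace_zero_cong[OF h]) (simp add: pde[OF graph_point_exterior] rdot_add rdot_scale rdot_gradient)
  qed
  then show ?thesis using trace_zero_tangential_iff[OF cont(2)] by blast
qed

text \<open>On a flat piece the conormal is locally constant, so differentiating the condition on the normal component of \<open>U\<close>
  shows that the tangential derivatives of \<open>U\<close> have no normal component. Given this, the tangential traction
  and the cross product of the normal with the curl both reduce to multiples of the tangential part of
  the normal derivative of \<open>U\<close>.\<close>

lemma third_kind_curl:
  assumes U: "smooth_on (- closure D) U" "Hk_near_regular_pieces 3 D U"
    and flat: "\<And>s i j. s \<in> V \<Longrightarrow> hess i j s = 0" and mu: "\<mu> \<noteq> 0"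
    and bc1: "slice_null V (\<lambda>s \<tau>. rdot (nrm s) (U (pt s \<tau>)))"
    and bc2: "slice_null V (\<lambda>s \<tau>. ccross (cvec (nrm s)) (traction lam \<mu> U (nrm s) (pt s \<tau>)))"
  shows "slice_null V (\<lambda>s \<tau>. ccross (cvec (nrm s)) (curl U (pt s \<tau>)))"
proof -
  have ext: "open (- closure D)" by (rule open_Compl[OF closed_closure])
  have H2: "Hk_near_regular_pieces 2 D U" by (rule Hk_near_regular_pieces_mono[OF U(2)]) simp
  have cont: "slice_cont V h (\<lambda>s \<tau>. U (pt s \<tau>))" "slice_cont V h (\<lambda>s \<tau>. curl U (pt s \<tau>))"
    by (rule slice_cont_smooth[OF U(1)], rule slice_cont_smooth[OF smooth_on_curl[OF ext U(1)]])
  have "slice_cont V h (\<lambda>s \<tau>. rdot (nrm s) (U (pt s \<tau>)))"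
  proof -
    have "trace_regular V h (\<lambda>s \<tau>. rdot (nrm s) (U (pt s \<tau>)))"
      by (rule trace_regular_rdot[OF h trace_regular_field[OF U(1) Hk_near_regular_pieces_mono[OF U(2)]] unit_normal_cont]) simp
    then show ?thesis by (simp add: trace_regular_def)
  qed
  then have "trace_zero V h (\<lambda>s \<tau>. complex_of_real (area s) * rdot (nrm s) (U (pt s \<tau>)))"
    using bc1 by (intro trace_zero_mult[OF h]) (auto simp: trace_zero_def intro!: continuous_intros area_cont)
  then have zN: "trace_zero V h (\<lambda>s \<tau>. rdot (conormal s) (U (pt s \<tau>)))" by (simp only: rdot_conormal)
  have N: "trace_zero V h (\<lambda>s \<tau>. rdot (conormal s) (dir_deriv (tangent j s) U (pt s \<tau>)))" for j
  proof -
    have "trace_zero V h (\<lambda>s \<tau>. rdot 0 (U (pt s \<tau>)) + rdot (conormal s) (dir_deriv (tangent j s) U (pt s \<tau>)))"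
      by (rule trace_zero_tangential_deriv_rdot[OF U(1) H2 conormal_cont conormal_differentiable(1) continuous_on_const conormal_differentiable(2) zN])
        (simp_all add: flat)
    then show ?thesis by (simp add: rdot_sum)
  qed
  have T: "trace_zero V h (\<lambda>s \<tau>. rdot (tangent j s) (traction lam \<mu> U (nrm s) (pt s \<tau>)))" for j
    using trace_zero_tangential_iff[OF slice_cont_traction[OF U(1) H2]] bc2 by blast
  define w where "w = (\<lambda>s \<tau>. ccross (cvec (nrm s)) (curl U (pt s \<tau>)))"
  have tw: "trace_zero V h (\<lambda>s \<tau>. rdot (tangent j s) (w s \<tau>))" for j
  proof -
    have "trace_zero V h (\<lambda>s \<tau>. complex_of_real (2 / area s) * rdot (conormal s) (dir_deriv (tangent j s) U (pt s \<tau>))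
        + complex_of_real (- 1 / \<mu>) * rdot (tangent j s) (traction lam \<mu> U (nrm s) (pt s \<tau>)))"
      using area_pos by (intro trace_zero_add[OF h] trace_zero_mult[OF h N] trace_zero_mult[OF h T])
        (auto intro!: continuous_intros area_cont simp: less_le)
    then show ?thesis
    proof (rule trace_zero_cong[OF h])
      fix s \<tau> assume s: "s \<in> V" "0 < \<tau>" "\<tau> < h"
      have "U differentiable at (pt s \<tau>)"
        using smooth_on_differentiable[OF U(1)] graph_point_exterior[OF s] by blast
      then have "rdot (tangent j s) (traction lam \<mu> U (nrm s) (pt s \<tau>))
          = complex_of_real \<mu> * (rdot (nrm s) (dir_deriv (tangent j s) U (pt s \<tau>)) + rdot (tangent j s) (dir_deriv (nrm s) U (pt s \<tau>)))"
        by (simp add: rdot_traction rdot_ccross_curl unit_normal_tangent algebra_simps)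
      then show "rdot (tangent j s) (w s \<tau>) = complex_of_real (2 / area s) * rdot (conormal s) (dir_deriv (tangent j s) U (pt s \<tau>))
        + complex_of_real (- 1 / \<mu>) * rdot (tangent j s) (traction lam \<mu> U (nrm s) (pt s \<tau>))"
        using mu area_pos[of s] unfolding w_def rdot_ccross_curl
        by (simp add: rdot_conormal field_simps)
    qed
  qed
  have w_cont: "slice_cont V h w"
    unfolding w_def by (rule slice_cont_normal_cross[OF cont(2)])
  have "slice_null V (\<lambda>s \<tau>. ccross (cvec (nrm s)) (w s \<tau>))"
    using trace_zero_tangential_iff[OF w_cont] tw by blast
  then have zz: "trace_zero V h (\<lambda>s \<tau>. ccross (cvec (nrm s)) (w s \<tau>))"
    unfolding trace_zero_def using slice_cont_normal_cross[OF w_cont] by blast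
  \<comment> \<open>\<open>w\<close> is itself orthogonal to the normal, so it is recovered from its cross product with the normal\<close>
  have "trace_zero V h (\<lambda>s \<tau>. w s \<tau> $ k)" for k
  proof -
    have "trace_zero V h (\<lambda>s \<tau>. rdot (cross3 (nrm s) (axis k 1)) (ccross (cvec (nrm s)) (w s \<tau>)))"
      by (intro trace_zero_rdot[OF h zz] continuous_on_cross unit_normal_cont continuous_on_const)
    moreover have "rdot (nrm s) (w s \<tau>) = 0" for s \<tau> unfolding w_def by (rule rdot_ccross_self)
    ultimately show ?thesis by (simp add: rdot_lagrange unit_normal_unit rdot_axis)
  qed
  then have "trace_zero V h w" by (rule trace_zero_vector[OF h])
  then show ?thesis unfolding w_def trace_zero_def by blast
qed

text \<open>The normal component of \<open>curl (curl U)\<close> is the surface curl of \<open>curl U\<close>, and the tangential part of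
  \<open>curl U\<close> vanishes. On a flat piece differentiating the latter produces no term with the derivative of the frame. The differential equation
  then gives the normal derivative of the divergence.\<close>

lemma third_kind_normal_gradient:
  assumes U: "smooth_on (- closure D) U" "Hk_near_regular_pieces 3 D U"
    and flat: "\<And>s i j. s \<in> V \<Longrightarrow> hess i j s = 0"
    and bc1: "slice_null V (\<lambda>s \<tau>. rdot (nrm s) (U (pt s \<tau>)))"
    and E: "slice_null V (\<lambda>s \<tau>. ccross (cvec (nrm s)) (curl U (pt s \<tau>)))"
    and pde: "\<And>x. x \<in> - closure D \<Longrightarrow> gradient (divergence U) x = a *s curl (curl U) x + b *s U x"
  shows "slice_null V (\<lambda>s \<tau>. rdot (nrm s) (gradient (divergence U) (pt s \<tau>)))"
proof -
  let ?X = "\<lambda>s. cross3 (tangent 1 s) (tangent 2 s)"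
  have ext: "open (- closure D)" by (rule open_Compl[OF closed_closure])
  have Es: "smooth_on (- closure D) (curl U)" "Hk_near_regular_pieces 2 D (curl U)"
    using U by (auto intro!: smooth_on_curl Hk_curl simp: numeral_3_eq_3 numeral_2_eq_2)
  have TE: "trace_zero V h (\<lambda>s \<tau>. rdot (tangent j s) (curl U (pt s \<tau>)))" for j
    using trace_zero_tangential_iff[OF slice_cont_smooth[OF Es(1)]] E by blast
  have TT: "trace_zero V h (\<lambda>s \<tau>. rdot (tangent j s) (dir_deriv (tangent i s) (curl U) (pt s \<tau>)))" for i j
  proof -
    have "trace_zero V h (\<lambda>s \<tau>. rdot 0 (curl U (pt s \<tau>)) + rdot (tangent j s) (dir_deriv (tangent i s) (curl U) (pt s \<tau>)))"
      by (rule trace_zero_tangential_deriv_rdot[OF Es tangent_cont tangent_differentiable(1) continuous_on_const _ TE])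
        (simp_all add: tangent_differentiable(2) flat)
    then show ?thesis by (simp add: rdot_sum)
  qed
  have "trace_zero V h (\<lambda>s \<tau>. rdot (?X s) (curl (curl U) (pt s \<tau>)))"
  proof -
    have "trace_zero V h (\<lambda>s \<tau>. rdot (tangent 2 s) (dir_deriv (tangent 1 s) (curl U) (pt s \<tau>))
        + (- 1) * rdot (tangent 1 s) (dir_deriv (tangent 2 s) (curl U) (pt s \<tau>)))"
      by (intro trace_zero_add[OF h TT] trace_zero_mult[OF h TT continuous_on_const])
    then show ?thesis by (simp add: rdot_curl_cross)
  qed
  then have cc: "trace_zero V h (\<lambda>s \<tau>. complex_of_real ((conormal s \<bullet> ?X s) / area s ^ 3) * rdot (?X s) (curl (curl U) (pt s \<tau>)))"
    using area_pos by (intro trace_zero_mult[OF h])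
      (auto intro!: continuous_intros continuous_on_cross tangent_cont conormal_cont area_cont simp: less_le)
  have ncc: "trace_zero V h (\<lambda>s \<tau>. rdot (nrm s) (curl (curl U) (pt s \<tau>)))"
  proof (rule trace_zero_cong[OF h cc])
    fix s \<tau>
    have "complex_of_real (area s) \<noteq> 0" using area_pos[of s] by simp
    then show "rdot (nrm s) (curl (curl U) (pt s \<tau>))
      = complex_of_real ((conormal s \<bullet> ?X s) / area s ^ 3) * rdot (?X s) (curl (curl U) (pt s \<tau>))"
      using rdot_conormal_cross[of s "curl (curl U) (pt s \<tau>)"] unfolding rdot_unit_normal
      by (simp add: field_simps power2_eq_square power3_eq_cube)
  qed
  have "trace_regular V h (\<lambda>s \<tau>. rdot (nrm s) (U (pt s \<tau>)))"
    by (rule trace_regular_rdot[OF h trace_regular_field[OF U(1) Hk_near_regular_pieces_mono[OF U(2)]] unit_normal_cont]) simp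
  then have nU: "trace_zero V h (\<lambda>s \<tau>. rdot (nrm s) (U (pt s \<tau>)))"
    using bc1 by (simp add: trace_zero_def trace_regular_def)
  have "trace_zero V h (\<lambda>s \<tau>. a * rdot (nrm s) (curl (curl U) (pt s \<tau>)) + b * rdot (nrm s) (U (pt s \<tau>)))"
    by (intro trace_zero_add[OF h] trace_zero_mult[OF h ncc continuous_on_const] trace_zero_mult[OF h nU continuous_on_const])
  then have "trace_zero V h (\<lambda>s \<tau>. rdot (nrm s) (gradient (divergence U) (pt s \<tau>)))"
    by (rule trace_zero_cong[OF h]) (simp add: pde[OF graph_point_exterior] rdot_add rdot_scale)
  then show ?thesis by (simp add: trace_zero_def)
qed

end

section \<open>Plane waves\<close>

lemma plane_wave_nth: "plane_wave \<alpha> p k d x $ l = \<alpha> * exp (\<i> * complex_of_real (k * (d \<bullet> x))) * complex_of_real (p $ l)"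
  by (simp add: plane_wave_def cvec_nth)

lemma exp_plane_has_derivative:
  "((\<lambda>x. exp (\<i> * complex_of_real (k * (d \<bullet> x)))) has_derivative
      (\<lambda>w. exp (\<i> * complex_of_real (k * (d \<bullet> x))) * (\<i> * complex_of_real (k * (d \<bullet> w))))) (at x)"
proof -
  have "((\<lambda>x. \<i> * complex_of_real (k * (d \<bullet> x))) has_derivative (\<lambda>w. \<i> * complex_of_real (k * (d \<bullet> w)))) (at x)"
    by (auto intro!: derivative_eq_intros)
  from has_derivative_compose[OF this DERIV_exp[unfolded has_field_derivative_def]]
  show ?thesis .
qed

lemma plane_wave_has_derivative:
  "(plane_wave \<alpha> p k d has_derivative (\<lambda>w. (\<i> * complex_of_real (k * (d \<bullet> w))) *s plane_wave \<alpha> p k d x)) (at x)"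
proof -
  have "bounded_linear (\<lambda>z. (\<alpha> * z) *s cvec p)"
    by (rule bounded_linear_euclideanI) (simp_all add: vec_eq_iff algebra_simps)
  from bounded_linear.has_derivative[OF this exp_plane_has_derivative] have "((\<lambda>x. (\<alpha> * exp (\<i> * complex_of_real (k * (d \<bullet> x)))) *s cvec p) has_derivative
      (\<lambda>w. (\<alpha> * (exp (\<i> * complex_of_real (k * (d \<bullet> x))) * (\<i> * complex_of_real (k * (d \<bullet> w))))) *s cvec p)) (at x)"
    .
  moreover have "plane_wave \<alpha> p k d = (\<lambda>x. (\<alpha> * exp (\<i> * complex_of_real (k * (d \<bullet> x)))) *s cvec p)"
    by (simp add: fun_eq_iff plane_wave_def)
  ultimately show ?thesis by (simp add: plane_wave_def algebra_simps)
qed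

lemma pderiv_at_plane_wave:
  "pderiv_at j (plane_wave \<alpha> p k d) x = (\<i> * complex_of_real (k * d $ j)) *s plane_wave \<alpha> p k d x"
  unfolding pderiv_at_eqI[OF plane_wave_has_derivative] by (simp add: inner_axis)

lemma plane_wave_smooth: "smooth_on UNIV (plane_wave \<alpha> p k d)"
proof -
  have "\<exists>c. iter_pderiv js (plane_wave \<alpha> p k d) = plane_wave c p k d" for js
  proof (induction js)
    case (Cons j js)
    then obtain c where c: "iter_pderiv js (plane_wave \<alpha> p k d) = plane_wave c p k d" by blast
    have "pderiv_at j (plane_wave c p k d) = plane_wave (\<i> * complex_of_real (k * d $ j) * c) p k d"
      by (rule ext) (simp only: pderiv_at_plane_wave, simp add: plane_wave_def)
    then have "iter_pderiv (j # js) (plane_wave \<alpha> p k d) = plane_wave (\<i> * complex_of_real (k * d $ j) * c) p k d"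
      by (simp only: iter_pderiv_Cons c)
    then show ?case by blast
  qed auto
  then show ?thesis unfolding smooth_on_def
    using plane_wave_has_derivative unfolding differentiable_def by metis
qed

lemma curl_plane_wave: "curl (plane_wave \<alpha> p k d) = plane_wave (\<i> * complex_of_real k * \<alpha>) (cross3 d p) k d"
  by (simp add: fun_eq_iff curl_def pderiv_at_plane_wave vec_eq_iff forall_3 plane_wave_nth cross3_nth algebra_simps)

lemma divergence_plane_wave:
  "divergence (plane_wave \<alpha> p k d) = (\<lambda>x. \<i> * complex_of_real (k * (d \<bullet> p)) * \<alpha> * exp (\<i> * complex_of_real (k * (d \<bullet> x))))"
  by (simp add: fun_eq_iff divergence_def pderiv_at_plane_wave plane_wave_nth sum_3 inner_vec_def algebra_simps)

lemma gradient_exp: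
  "gradient (\<lambda>x. c * exp (\<i> * complex_of_real (k * (d \<bullet> x)))) x = plane_wave (\<i> * complex_of_real k * c) d k d x"
proof -
  have "((\<lambda>x. c * exp (\<i> * complex_of_real (k * (d \<bullet> x)))) has_derivative
      (\<lambda>w. c * (exp (\<i> * complex_of_real (k * (d \<bullet> x))) * (\<i> * complex_of_real (k * (d \<bullet> w)))))) (at x)"
    by (rule has_derivative_mult_right[OF exp_plane_has_derivative])
  from pderiv_at_eqI[OF this] show ?thesis
    by (simp add: gradient_def vec_eq_iff plane_wave_nth inner_axis)
qed

text \<open>Longitudinal and transversal plane waves are eigenfields of the two second-order operators, with plus or minus the
  squared wave number as eigenvalue; so the incident field splits like the total field.\<close>

lemma curl_curl_plane_wave_transversal:
  assumes "norm d = 1" "d \<bullet> p = 0"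
  shows "curl (curl (plane_wave \<alpha> p k d)) x = complex_of_real (k\<^sup>2) *s plane_wave \<alpha> p k d x"
proof -
  have "cross3 d (cross3 d p) = - p"
    using assms Lagrange[of d d p] by (simp add: norm_eq_1)
  then show ?thesis unfolding curl_plane_wave
    by (simp add: vec_eq_iff plane_wave_nth power2_eq_square algebra_simps)
qed

lemma gradient_divergence_plane_wave_longitudinal:
  assumes "norm d = 1"
  shows "gradient (divergence (plane_wave \<alpha> d k d)) x = - (complex_of_real (k\<^sup>2) *s plane_wave \<alpha> d k d x)"
  using assms unfolding divergence_plane_wave gradient_exp
  by (simp add: vec_eq_iff plane_wave_nth power2_eq_square norm_eq_1 algebra_simps)

section \<open>The Navier equation in the exterior\<close>

lemma scaleR_eq_scaleC: "r *\<^sub>R (u :: complex^3) = complex_of_real r *s u"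
  by (simp add: vec_eq_iff scaleR_conv_of_real[where 'a = complex])

lemma ccross_anticomm: "ccross a b = - ccross b a"
  by (simp add: vec_eq_iff forall_3 ccross_nth)

lemma first_order_op_add:
  assumes "f differentiable at x" "g differentiable at x" "\<And>k. bounded_linear (L k)"
  shows "first_order_op L (\<lambda>y. f y + g y) x = first_order_op L f x + first_order_op L g x"
  using assms by (simp add: first_order_op_def pderiv_at_add linear_add bounded_linear.linear sum.distrib)

lemmas divergence_add = first_order_op_add[where L = div_coeff, folded divergence_eq, OF _ _ bounded_linear_coeffs(2)]
lemmas curl_add = first_order_op_add[where L = curl_coeff, folded curl_eq, OF _ _ bounded_linear_coeffs(3)]

lemma differentiable_scaleC:
  fixes f :: "real^3 \<Rightarrow> complex^3"
  assumes "f differentiable at x"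
  shows "(\<lambda>x. c *s f x) differentiable at x"
  by (rule differentiable_bounded_linear[OF _ assms], rule bounded_linear_euclideanI) (simp_all add: vec_eq_iff algebra_simps)

lemma smooth_on_scaleC: "open S \<Longrightarrow> smooth_on S f \<Longrightarrow> smooth_on S (\<lambda>x. c *s (f x :: complex^3))"
  by (rule smooth_on_bounded_linear, assumption, assumption, rule bounded_linear_euclideanI) (simp_all add: vec_eq_iff algebra_simps)

text \<open>The consequences of the differential equation alone, which hold in any open set.\<close>

locale navier_solution =
  fixes S :: "(real^3) set" and U :: "real^3 \<Rightarrow> complex^3" and lam \<mu> \<omega> ks kp :: real
  assumes S: "open S" and U: "smooth_on S U"
    and mu: "\<mu> > 0" and lame: "lam + 2 * \<mu> > 0" and om: "\<omega> > 0"
    and ks: "ks = \<omega> / sqrt \<mu>" and kp: "kp = \<omega> / sqrt (lam + 2 * \<mu>)"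
    and pde: "\<And>x. x \<in> S \<Longrightarrow> \<mu> *\<^sub>R laplacian U x + (lam + \<mu>) *\<^sub>R gradient (divergence U) x + \<omega>\<^sup>2 *\<^sub>R U x = 0"
begin

lemma ks_pos: "ks > 0" and kp_pos: "kp > 0"
  using mu lame om by (simp_all add: ks kp)

lemma ks_square: "ks\<^sup>2 = \<omega>\<^sup>2 / \<mu>" and kp_square: "kp\<^sup>2 = \<omega>\<^sup>2 / (lam + 2 * \<mu>)"
  using mu lame by (simp_all add: ks kp power_divide)

lemma div_smooth: "smooth_on S (divergence U)" and curl_smooth: "smooth_on S (curl U)"
  and graddiv_smooth: "smooth_on S (gradient (divergence U))" and curlcurl_smooth: "smooth_on S (curl (curl U))"
  by (intro smooth_on_gradient smooth_on_divergence smooth_on_curl S U)+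

text \<open>The Navier equation with the Laplacian replaced by \<open>gradient (divergence U) - curl (curl U)\<close>. The
  identities that follow are its divergence, its curl, and its two rearrangements.\<close>

lemma helmholtz_decomposition:
  assumes x: "x \<in> S"
  shows "U x = complex_of_real (1 / ks\<^sup>2) *s curl (curl U) x - complex_of_real (1 / kp\<^sup>2) *s gradient (divergence U) x"
proof -
  have lap: "laplacian U x = gradient (divergence U) x - curl (curl U) x" using curl_curl[OF S U x] by simp
  have "(lam + 2 * \<mu>) *\<^sub>R gradient (divergence U) x = \<mu> *\<^sub>R gradient (divergence U) x + (lam + \<mu>) *\<^sub>R gradient (divergence U) x"
    by (simp flip: scaleR_add_left)
  then have "(lam + 2 * \<mu>) *\<^sub>R gradient (divergence U) x - \<mu> *\<^sub>R curl (curl U) x + \<omega>\<^sup>2 *\<^sub>R U x = 0"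
    using pde[OF x] unfolding lap by (simp add: scaleR_diff_right diff_add_eq)
  then have "\<omega>\<^sup>2 *\<^sub>R U x = \<mu> *\<^sub>R curl (curl U) x - (lam + 2 * \<mu>) *\<^sub>R gradient (divergence U) x"
    by (simp add: algebra_simps add_eq_0_iff)
  then have "(1 / \<omega>\<^sup>2) *\<^sub>R (\<omega>\<^sup>2 *\<^sub>R U x) = (1 / ks\<^sup>2) *\<^sub>R curl (curl U) x - (1 / kp\<^sup>2) *\<^sub>R gradient (divergence U) x"
    unfolding ks_square kp_square by (simp add: scaleR_diff_right)
  then show ?thesis using om by (simp add: scaleR_eq_scaleC)
qed

lemma decomposition_local:
  assumes "x \<in> S"
  shows "divergence U x = divergence (\<lambda>x. complex_of_real (1 / ks\<^sup>2) *s curl (curl U) x - complex_of_real (1 / kp\<^sup>2) *s gradient (divergence U) x) x"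
    and "curl U x = curl (\<lambda>x. complex_of_real (1 / ks\<^sup>2) *s curl (curl U) x - complex_of_real (1 / kp\<^sup>2) *s gradient (divergence U) x) x"
  using divergence_cong[OF S assms helmholtz_decomposition] curl_cong[OF S assms helmholtz_decomposition] by simp_all

lemma divergence_helmholtz:
  assumes x: "x \<in> S"
  shows "laplacian (divergence U) x = - (complex_of_real (kp\<^sup>2) * divergence U x)"
proof -
  have d: "curl (curl U) differentiable at x" "gradient (divergence U) differentiable at x"
    using smooth_on_differentiable curlcurl_smooth graddiv_smooth x by blast+
  have "divergence U x = complex_of_real (1 / ks\<^sup>2) * divergence (curl (curl U)) x - complex_of_real (1 / kp\<^sup>2) * divergence (gradient (divergence U)) x"
    by (subst decomposition_local(1)[OF x]) (simp only: divergence_diff[OF differentiable_scaleC[OF d(1)] differentiable_scaleC[OF d(2)]] divergence_scaleC[OF d(1)] divergence_scaleC[OF d(2)])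
  also have "\<dots> = - (complex_of_real (1 / kp\<^sup>2) * laplacian (divergence U) x)"
    by (simp only: divergence_curl[OF S curl_smooth x] divergence_gradient[OF S div_smooth x]) simp
  finally have "complex_of_real (kp\<^sup>2) * divergence U x = - (complex_of_real (kp\<^sup>2) * complex_of_real (1 / kp\<^sup>2) * laplacian (divergence U) x)"
    by (simp only: mult_minus_right mult.assoc)
  also have "complex_of_real (kp\<^sup>2) * complex_of_real (1 / kp\<^sup>2) = 1"
    using kp_pos by (simp flip: of_real_mult)
  finally show ?thesis by simp
qed

lemma curl_curl_curl:
  assumes x: "x \<in> S"
  shows "curl (curl (curl U)) x = complex_of_real (ks\<^sup>2) *s curl U x"
proof -
  have d: "curl (curl U) differentiable at x" "gradient (divergence U) differentiable at x"
    using smooth_on_differentiable curlcurl_smooth graddiv_smooth x by blast+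
  have "curl U x = complex_of_real (1 / ks\<^sup>2) *s curl (curl (curl U)) x - complex_of_real (1 / kp\<^sup>2) *s curl (gradient (divergence U)) x"
    by (subst decomposition_local(2)[OF x]) (simp only: curl_diff[OF differentiable_scaleC[OF d(1)] differentiable_scaleC[OF d(2)]] curl_scaleC[OF d(1)] curl_scaleC[OF d(2)])
  also have "\<dots> = complex_of_real (1 / ks\<^sup>2) *s curl (curl (curl U)) x"
    by (simp only: curl_gradient[OF S div_smooth x]) simp
  finally have "complex_of_real (ks\<^sup>2) *s curl U x = (complex_of_real (ks\<^sup>2) * complex_of_real (1 / ks\<^sup>2)) *s curl (curl (curl U)) x"
    by (simp only: vector_smult_assoc)
  also have "complex_of_real (ks\<^sup>2) * complex_of_real (1 / ks\<^sup>2) = 1"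
    using ks_pos by (simp flip: of_real_mult)
  finally show ?thesis by simp
qed

lemma curl_curl_from_pde:
  assumes "x \<in> S"
  shows "curl (curl U) x = complex_of_real (ks\<^sup>2 / kp\<^sup>2) *s gradient (divergence U) x + complex_of_real (ks\<^sup>2) *s U x"
proof -
  have "complex_of_real (ks\<^sup>2) *s U x = (complex_of_real (ks\<^sup>2) * complex_of_real (1 / ks\<^sup>2)) *s curl (curl U) x
      - (complex_of_real (ks\<^sup>2) * complex_of_real (1 / kp\<^sup>2)) *s gradient (divergence U) x"
    by (subst helmholtz_decomposition[OF assms]) (simp only: vector_smult_assoc vector_ssub_ldistrib)
  also have "complex_of_real (ks\<^sup>2) * complex_of_real (1 / ks\<^sup>2) = 1"
    using ks_pos by (simp flip: of_real_mult)
  finally show ?thesis by simp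
qed

lemma gradient_divergence_from_pde:
  assumes "x \<in> S"
  shows "gradient (divergence U) x = complex_of_real (kp\<^sup>2 / ks\<^sup>2) *s curl (curl U) x + complex_of_real (- (kp\<^sup>2)) *s U x"
proof -
  have "complex_of_real (kp\<^sup>2) *s U x = (complex_of_real (kp\<^sup>2) * complex_of_real (1 / ks\<^sup>2)) *s curl (curl U) x
      - (complex_of_real (kp\<^sup>2) * complex_of_real (1 / kp\<^sup>2)) *s gradient (divergence U) x"
    by (subst helmholtz_decomposition[OF assms]) (simp only: vector_smult_assoc vector_ssub_ldistrib)
  also have "complex_of_real (kp\<^sup>2) * complex_of_real (1 / kp\<^sup>2) = 1"
    using kp_pos by (simp flip: of_real_mult)
  finally show ?thesis by (simp add: vec_eq_iff)
qed

end

section \<open>Decoupling of the elastic scattering problem\<close>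

lemma C21_chart_exterior:
  assumes "C21_chart D Q \<phi> V"
  obtains h where "graph_chart_exterior D Q \<phi> V h"
  using assms unfolding C21_chart_def graph_chart_exterior_def by blast

context graph_chart_exterior
begin

lemma admissible_curvature:
  assumes "admissible D K" "s \<in> V"
  shows "zero_mean_curvature_at D (graph_point Q \<phi> s 0)"
    and "K = Third_Kind \<Longrightarrow> zero_gaussian_curvature_at D (graph_point Q \<phi> s 0)"
  using assms(1) regular_piece[OF assms(2)] unfolding admissible_def by (cases K; force)+

end

text \<open>The radiation conditions concern a neighbourhood of infinity, where all fields are smooth.\<close>

lemma eventually_exterior:
  assumes "scatterer D"
  shows "eventually (\<lambda>x. x \<in> - closure D) at_infinity"
proof -
  have "bounded (closure D)" using assms unfolding scatterer_def by auto
  then obtain b where "\<forall>x\<in>closure D. norm x \<le> b" unfolding bounded_iff by blast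
  then have "\<forall>x. b + 1 \<le> norm x \<longrightarrow> x \<in> - closure D" by force
  then show ?thesis unfolding eventually_at_infinity by blast
qed

lemma rdot_minus: "rdot a (- u) = - rdot a u"
  by (simp add: rdot_sum sum_negf)

lemma fourth_kind_boundary:
  assumes adm: "admissible D Fourth_Kind" and U: "Hk_near_regular_pieces 3 D U"
    and N: "navier_solution (- closure D) U lam \<mu> \<omega> ks kp"
    and bc1: "vanishes_on_boundary D (\<lambda>\<nu> x. ccross (cvec \<nu>) (U x))"
    and bc2: "vanishes_on_boundary D (\<lambda>\<nu> x. cdot (cvec \<nu>) (traction lam \<mu> U \<nu> x))"
  shows "vanishes_on_boundary D (\<lambda>\<nu> x. - divergence U x)"
    and "vanishes_on_boundary D (\<lambda>\<nu> x. ccross (cvec \<nu>) (curl (curl U) x))"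
proof -
  interpret N: navier_solution "- closure D" U lam \<mu> \<omega> ks kp by (rule N)
  have "slice_null V (\<lambda>s \<tau>. - divergence U (graph_point Q \<phi> s \<tau>)) \<and>
      slice_null V (\<lambda>s \<tau>. ccross (cvec (unit_normal Q \<phi> s)) (curl (curl U) (graph_point Q \<phi> s \<tau>)))"
    if C: "C21_chart D Q \<phi> V" for Q \<phi> V
  proof -
    obtain h where "graph_chart_exterior D Q \<phi> V h" using C21_chart_exterior[OF C] .
    then interpret graph_chart_exterior D Q \<phi> V h .
    have b1: "slice_null V (\<lambda>s \<tau>. ccross (cvec (unit_normal Q \<phi> s)) (U (graph_point Q \<phi> s \<tau>)))"
      using bc1 C unfolding vanishes_on_boundary_iff by blast
    have b2: "slice_null V (\<lambda>s \<tau>. rdot (unit_normal Q \<phi> s) (traction lam \<mu> U (unit_normal Q \<phi> s) (graph_point Q \<phi> s \<tau>)))"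
      using bc2 C unfolding vanishes_on_boundary_iff rdot_def by blast
    have "lam + 2 * \<mu> \<noteq> 0" using N.lame by simp
    then have div: "trace_zero V h (\<lambda>s \<tau>. divergence U (graph_point Q \<phi> s \<tau>))"
      using fourth_kind_divergence[OF N.U U admissible_curvature(1)[OF adm] _ b1 b2] by blast
    then have "slice_null V (\<lambda>s \<tau>. - divergence U (graph_point Q \<phi> s \<tau>))"
    proof -
      have "slice_null V (\<lambda>s \<tau>. divergence U (graph_point Q \<phi> s \<tau>))" using div by (simp add: trace_zero_def)
      then show ?thesis by (rule slice_null_mono[OF _ h]) simp
    qed
    then show ?thesis
      using fourth_kind_curl_curl[OF N.U U div b1 N.curl_curl_from_pde] by blast
  qed
  then show "vanishes_on_boundary D (\<lambda>\<nu> x. - divergence U x)"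
    and "vanishes_on_boundary D (\<lambda>\<nu> x. ccross (cvec \<nu>) (curl (curl U) x))"
    unfolding vanishes_on_boundary_iff by blast+
qed

lemma third_kind_boundary:
  assumes adm: "admissible D Third_Kind" and U: "Hk_near_regular_pieces 3 D U"
    and N: "navier_solution (- closure D) U lam \<mu> \<omega> ks kp"
    and bc1: "vanishes_on_boundary D (\<lambda>\<nu> x. cdot (cvec \<nu>) (U x))"
    and bc2: "vanishes_on_boundary D (\<lambda>\<nu> x. ccross (cvec \<nu>) (traction lam \<mu> U \<nu> x))"
  shows "vanishes_on_boundary D (\<lambda>\<nu> x. cdot (cvec \<nu>) (gradient (\<lambda>x. - divergence U x) x))"
    and "vanishes_on_boundary D (\<lambda>\<nu> x. ccross (cvec \<nu>) (curl U x))"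
proof -
  interpret N: navier_solution "- closure D" U lam \<mu> \<omega> ks kp by (rule N)
  have "slice_null V (\<lambda>s \<tau>. cdot (cvec (unit_normal Q \<phi> s)) (gradient (\<lambda>x. - divergence U x) (graph_point Q \<phi> s \<tau>))) \<and>
      slice_null V (\<lambda>s \<tau>. ccross (cvec (unit_normal Q \<phi> s)) (curl U (graph_point Q \<phi> s \<tau>)))"
    if C: "C21_chart D Q \<phi> V" for Q \<phi> V
  proof -
    obtain h where "graph_chart_exterior D Q \<phi> V h" using C21_chart_exterior[OF C] .
    then interpret graph_chart_exterior D Q \<phi> V h .
    have b1: "slice_null V (\<lambda>s \<tau>. rdot (unit_normal Q \<phi> s) (U (graph_point Q \<phi> s \<tau>)))"
      using bc1 C unfolding vanishes_on_boundary_iff rdot_def by blast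
    have b2: "slice_null V (\<lambda>s \<tau>. ccross (cvec (unit_normal Q \<phi> s)) (traction lam \<mu> U (unit_normal Q \<phi> s) (graph_point Q \<phi> s \<tau>)))"
      using bc2 C unfolding vanishes_on_boundary_iff by blast
    have flat: "hess i j s = 0" if "s \<in> V" for i j s
      using flat_hessian_zero[OF that admissible_curvature(1)[OF adm that] admissible_curvature(2)[OF adm that refl]] .
    have mu: "\<mu> \<noteq> 0" using N.mu by simp
    have E: "slice_null V (\<lambda>s \<tau>. ccross (cvec (unit_normal Q \<phi> s)) (curl U (graph_point Q \<phi> s \<tau>)))"
      by (rule third_kind_curl[OF N.U U flat mu b1 b2])
    have "slice_null V (\<lambda>s \<tau>. rdot (unit_normal Q \<phi> s) (gradient (divergence U) (graph_point Q \<phi> s \<tau>)))"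
      by (rule third_kind_normal_gradient[OF N.U U flat b1 E N.gradient_divergence_from_pde])
    then have "slice_null V (\<lambda>s \<tau>. cdot (cvec (unit_normal Q \<phi> s)) (gradient (\<lambda>x. - divergence U x) (graph_point Q \<phi> s \<tau>)))"
    proof (rule slice_null_mono[OF _ h])
      fix s \<tau> assume s: "s \<in> V" "0 < \<tau>" "\<tau> < h"
      have "gradient (\<lambda>x. (- 1) * divergence U x) (graph_point Q \<phi> s \<tau>) = (- 1) *s gradient (divergence U) (graph_point Q \<phi> s \<tau>)"
        by (rule gradient_scaleC[OF smooth_on_differentiable[OF N.div_smooth graph_point_exterior[OF s]]])
      then show "norm (cdot (cvec (unit_normal Q \<phi> s)) (gradient (\<lambda>x. - divergence U x) (graph_point Q \<phi> s \<tau>)))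
        \<le> norm (rdot (unit_normal Q \<phi> s) (gradient (divergence U) (graph_point Q \<phi> s \<tau>)))"
        by (simp add: rdot_minus flip: rdot_def)
    qed
    then show ?thesis using E by blast
  qed
  then show "vanishes_on_boundary D (\<lambda>\<nu> x. cdot (cvec \<nu>) (gradient (\<lambda>x. - divergence U x) x))"
    and "vanishes_on_boundary D (\<lambda>\<nu> x. ccross (cvec \<nu>) (curl U x))"
    unfolding vanishes_on_boundary_iff by blast+
qed

lemma Hk_near_regular_pieces_uminus:
  fixes v :: "real^3 \<Rightarrow> complex"
  assumes v: "smooth_on (- closure D) v" and H: "Hk_near_regular_pieces k D v"
  shows "Hk_near_regular_pieces k D (\<lambda>x. - v x)"
  unfolding Hk_near_regular_pieces_def
proof
  fix y assume "y \<in> regular_points D"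
  then obtain W where W: "open W" "y \<in> W" "sobolev_bounded k (W - closure D) v"
    using H unfolding Hk_near_regular_pieces_def by blast
  have S: "open (W - closure D)" using W(1) by (rule open_Diff[OF _ closed_closure])
  have vS: "smooth_on (W - closure D) v" by (rule smooth_on_subset[OF v]) blast
  have "sqint (W - closure D) (iter_pderiv js (\<lambda>x. - v x)) = sqint (W - closure D) (iter_pderiv js v)" for js
  proof -
    have "iter_pderiv js (\<lambda>x. - v x) x = - iter_pderiv js v x" if "x \<in> W - closure D" for x
      using iter_pderiv_sum_bounded_linear[OF S vS bounded_linear_minus[OF bounded_linear_ident] _ that, of "{()}" js] by simp
    then show ?thesis by (intro antisym sqint_mono) auto
  qed
  then have "sobolev_bounded k (W - closure D) (\<lambda>x. - v x)" using W(3) by (simp add: sobolev_bounded_iff)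
  then show "\<exists>W. open W \<and> y \<in> W \<and> sobolev_bounded k (W - closure D) (\<lambda>x. - v x)" using W by blast
qed

theorem theorem4p1:
  fixes lam \<mu> \<omega> ks kp :: real
    and D :: "(real^3) set" and K :: elastic_kind
    and d d_perp :: "real^3" and \<alpha>p \<alpha>s :: complex
    and Uin Uin_p Uin_s U Usc Usc_p Usc_s U_p U_s :: "real^3 \<Rightarrow> complex^3"
    and v_p vin_p :: "real^3 \<Rightarrow> complex" and E_s Ein_s :: "real^3 \<Rightarrow> complex^3"
  assumes "\<mu> > 0" and "3 * lam + 2 * \<mu> > 0" and "\<omega> > 0"
    and "ks = \<omega> / sqrt \<mu>" and "kp = \<omega> / sqrt (lam + 2 * \<mu>)"
    and "admissible D K"
    and "norm d = 1" and "norm d_perp = 1" and "d \<bullet> d_perp = 0"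
    and "Uin_p = plane_wave \<alpha>p d kp d" and "Uin_s = plane_wave \<alpha>s d_perp ks d"
    and "Uin = (\<lambda>x. Uin_p x + Uin_s x)"
    and "elastic_solution lam \<mu> \<omega> D K Uin U"
    and "Usc = (\<lambda>x. U x - Uin x)"
    and "Usc_p = (\<lambda>x. - (1 / kp\<^sup>2) *\<^sub>R gradient (divergence Usc) x)"
    and "Usc_s = (\<lambda>x. (1 / ks\<^sup>2) *\<^sub>R curl (curl Usc) x)"
    and "U_p = (\<lambda>x. Uin_p x + Usc_p x)" and "U_s = (\<lambda>x. Uin_s x + Usc_s x)"
    and "v_p = (\<lambda>x. - divergence U x)" and "E_s = curl U"
    and "vin_p = (\<lambda>x. - divergence Uin x)" and "Ein_s = curl Uin"
  shows "(\<forall>x\<in>- closure D. U x = U_s x + U_p x \<and>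
            U_s x = (1 / ks\<^sup>2) *\<^sub>R curl E_s x \<and>
            U_p x = (1 / kp\<^sup>2) *\<^sub>R gradient v_p x) \<and>
         acoustic_solution kp D (acoustic_kind_of K) vin_p v_p \<and>
         em_solution ks D (em_kind_of K) Ein_s E_s"
proof -
  note mu = \<open>\<mu> > 0\<close> and om = \<open>\<omega> > 0\<close> and ks = \<open>ks = \<omega> / sqrt \<mu>\<close> and kp = \<open>kp = \<omega> / sqrt (lam + 2 * \<mu>)\<close>
    and adm = \<open>admissible D K\<close> and sol = \<open>elastic_solution lam \<mu> \<omega> D K Uin U\<close>
    and Uin_p = \<open>Uin_p = plane_wave \<alpha>p d kp d\<close> and Uin_s = \<open>Uin_s = plane_wave \<alpha>s d_perp ks d\<close>
    and Uin = \<open>Uin = (\<lambda>x. Uin_p x + Uin_s x)\<close> and Usc = \<open>Usc = (\<lambda>x. U x - Uin x)\<close>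
  let ?S = "- closure D"
  have lame: "lam + 2 * \<mu> > 0" using mu \<open>3 * lam + 2 * \<mu> > 0\<close> by linarith
  have S: "open ?S" by (rule open_Compl[OF closed_closure])
  have sc: "scatterer D" using adm unfolding admissible_def by blast
  have U: "smooth_on ?S U" and H3: "Hk_near_regular_pieces 3 D U"
    and pde: "\<And>x. x \<in> ?S \<Longrightarrow> \<mu> *\<^sub>R laplacian U x + (lam + \<mu>) *\<^sub>R gradient (divergence U) x + \<omega>\<^sup>2 *\<^sub>R U x = 0"
    and rad: "kupradze_radiation ks kp Usc"
    using sol unfolding elastic_solution_def ks kp Usc by auto
  interpret navier_solution ?S U lam \<mu> \<omega> ks kp
    using S U mu lame om ks kp pde by unfold_locales


  have wave: "smooth_on UNIV Uin_p" "smooth_on UNIV Uin_s"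
    unfolding Uin_p Uin_s by (rule plane_wave_smooth)+
  have wave_diff: "Uin_p differentiable at x" "Uin_s differentiable at x" for x
    using smooth_on_differentiable[OF wave(1)] smooth_on_differentiable[OF wave(2)] by simp_all
  have Uin_smooth: "smooth_on ?S Uin"
  proof -
    have "smooth_on UNIV (\<lambda>x. Uin_p x - (- 1) *s Uin_s x)"
      by (intro smooth_on_diff smooth_on_scaleC wave open_UNIV)
    then have "smooth_on UNIV Uin" by (simp add: Uin)
    then show ?thesis by (rule smooth_on_subset) simp
  qed
  have div_s: "divergence Uin_s = (\<lambda>x. 0)"
    unfolding Uin_s divergence_plane_wave using \<open>d \<bullet> d_perp = 0\<close> by simp
  have curl_p: "curl Uin_p = (\<lambda>x. 0)"
    unfolding Uin_p curl_plane_wave by (simp add: fun_eq_iff vec_eq_iff plane_wave_nth)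
  have div_in: "divergence Uin = divergence Uin_p"
    unfolding Uin by (rule ext) (simp add: divergence_add[OF wave_diff] div_s)
  have curl_in: "curl Uin = curl Uin_s"
    unfolding Uin by (rule ext) (simp add: curl_add[OF wave_diff] curl_p)
  have grad_div_in: "gradient (divergence Uin) x = - (complex_of_real (kp\<^sup>2) *s Uin_p x)" for x
    unfolding div_in Uin_p by (rule gradient_divergence_plane_wave_longitudinal[OF \<open>norm d = 1\<close>])
  have curl_curl_in: "curl (curl Uin) x = complex_of_real (ks\<^sup>2) *s Uin_s x" for x
    unfolding curl_in Uin_s by (rule curl_curl_plane_wave_transversal[OF \<open>norm d = 1\<close> \<open>d \<bullet> d_perp = 0\<close>])

  note diff = smooth_on_differentiable
  have div_sc: "divergence Usc x = divergence U x - divergence Uin x" if "x \<in> ?S" for x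
    unfolding Usc by (rule divergence_diff[OF diff[OF U that] diff[OF Uin_smooth that]])
  have curl_sc: "curl Usc x = curl U x - curl Uin x" if "x \<in> ?S" for x
    unfolding Usc by (rule curl_diff[OF diff[OF U that] diff[OF Uin_smooth that]])
  have grad_div_sc: "gradient (divergence Usc) x = gradient (divergence U) x - gradient (divergence Uin) x" if x: "x \<in> ?S" for x
    using gradient_cong[OF S x div_sc]
      gradient_diff[OF diff[OF div_smooth x] diff[OF smooth_on_divergence[OF S Uin_smooth] x]] by simp
  have curl_curl_sc: "curl (curl Usc) x = curl (curl U) x - curl (curl Uin) x" if x: "x \<in> ?S" for x
    using curl_cong[OF S x curl_sc]
      curl_diff[OF diff[OF curl_smooth x] diff[OF smooth_on_curl[OF S Uin_smooth] x]] by simp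
  have grad_vp: "gradient v_p x = - gradient (divergence U) x" if x: "x \<in> ?S" for x
    using gradient_scaleC[OF diff[OF div_smooth x], of "- 1"] \<open>v_p = (\<lambda>x. - divergence U x)\<close> by (simp add: vec_eq_iff)

  have kk: "complex_of_real (1 / kp\<^sup>2) * complex_of_real (kp\<^sup>2) = 1" "complex_of_real (1 / ks\<^sup>2) * complex_of_real (ks\<^sup>2) = 1"
    using kp_pos ks_pos by (simp_all flip: of_real_mult)
  have Up: "U_p x = (1 / kp\<^sup>2) *\<^sub>R gradient v_p x" if x: "x \<in> ?S" for x
  proof -
    have "U_p x = Uin_p x - complex_of_real (1 / kp\<^sup>2) *s (gradient (divergence U) x + complex_of_real (kp\<^sup>2) *s Uin_p x)"
      using \<open>U_p = _\<close> \<open>Usc_p = _\<close> grad_div_sc[OF x] grad_div_in[of x] by (simp add: scaleR_eq_scaleC)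
    also have "\<dots> = - (complex_of_real (1 / kp\<^sup>2) *s gradient (divergence U) x)"
      by (simp only: vector_add_ldistrib vector_smult_assoc kk) simp
    finally show ?thesis by (simp add: grad_vp[OF x] scaleR_eq_scaleC)
  qed
  have Us: "U_s x = (1 / ks\<^sup>2) *\<^sub>R curl E_s x" if x: "x \<in> ?S" for x
  proof -
    have "U_s x = Uin_s x + complex_of_real (1 / ks\<^sup>2) *s (curl (curl U) x - complex_of_real (ks\<^sup>2) *s Uin_s x)"
      using \<open>U_s = _\<close> \<open>Usc_s = _\<close> curl_curl_sc[OF x] curl_curl_in[of x] by (simp add: scaleR_eq_scaleC)
    also have "\<dots> = complex_of_real (1 / ks\<^sup>2) *s curl (curl U) x"
      by (simp only: vector_ssub_ldistrib vector_smult_assoc kk) simp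
    finally show ?thesis using \<open>E_s = curl U\<close> by (simp add: scaleR_eq_scaleC)
  qed
  have split: "U x = U_s x + U_p x" if x: "x \<in> ?S" for x
    using helmholtz_decomposition[OF x] \<open>E_s = curl U\<close>
    by (simp add: Us[OF x] Up[OF x] grad_vp[OF x] scaleR_eq_scaleC)

  have H2: "Hk_near_regular_pieces 2 D (divergence U)" "Hk_near_regular_pieces 2 D (curl U)"
    using U H3 by (auto intro!: Hk_divergence Hk_curl simp: numeral_3_eq_3 numeral_2_eq_2)
  have bc: "case K of Third_Kind \<Rightarrow>
          vanishes_on_boundary D (\<lambda>\<nu> x. cdot (cvec \<nu>) (U x)) \<and>
          vanishes_on_boundary D (\<lambda>\<nu> x. ccross (cvec \<nu>) (traction lam \<mu> U \<nu> x))
      | Fourth_Kind \<Rightarrow>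
          vanishes_on_boundary D (\<lambda>\<nu> x. ccross (cvec \<nu>) (U x)) \<and>
          vanishes_on_boundary D (\<lambda>\<nu> x. cdot (cvec \<nu>) (traction lam \<mu> U \<nu> x))"
    using sol unfolding elastic_solution_def by blast
  note ev = eventually_exterior[OF sc]

  have "acoustic_solution kp D (acoustic_kind_of K) vin_p v_p"
    unfolding acoustic_solution_def Let_def
  proof (intro conjI ballI)
    have vp: "v_p = (\<lambda>x. - divergence U x)" by fact
    show vs: "smooth_on ?S v_p"
      unfolding vp by (rule smooth_on_bounded_linear[OF S div_smooth bounded_linear_minus[OF bounded_linear_ident]])
    show "Hk_near_regular_pieces 2 D v_p"
      unfolding vp by (rule Hk_near_regular_pieces_uminus[OF div_smooth H2(1)])
    show "laplacian v_p x + kp\<^sup>2 *\<^sub>R v_p x = 0" if x: "x \<in> ?S" for x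
    proof -
      have "laplacian v_p x = divergence (gradient v_p) x" by (rule divergence_gradient[OF S vs x, symmetric])
      also have "\<dots> = divergence (\<lambda>x. (- 1) *s gradient (divergence U) x) x"
        by (rule divergence_cong[OF S x]) (simp add: grad_vp vec_eq_iff)
      also have "\<dots> = - divergence (gradient (divergence U)) x"
        by (simp only: divergence_scaleC[OF diff[OF graddiv_smooth x]]) simp
      also have "\<dots> = complex_of_real (kp\<^sup>2) * divergence U x"
        by (simp only: divergence_gradient[OF S div_smooth x] divergence_helmholtz[OF x]) simp
      finally show ?thesis by (simp add: vp scaleR_conv_of_real)
    qed
    have "norm (cdot (cvec (sgn x)) (gradient (\<lambda>x. v_p x - vin_p x) x) - \<i> * complex_of_real kp * (v_p x - vin_p x))
        = norm (cdot (cvec (sgn x)) (gradient (divergence Usc) x) - \<i> * complex_of_real kp * divergence Usc x)" if x: "x \<in> ?S" for x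
    proof -
      have v: "v_p x - vin_p x = (- 1) * divergence Usc x" if "x \<in> ?S" for x
        using \<open>v_p = _\<close> \<open>vin_p = _\<close> div_sc[OF that] by simp
      have Usc_smooth: "smooth_on ?S Usc" unfolding Usc by (rule smooth_on_diff[OF S U Uin_smooth])
      have "gradient (\<lambda>x. v_p x - vin_p x) x = gradient (\<lambda>x. (- 1) * divergence Usc x) x"
        by (rule gradient_cong[OF S x v])
      also have "\<dots> = (- 1) *s gradient (divergence Usc) x"
        by (rule gradient_scaleC[OF diff[OF smooth_on_divergence[OF S Usc_smooth] x]])
      finally have "cdot (cvec (sgn x)) (gradient (\<lambda>x. v_p x - vin_p x) x) - \<i> * complex_of_real kp * (v_p x - vin_p x)
        = - (cdot (cvec (sgn x)) (gradient (divergence Usc) x) - \<i> * complex_of_real kp * divergence Usc x)"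
        unfolding v[OF x] by (simp add: rdot_minus flip: rdot_def)
      then show ?thesis by (simp only: norm_minus_cancel)
    qed
    then have "eventually (\<lambda>x. norm (cdot (cvec (sgn x)) (gradient (\<lambda>x. v_p x - vin_p x) x) - \<i> * complex_of_real kp * (v_p x - vin_p x))
        = norm (cdot (cvec (sgn x)) (gradient (divergence Usc) x) - \<i> * complex_of_real kp * divergence Usc x)) at_infinity"
      using ev by (auto elim: eventually_mono)
    then show "(\<lambda>x. norm (cdot (cvec (sgn x)) (gradient (\<lambda>x. v_p x - vin_p x) x) - \<i> * complex_of_real kp * (v_p x - vin_p x)))
        \<in> O[at_infinity](\<lambda>x. 1 / (norm x)\<^sup>2)"
      using rad unfolding kupradze_radiation_def by (subst landau_o.big.in_cong) auto
    show "case acoustic_kind_of K of Sound_Soft \<Rightarrow> vanishes_on_boundary D (\<lambda>\<nu> x. v_p x)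
      | Sound_Hard \<Rightarrow> vanishes_on_boundary D (\<lambda>\<nu> x. cdot (cvec \<nu>) (gradient v_p x))"
      using third_kind_boundary(1)[OF _ H3 navier_solution_axioms] fourth_kind_boundary(1)[OF _ H3 navier_solution_axioms] bc adm
      unfolding vp by (cases K) auto
  qed
  moreover have "em_solution ks D (em_kind_of K) Ein_s E_s"
    unfolding em_solution_def Let_def
  proof (intro conjI)
    have E: "E_s = curl U" by fact
    show "smooth_on ?S E_s" unfolding E by (rule curl_smooth)
    show "Hk_near_regular_pieces 2 D E_s" unfolding E by (rule H2(2))
    show "\<exists>H. smooth_on ?S H \<and> (\<forall>x\<in>?S. curl E_s x - (\<i> * complex_of_real ks) *s H x = 0 \<and>
        curl H x + (\<i> * complex_of_real ks) *s E_s x = 0)"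
    proof (intro exI conjI ballI)
      let ?k = "\<i> * complex_of_real ks"
      \<comment> \<open>forced by the first Maxwell equation; the second one is then the equation for \<open>curl (curl E_s)\<close>\<close>
      let ?H = "\<lambda>x. (1 / ?k) *s curl E_s x"
      have k0: "?k \<noteq> 0" using ks_pos by simp
      show "smooth_on ?S ?H" unfolding E by (rule smooth_on_scaleC[OF S curlcurl_smooth])
      fix x assume x: "x \<in> ?S"
      show "curl E_s x - ?k *s ?H x = 0" using k0 by (simp add: vector_smult_assoc)
      have "curl ?H x = (1 / ?k) *s curl (curl (curl U)) x"
        unfolding E by (rule curl_scaleC[OF diff[OF curlcurl_smooth x]])
      also have "\<dots> = (1 / ?k * complex_of_real (ks\<^sup>2)) *s curl U x"
        unfolding curl_curl_curl[OF x] by (simp only: vector_smult_assoc)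
      also have "1 / ?k * complex_of_real (ks\<^sup>2) = - ?k"
        using ks_pos by (simp add: field_simps power2_eq_square)
      finally show "curl ?H x + ?k *s E_s x = 0" unfolding E by (simp add: vec_eq_iff)
    qed
    have "norm (ccross (cvec (sgn x)) (curl (\<lambda>x. E_s x - Ein_s x) x) + (\<i> * complex_of_real ks) *s (E_s x - Ein_s x))
        = norm (ccross (curl (curl Usc) x) (cvec (sgn x)) - (\<i> * complex_of_real ks) *s curl Usc x)" if x: "x \<in> ?S" for x
    proof -
      have e: "E_s x - Ein_s x = curl Usc x" if "x \<in> ?S" for x
        using \<open>E_s = _\<close> \<open>Ein_s = _\<close> curl_sc[OF that] by simp
      have "curl (\<lambda>x. E_s x - Ein_s x) x = curl (curl Usc) x" by (rule curl_cong[OF S x e])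
      then have "ccross (cvec (sgn x)) (curl (\<lambda>x. E_s x - Ein_s x) x) + (\<i> * complex_of_real ks) *s (E_s x - Ein_s x)
        = - (ccross (curl (curl Usc) x) (cvec (sgn x)) - (\<i> * complex_of_real ks) *s curl Usc x)"
        unfolding e[OF x] by (subst ccross_anticomm) simp
      then show ?thesis by (simp only: norm_minus_cancel)
    qed
    then have "eventually (\<lambda>x. norm (ccross (cvec (sgn x)) (curl (\<lambda>x. E_s x - Ein_s x) x) + (\<i> * complex_of_real ks) *s (E_s x - Ein_s x))
        = norm (ccross (curl (curl Usc) x) (cvec (sgn x)) - (\<i> * complex_of_real ks) *s curl Usc x)) at_infinity"
      using ev by (auto elim: eventually_mono)
    then show "(\<lambda>x. norm (ccross (cvec (sgn x)) (curl (\<lambda>x. E_s x - Ein_s x) x) + (\<i> * complex_of_real ks) *s (E_s x - Ein_s x)))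
        \<in> O[at_infinity](\<lambda>x. 1 / (norm x)\<^sup>2)"
      using rad unfolding kupradze_radiation_def by (subst landau_o.big.in_cong) auto
    show "case em_kind_of K of PEC \<Rightarrow> vanishes_on_boundary D (\<lambda>\<nu> x. ccross (cvec \<nu>) (E_s x))
      | PMC \<Rightarrow> vanishes_on_boundary D (\<lambda>\<nu> x. ccross (cvec \<nu>) (curl E_s x))"
      using third_kind_boundary(2)[OF _ H3 navier_solution_axioms] fourth_kind_boundary(2)[OF _ H3 navier_solution_axioms] bc adm
      unfolding E by (cases K) auto
  qed
  ultimately show ?thesis using split Us Up by blast
qed

end
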